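(* Let $G,H:I\to\mathbb{R}$ be continuous functions such that for all $x\in I$ $$G(x)\le H(x),\quad E_x\Big[\sup_{t\ge0}|e^{-rt}G(X_t)|\Big]<\infty,\quad E_x\Big[\sup_{t\ge0}|e^{-rt}H(X_t)|\Big]<\infty,$$ $$P_x\Big(\lim_{t\to\infty}e^{-rt}G(X_t)=\lim_{t\to\infty}e^{-rt}H(X_t)\Big)=1.$$ Let $$R_x(\tau,\sigma)=E_x\big[e^{-r(\tau\wedge\sigma)}\big(G(X_\tau)\mathbb{I}_{[\tau\le\sigma]}+H(X_\sigma)\mathbb{I}_{[\tau>\sigma]}\big)\big],$$ $$\mathcal D^+=\{x\in I:\partial^HG(F(x))\ne\emptyset\},\qquad \mathcal D^-=\{x\in I:\partial^GH(F(x))\ne\emptyset\},$$ $$\tau^*=\inf\{t\ge0:X_t\in\mathcal D^+\},\qquad \sigma^*=\inf\{t\ge0:X_t\in\mathcal D^-\}.$$ Then the optimal stopping game with lower value $\sup_\tau\inf_\sigma R_x(\tau,\sigma)$ and upper value $\inf_\sigma\sup_\tau R_x(\tau,\sigma)$ has a Nash equilibrium and $(\tau^*,\sigma^* )$ is a saddle point, i.e. for any stopping times $\tau,\sigma$ $$R_x(\tau,\sigma^* )\le R_x(\tau^*,\sigma^* )\le R_x(\tau^*,\sigma)$$ for all $x\in I$.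
   Context: Setting. $I=(a,b)\subseteq\mathbb{R}$ is an open interval and $X=(X_t)_{t\ge0}$ is a one-dimensional diffusion with state space $I$ on a stochastic basis $(\Omega,\mathcal F,\mathbb F,\{P_x\}_{x\in I})$, $X_0=x$ under $P_x$. Put $T_y=\inf\{t\ge0:X_t=y\}$. The boundaries are natural: $P_x(T_a<\infty)=P_x(T_b<\infty)=0$ for all $x\in I$. $X$ is regular: for all $x\in I$, $P_x(T_y<\infty)>0$ for some $y\in(x,b)$. The generator is $\mathbb{L}_Xf=\mu f'+Df''$ with drift $\mu$ and $D>0$. Fix $r>0$. The ODE $\mathbb{L}_Xf=rf$ on $I$ has positive, continuous, strictly monotone, strictly convex solutions $\varphi$ (increasing) and $\psi$ (decreasing) with $\varphi(a+)=\psi(b-)=0$, $\varphi(b-)=\psi(a+)=+\infty$. $F=\varphi/\psi:I\to(0,\infty)$ is strictly increasing. The game has a Nash equilibrium if it has a saddle point. Transformed functions and generalised differentials. $W^G=(G/\psi)\circ F^{-1}$, $W_H=(H/\psi)\circ F^{-1}$ on $(0,\infty)$. For $f:(0,\infty)\to\mathbb{R}$, $x>0$, $c,p\in\mathbb{R}$: $l_f^x(c,p)=\sup\{z\le x: f(z)-p=c(z-x)\}$, $r_f^x(c,p)=\inf\{y\ge x: f(y)-p=c(y-x)\}$, with $\sup\emptyset=0$, $\inf\emptyset=+\infty$. Write $l_G^x,r_G^x$ for $f=W^G$ and $l_H^x,r_H^x$ for $f=W_H$. For $x>0$, $\partial^GH(x)=\{c\in\mathbb{R}: W_H(y)-W_H(x)\ge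 c(y-x)\ \forall y\in(l_G^x(c,W_H(x)),\,r_G^x(c,W_H(x)))\}$, $\partial^HG(x)=\{c\in\mathbb{R}: W^G(y)-W^G(x)\le c(y-x)\ \forall y\in(l_H^x(c,W^G(x)),\,r_H^x(c,W^G(x)))\}$. *)

theory Defs
  imports "HOL-Probability.Probability"
begin

section \<open>Diffusions on an open interval\<close>

definition generator :: "(real \<Rightarrow> real) \<Rightarrow> (real \<Rightarrow> real) \<Rightarrow> (real \<Rightarrow> real) \<Rightarrow> real \<Rightarrow> real" where
  "generator \<mu> D f x = \<mu> x * deriv f x + D x * deriv (deriv f) x"

definition C2_on :: "real set \<Rightarrow> (real \<Rightarrow> real) \<Rightarrow> bool" where
  "C2_on S f \<longleftrightarrow> f differentiable_on S \<and> deriv f differentiable_on S \<and>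
     continuous_on S (deriv (deriv f))"

definition strictly_convex_on :: "real set \<Rightarrow> (real \<Rightarrow> real) \<Rightarrow> bool" where
  "strictly_convex_on S f \<longleftrightarrow> (\<forall>x\<in>S. \<forall>y\<in>S. \<forall>t. x \<noteq> y \<longrightarrow> 0 < t \<longrightarrow> t < 1 \<longrightarrow>
     f ((1 - t) * x + t * y) < (1 - t) * f x + t * f y)"

text \<open>The infimum is taken in \<^typ>\<open>ennreal\<close>, so that a set that is never reached has hitting
  time \<open>\<infinity>\<close>.\<close>

definition hitting_time :: "(real \<Rightarrow> 'a \<Rightarrow> real) \<Rightarrow> real set \<Rightarrow> 'a \<Rightarrow> ennreal" where
  "hitting_time X A \<omega> = Inf (ennreal ` {t. 0 \<le> t \<and> X t \<omega> \<in> A})"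

text \<open>
  The filtration is indexed by \<open>[0, \<infinity>]\<close>, so that the library's stopping times may take the
  value \<open>\<infinity>\<close>. The index \<open>\<infinity>\<close> imposes no condition on a stopping time.

  A diffusion with generator \<open>L f = \<mu> f' + D f''\<close> is understood as in Revuz and Yor,
  Continuous Martingales and Brownian Motion, Chapter VII: a strong Markov process with continuous
  paths such that \<open>E\<^sub>x f(X\<^sub>t) = f(x) + E\<^sub>x \<integral>\<^sub>0\<^sup>t L f(X\<^sub>s) ds\<close> for the compactly supported test
  functions \<open>f\<close> on the state space. The coefficients are Borel and locally bounded, which makes the
  right-hand side meaningful.

  The paths live in the open interval for all times, so the assumption on the endpoints
  (not attained in finite time) is a consequence; it is kept for the sake of explicitness. If an
  endpoint is infinite, then it is never attained because \<open>X\<close> is real valued.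
\<close>

locale regular_diffusion = filtration "space M" F
  for M :: "'a measure" and F :: "ennreal \<Rightarrow> 'a measure" +
  fixes P :: "real \<Rightarrow> 'a measure" and X :: "real \<Rightarrow> 'a \<Rightarrow> real"
    and a b :: ereal and \<mu> D :: "real \<Rightarrow> real"
  assumes nonempty_interval: "a < b"
    and filtration_sub: "subalgebra M (F t)"
    and prob_space_P: "x \<in> einterval a b \<Longrightarrow> prob_space (P x)"
    and sets_P: "x \<in> einterval a b \<Longrightarrow> sets (P x) = sets M"
    and adapted: "0 \<le> s \<Longrightarrow> X s \<in> borel_measurable (F (ennreal s))"
    and state_space: "0 \<le> s \<Longrightarrow> \<omega> \<in> space M \<Longrightarrow> X s \<omega> \<in> einterval a b"
    and continuous_paths: "\<omega> \<in> space M \<Longrightarrow> continuous_on {0..} (\<lambda>s. X s \<omega>)"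
    and start: "x \<in> einterval a b \<Longrightarrow> AE \<omega> in P x. X 0 \<omega> = x"
    and transition_measurable:
      "0 \<le> s \<Longrightarrow> B \<in> sets borel \<Longrightarrow>
        (\<lambda>x. emeasure (P x) {\<omega> \<in> space M. X s \<omega> \<in> B})
          \<in> borel_measurable (restrict_space borel (einterval a b))"
    and strong_markov:
      "x \<in> einterval a b \<Longrightarrow> stopping_time F \<tau> \<Longrightarrow> A \<in> sets (pre_sigma \<tau>) \<Longrightarrow>
        0 \<le> s \<Longrightarrow> B \<in> sets borel \<Longrightarrow>
        emeasure (P x) {\<omega> \<in> A. \<tau> \<omega> < \<infinity> \<and> X (enn2real (\<tau> \<omega>) + s) \<omega> \<in> B} =
        (\<integral>\<^sup>+\<omega>. emeasure (P (X (enn2real (\<tau> \<omega>)) \<omega>)) {\<omega>' \<in> space M. X s \<omega>' \<in> B} *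
               indicator {\<omega> \<in> A. \<tau> \<omega> < \<infinity>} \<omega> \<partial>P x)"
    and drift_measurable: "\<mu> \<in> borel_measurable (restrict_space borel (einterval a b))"
    and diffusion_measurable: "D \<in> borel_measurable (restrict_space borel (einterval a b))"
    and drift_locally_bounded: "compact K \<Longrightarrow> K \<subseteq> einterval a b \<Longrightarrow> bounded (\<mu> ` K)"
    and diffusion_locally_bounded: "compact K \<Longrightarrow> K \<subseteq> einterval a b \<Longrightarrow> bounded (D ` K)"
    and diffusion_pos: "x \<in> einterval a b \<Longrightarrow> 0 < D x"
    and generator_identity:
      "C2_on UNIV f \<Longrightarrow> compact K \<Longrightarrow> K \<subseteq> einterval a b \<Longrightarrow> (\<And>y. y \<notin> K \<Longrightarrow> f y = 0) \<Longrightarrow>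
        x \<in> einterval a b \<Longrightarrow> 0 \<le> s \<Longrightarrow>
        (LINT \<omega>|P x. f (X s \<omega>)) =
          f x + (LINT \<omega>|P x. (LBINT u:{0..s}. generator \<mu> D f (X u \<omega>)))"
    and natural_boundaries:
      "x \<in> einterval a b \<Longrightarrow> c \<in> {a, b} \<Longrightarrow> AE \<omega> in P x. hitting_time X {y. ereal y = c} \<omega> = \<infinity>"
    and regular:
      "x \<in> einterval a b \<Longrightarrow>
        \<exists>y. x < y \<and> y \<in> einterval a b \<and>
            measure (P x) {\<omega> \<in> space M. hitting_time X {y} \<omega> < \<infinity>} > 0"

definition ode_solution ::
    "ereal \<Rightarrow> ereal \<Rightarrow> (real \<Rightarrow> real) \<Rightarrow> (real \<Rightarrow> real) \<Rightarrow> real \<Rightarrow> (real \<Rightarrow> real) \<Rightarrow> bool" where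
  "ode_solution a b \<mu> D r f \<longleftrightarrow> C2_on (einterval a b) f \<and>
     (\<forall>x\<in>einterval a b. generator \<mu> D f x = r * f x)"

definition fundamental_solutions ::
    "ereal \<Rightarrow> ereal \<Rightarrow> (real \<Rightarrow> real) \<Rightarrow> (real \<Rightarrow> real) \<Rightarrow> real \<Rightarrow>
     (real \<Rightarrow> real) \<Rightarrow> (real \<Rightarrow> real) \<Rightarrow> bool" where
  "fundamental_solutions a b \<mu> D r \<phi> \<psi> \<longleftrightarrow>
     (\<forall>f\<in>{\<phi>, \<psi>}. ode_solution a b \<mu> D r f \<and> (\<forall>x\<in>einterval a b. 0 < f x) \<and>
        strictly_convex_on (einterval a b) f) \<and>
     strict_mono_on (einterval a b) \<phi> \<and> strict_antimono_on (einterval a b) \<psi> \<and>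
     ((\<phi> \<circ> real_of_ereal) \<longlongrightarrow> 0) (at_right a) \<and>
     filterlim (\<phi> \<circ> real_of_ereal) at_top (at_left b) \<and>
     ((\<psi> \<circ> real_of_ereal) \<longlongrightarrow> 0) (at_left b) \<and>
     filterlim (\<psi> \<circ> real_of_ereal) at_top (at_right a)"

section \<open>The optimal stopping game\<close>

text \<open>At \<open>t = \<infinity>\<close> the discounted reward is the limit along the path. Since this limit need not
  vanish, reading \<open>e\<^sup>-\<^sup>r\<^sup>t g(X\<^sub>t)\<close> as \<open>0\<close> there would change the game.\<close>

definition discounted :: "(real \<Rightarrow> 'a \<Rightarrow> real) \<Rightarrow> real \<Rightarrow> (real \<Rightarrow> real) \<Rightarrow> ennreal \<Rightarrow> 'a \<Rightarrow> real" where
  "discounted X r g t \<omega> =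
     (if t = \<infinity> then Lim at_top (\<lambda>s. exp (- r * s) * g (X s \<omega>))
      else exp (- r * enn2real t) * g (X (enn2real t) \<omega>))"

definition expected_payoff ::
    "(real \<Rightarrow> 'a measure) \<Rightarrow> (real \<Rightarrow> 'a \<Rightarrow> real) \<Rightarrow> real \<Rightarrow> (real \<Rightarrow> real) \<Rightarrow> (real \<Rightarrow> real) \<Rightarrow>
     real \<Rightarrow> ('a \<Rightarrow> ennreal) \<Rightarrow> ('a \<Rightarrow> ennreal) \<Rightarrow> real" where
  "expected_payoff P X r G H x \<tau> \<sigma> =
     (LINT \<omega>|P x. (if \<tau> \<omega> \<le> \<sigma> \<omega> then discounted X r G (\<tau> \<omega>) \<omega>
                  else discounted X r H (\<sigma> \<omega>) \<omega>))"

text \<open>Here \<open>R \<tau> \<sigma>\<close> is the payoff that the first player maximises over \<open>\<tau>\<close> and the second player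
  minimises over \<open>\<sigma>\<close>.\<close>

definition saddle_point ::
    "(ennreal \<Rightarrow> 'a measure) \<Rightarrow> (('a \<Rightarrow> ennreal) \<Rightarrow> ('a \<Rightarrow> ennreal) \<Rightarrow> real) \<Rightarrow>
     ('a \<Rightarrow> ennreal) \<Rightarrow> ('a \<Rightarrow> ennreal) \<Rightarrow> bool" where
  "saddle_point F R \<tau>' \<sigma>' \<longleftrightarrow> stopping_time F \<tau>' \<and> stopping_time F \<sigma>' \<and>
     (\<forall>\<tau> \<sigma>. stopping_time F \<tau> \<longrightarrow> stopping_time F \<sigma> \<longrightarrow>
        R \<tau> \<sigma>' \<le> R \<tau>' \<sigma>' \<and> R \<tau>' \<sigma>' \<le> R \<tau>' \<sigma>)"

definition nash_equilibrium ::
    "(ennreal \<Rightarrow> 'a measure) \<Rightarrow> (('a \<Rightarrow> ennreal) \<Rightarrow> ('a \<Rightarrow> ennreal) \<Rightarrow> real) \<Rightarrow> bool" where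
  "nash_equilibrium F R \<longleftrightarrow> (\<exists>\<tau>' \<sigma>'. saddle_point F R \<tau>' \<sigma>')"

section \<open>Generalised differentials\<close>

text \<open>\<open>W\<^sup>G = (G / \<psi>) \<circ> F\<^sup>-\<^sup>1\<close> with \<open>F = \<phi> / \<psi>\<close>; meaningful on \<open>(0, \<infinity>)\<close>.\<close>

definition transformed ::
    "real set \<Rightarrow> (real \<Rightarrow> real) \<Rightarrow> (real \<Rightarrow> real) \<Rightarrow> (real \<Rightarrow> real) \<Rightarrow> real \<Rightarrow> real" where
  "transformed I \<phi> \<psi> g y =
     (let x = the_inv_into I (\<lambda>z. \<phi> z / \<psi> z) y in g x / \<psi> x)"

text \<open>In \<^typ>\<open>ennreal\<close> the supremum of the empty set is \<open>0\<close> and the infimum of the empty set is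
  \<open>\<infinity>\<close>, which are the required conventions.\<close>

definition left_contact :: "(real \<Rightarrow> real) \<Rightarrow> real \<Rightarrow> real \<Rightarrow> real \<Rightarrow> ennreal" where
  "left_contact f x c p = Sup (ennreal ` {z. 0 < z \<and> z \<le> x \<and> f z - p = c * (z - x)})"

definition right_contact :: "(real \<Rightarrow> real) \<Rightarrow> real \<Rightarrow> real \<Rightarrow> real \<Rightarrow> ennreal" where
  "right_contact f x c p = Inf (ennreal ` {y. x \<le> y \<and> f y - p = c * (y - x)})"

definition gen_subdifferential :: "(real \<Rightarrow> real) \<Rightarrow> (real \<Rightarrow> real) \<Rightarrow> real \<Rightarrow> real set" where
  "gen_subdifferential WG WH x =
     {c. \<forall>y>0. left_contact WG x c (WH x) < ennreal y \<longrightarrow>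
               ennreal y < right_contact WG x c (WH x) \<longrightarrow> WH y - WH x \<ge> c * (y - x)}"

definition gen_superdifferential :: "(real \<Rightarrow> real) \<Rightarrow> (real \<Rightarrow> real) \<Rightarrow> real \<Rightarrow> real set" where
  "gen_superdifferential WH WG x =
     {c. \<forall>y>0. left_contact WH x c (WG x) < ennreal y \<longrightarrow>
               ennreal y < right_contact WH x c (WG x) \<longrightarrow> WG y - WG x \<le> c * (y - x)}"

end

theory Submission imports Defs
begin

text \<open>
  In the coordinate \<open>F = \<phi> / \<psi>\<close>, and after division by \<open>\<psi>\<close>, the \<open>r\<close>-harmonic functions
  \<open>\<alpha>\<phi> + \<beta>\<psi>\<close> are the affine functions, and the value of the game is the taut string \<open>W\<close> between the
  obstacles \<open>W\<^sup>G \<le> W\<^sub>H\<close>: it is concave where it stays below \<open>W\<^sub>H\<close> and convex where it stays above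
  \<open>W\<^sup>G\<close>. It is obtained as the least function \<open>W \<ge> W\<^sup>G\<close> that a line below \<open>W\<^sub>H\<close> cannot cross from
  below. The generalised differentials at a point are nonempty exactly where \<open>W\<close> touches the
  respective obstacle; for this one needs that the obstacles meet at the two ends, which follows from
  the common limit of the discounted rewards by stopping at the hitting times of points that tend to
  an end.

  If \<open>W < W\<^sub>H\<close> at the starting point, then a line supports \<open>W\<close> from above up to the next contact
  with \<open>W\<^sub>H\<close>. It corresponds to a harmonic function that dominates the value until \<open>\<sigma>\<^sup>*\<close>, so
  \<open>\<sigma>\<^sup>*\<close> guarantees the value to the minimiser; the claim for \<open>\<tau>\<^sup>*\<close> is the same statement for the
  negated obstacles. Harmonic functions may be stopped on leaving a compact interval because a
  test function \<open>u\<close> is the resolvent of \<open>(r - L)u\<close>, to which the strong Markov property applies.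
\<close>

section \<open>The taut string between two obstacles\<close>

text \<open>Two restrictions shape the proof. The obstacles are only continuous, and the set where a
  candidate stays below \<open>h\<close> varies with the candidate; so the string is tested against
  lines alone, a condition that survives infima. Negation swaps the two players, so each half is
  proved once. On the probabilistic side the assumptions give Dynkin's formula at fixed times, for
  compactly supported functions, and a strong Markov property for the law of a single later
  position. The resolvent depends on such one-time laws only. If \<open>k\<close> vanishes on an
  interval, the resolvent of \<open>k\<close> is the discounted amount collected after the exit, so
  its discounted value at the exit has the same mean as at the start. This applies to
  \<open>(r - L)u\<close> when \<open>u\<close> agrees with a harmonic function near the interval.
  The common limit of the rewards need not vanish, so an infinite stopping time has a value of its
  own. A path that never leaves a compact interval has limit 0; otherwise the exits from growing
  intervals approximate the limit.\<close>

definition line_barrier :: "(real \<Rightarrow> real) \<Rightarrow> (real \<Rightarrow> real) \<Rightarrow> bool" where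
  "line_barrier h f \<longleftrightarrow> (\<forall>p q \<alpha> \<beta>. 0 < p \<longrightarrow> p < q \<longrightarrow> (\<forall>y\<in>{p..q}. \<alpha> + \<beta> * y \<le> h y) \<longrightarrow>
     \<alpha> + \<beta> * p \<le> f p \<longrightarrow> \<alpha> + \<beta> * q \<le> f q \<longrightarrow> (\<forall>y\<in>{p..q}. \<alpha> + \<beta> * y \<le> f y))"

lemma line_barrierD:
  assumes "line_barrier h f" "0 < p" "p < q" "\<And>y. p \<le> y \<Longrightarrow> y \<le> q \<Longrightarrow> \<alpha> + \<beta> * y \<le> h y"
    "\<alpha> + \<beta> * p \<le> f p" "\<alpha> + \<beta> * q \<le> f q" "p \<le> y" "y \<le> q"
  shows "\<alpha> + \<beta> * y \<le> f y"
  using assms(1)[unfolded line_barrier_def, rule_format, OF assms(2,3), of \<alpha> \<beta> y] assms(4-8)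
  by (simp add: Ball_def)

lemma affine_nonneg_between:
  fixes A B p q y :: real
  assumes "0 \<le> A + B * p" "0 \<le> A + B * q" "p \<le> y" "y \<le> q"
  shows "0 \<le> A + B * y"
proof (cases "0 \<le> B")
  case True
  then have "B * p \<le> B * y" using assms by (intro mult_left_mono)
  then show ?thesis using assms by linarith
next
  case False
  then have "B * q \<le> B * y" using assms by (intro mult_left_mono_neg) auto
  then show ?thesis using assms by linarith
qed

lemma affine_le_between:
  fixes A B A' B' p q y :: real
  assumes "A + B * p \<le> A' + B' * p" "A + B * q \<le> A' + B' * q" "p \<le> y" "y \<le> q"
  shows "A + B * y \<le> A' + B' * y"
  using affine_nonneg_between[of "A' - A" "B' - B" p q y] assms by (simp add: algebra_simps)

text \<open>A line below the infimum at the two ends is below every member there, so each member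
  keeps it out. The bound \<open>g\<close> makes the real infima meaningful.\<close>

lemma line_barrier_Inf:
  assumes ne: "S \<noteq> {}" and lb: "\<And>f y. f \<in> S \<Longrightarrow> 0 < y \<Longrightarrow> g y \<le> f y"
    and S: "\<And>f. f \<in> S \<Longrightarrow> line_barrier h f"
  shows "line_barrier h (\<lambda>y. INF f\<in>S. f y)"
  unfolding line_barrier_def
proof (intro allI impI ballI)
  fix p q \<alpha> \<beta> y :: real
  assume *: "0 < p" "p < q" "\<forall>y\<in>{p..q}. \<alpha> + \<beta> * y \<le> h y"
    "\<alpha> + \<beta> * p \<le> (INF f\<in>S. f p)" "\<alpha> + \<beta> * q \<le> (INF f\<in>S. f q)" "y \<in> {p..q}"
  have bdd: "bdd_below ((\<lambda>f. f y) ` S)" if "0 < y" for y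
    using lb that by (auto intro!: bdd_belowI2)
  show "\<alpha> + \<beta> * y \<le> (INF f\<in>S. f y)"
  proof (rule cINF_greatest[OF ne])
    fix f assume f: "f \<in> S"
    have "(INF f\<in>S. f p) \<le> f p" "(INF f\<in>S. f q) \<le> f q"
      using * f by (auto intro!: cINF_lower bdd)
    then have pq: "\<alpha> + \<beta> * p \<le> f p" "\<alpha> + \<beta> * q \<le> f q" using *(4,5) by linarith+
    show "\<alpha> + \<beta> * y \<le> f y"
      by (rule line_barrierD[OF S[OF f] *(1,2) _ pq]) (use *(3,6) in auto)
  qed
qed

text \<open>Cutting the least barrier off by a line that stays above \<open>g\<close> yields a barrier again, so the
  least barrier is also a barrier from the other side.\<close>

lemma ex_double_barrier:
  fixes g h :: "real \<Rightarrow> real"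
  assumes gh: "\<And>y. 0 < y \<Longrightarrow> g y \<le> h y"
  obtains W where "\<And>y. 0 < y \<Longrightarrow> g y \<le> W y" "\<And>y. 0 < y \<Longrightarrow> W y \<le> h y"
    "line_barrier h W" "line_barrier (\<lambda>y. - g y) (\<lambda>y. - W y)"
proof -
  define S where "S = {f. (\<forall>y>0. g y \<le> f y \<and> f y \<le> h y) \<and> line_barrier h f}"
  define W where "W y = (INF f\<in>S. f y)" for y
  \<comment> \<open>The upper obstacle is a barrier for a trivial reason, so the infimum is over a
    nonempty set.\<close>
  have hS: "h \<in> S" using gh by (auto simp: S_def line_barrier_def)
  have bdd: "bdd_below ((\<lambda>f. f y) ` S)" if "0 < y" for y
    using that by (intro bdd_belowI2[of _ "g y"]) (auto simp: S_def)
  have W_le: "W y \<le> f y" if "f \<in> S" "0 < y" for f y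
    unfolding W_def using that by (intro cINF_lower bdd)
  have gW: "g y \<le> W y" if "0 < y" for y
    unfolding W_def using that hS by (intro cINF_greatest) (auto simp: S_def)
  have Wh: "W y \<le> h y" if "0 < y" for y using W_le[OF hS that] .
  have bW: "line_barrier h W"
    unfolding W_def using hS by (intro line_barrier_Inf[where g = g]) (auto simp: S_def)
  have "line_barrier (\<lambda>y. - g y) (\<lambda>y. - W y)"
    unfolding line_barrier_def
  proof (intro allI impI ballI)
    fix p q \<alpha> \<beta> y :: real
    assume *: "0 < p" "p < q" "\<forall>y\<in>{p..q}. \<alpha> + \<beta> * y \<le> - g y"
      "\<alpha> + \<beta> * p \<le> - W p" "\<alpha> + \<beta> * q \<le> - W q" "y \<in> {p..q}"
    define f where "f t = (if t \<in> {p..q} then min (W t) (- \<alpha> + - \<beta> * t) else W t)" for t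
    have fW: "f t \<le> W t" for t by (auto simp: f_def)
    have fl: "f t \<le> - \<alpha> + - \<beta> * t" if "t \<in> {p..q}" for t using that by (auto simp: f_def)
    have "f \<in> S"
      unfolding S_def line_barrier_def
    proof (safe)
      fix t :: real assume t: "0 < t"
      show "g t \<le> f t" using *(3)[rule_format, of t] gW[OF t] by (auto simp: f_def)
      show "f t \<le> h t" using fW[of t] Wh[OF t] by linarith
    next
      fix p' q' \<alpha>' \<beta>' t :: real
      assume **: "0 < p'" "p' < q'" "\<forall>y\<in>{p'..q'}. \<alpha>' + \<beta>' * y \<le> h y"
        "\<alpha>' + \<beta>' * p' \<le> f p'" "\<alpha>' + \<beta>' * q' \<le> f q'" "t \<in> {p'..q'}"
      have le: "\<alpha>' + \<beta>' * s \<le> W s" if "p' \<le> s" "s \<le> q'" for s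
      proof (rule line_barrierD[OF bW, of p' q'])
        show "\<alpha>' + \<beta>' * p' \<le> W p'" "\<alpha>' + \<beta>' * q' \<le> W q'"
          using **(4,5) fW[of p'] fW[of q'] by linarith+
      qed (use **(1-3) that in auto)
      \<comment> \<open>The two lines are compared at the ends of the overlap of their intervals.
        Such an end is either an end of the test interval, where the test line lies below
        \<open>f\<close> and hence below the cut, or an end of \<open>{p..q}\<close>, where the test
        line lies below \<open>W\<close> and \<open>W\<close> below the cut.\<close>
      have "\<alpha>' + \<beta>' * t \<le> - \<alpha> + - \<beta> * t" if t: "t \<in> {p..q}"
      proof (rule affine_le_between[of _ _ "max p p'" _ _ "min q q'"])
        show "\<alpha>' + \<beta>' * max p p' \<le> - \<alpha> + - \<beta> * max p p'"
        proof (cases "p \<le> p'")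
          case True
          then have "p' \<in> {p..q}" using t **(6) by auto
          then show ?thesis using True **(4) fl[of p'] by (simp add: max_absorb2)
        next
          case False
          then have "\<alpha>' + \<beta>' * p \<le> W p" using le[of p] t **(6) by auto
          then show ?thesis using False *(4) by (simp add: max_absorb1)
        qed
        show "\<alpha>' + \<beta>' * min q q' \<le> - \<alpha> + - \<beta> * min q q'"
        proof (cases "q' \<le> q")
          case True
          then have "q' \<in> {p..q}" using t **(6) by auto
          then show ?thesis using True **(5) fl[of q'] by (simp add: min_absorb2)
        next
          case False
          then have "\<alpha>' + \<beta>' * q \<le> W q" using le[of q] t **(6) by auto
          then show ?thesis using False *(5) by (simp add: min_absorb1)
        qed
      qed (use t **(6) in auto)
      then show "\<alpha>' + \<beta>' * t \<le> f t" using le[of t] **(6) by (auto simp: f_def)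
    qed
    \<comment> \<open>Minimality: the cut function is admissible, so \<open>W\<close> lies below it
      and therefore below the cutting line.\<close>
    from W_le[OF this, of y] fl[of y] *(1,6) show "\<alpha> + \<beta> * y \<le> - W y" by auto
  qed
  with gW Wh bW show ?thesis using that by blast
qed

text \<open>A tent with apex \<open>W x - e / 2\<close> at \<open>x\<close> keeps \<open>W\<close>
  above it. Its sides are admissible test lines: near \<open>x\<close> the obstacle \<open>h\<close>
  drops by less than \<open>e / 2\<close>, and the feet of a steep tent lie below
  \<open>g\<close>.\<close>

lemma line_barrier_lower_semicontinuous:
  fixes g h W :: "real \<Rightarrow> real"
  assumes g: "continuous_on {0<..} g" and h: "continuous_on {0<..} h"
    and gW: "\<And>y. 0 < y \<Longrightarrow> g y \<le> W y" and Wh: "\<And>y. 0 < y \<Longrightarrow> W y \<le> h y"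
    and W: "line_barrier h W" and x: "0 < x" and e: "0 < e"
  shows "\<forall>\<^sub>F y in at x. W x - e < W y"
proof -
  have lim: "(g \<longlongrightarrow> g x) (at x)" "(h \<longlongrightarrow> h x) (at x)"
    using continuous_on_interior[OF g, of x] continuous_on_interior[OF h, of x] x
    by (auto simp: continuous_at interior_open)
  have "\<forall>\<^sub>F y in at x. g x - 1 < g y \<and> h x - e / 2 < h y"
    using order_tendstoD(1)[OF lim(1), of "g x - 1"] order_tendstoD(1)[OF lim(2), of "h x - e / 2"] e
    by (auto elim: eventually_elim2)
  then obtain d0 where d0: "d0 > 0"
    "\<And>y. y \<noteq> x \<Longrightarrow> dist y x < d0 \<Longrightarrow> g x - 1 < g y \<and> h x - e / 2 < h y"
    unfolding eventually_at by auto
  define d where "d = min d0 x / 2"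
  have d: "0 < d" "d < d0" "d < x" using d0 x by (auto simp: d_def)
  have gd: "g x - 1 < g y" "h x - e / 2 < h y" if "\<bar>y - x\<bar> \<le> d" for y
    using d0(2)[of y] that d e by (cases "y = x"; force simp: dist_real_def)+
  define w where "w = W x - e / 2"
  \<comment> \<open>Each side of the tent thus falls to \<open>g x - 1\<close> or lower at distance
    \<open>d\<close>; the minimum keeps \<open>K\<close> nonnegative when the apex is already
    lower.\<close>
  define K where "K = (w - min (g x - 1) w) / d"
  have K: "0 \<le> K" "w - K * d \<le> g x - 1" "K * d \<ge> 0" using d by (auto simp: K_def)
  have lower: "w - K * \<bar>y - x\<bar> \<le> W y" if y: "\<bar>y - x\<bar> \<le> d" for y
  proof (cases "x \<le> y")
    case True
    have "(w + K * x) + (- K) * y \<le> W y"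
    proof (rule line_barrierD[OF W, of x "x + d"])
      fix t assume t: "x \<le> t" "t \<le> x + d"
      have "K * x \<le> K * t" using t K by (intro mult_left_mono)
      moreover have "h x - e / 2 < h t" using gd(2)[of t] t by auto
      ultimately show "(w + K * x) + (- K) * t \<le> h t" using Wh[OF x] by (simp add: w_def)
    next
      show "(w + K * x) + (- K) * (x + d) \<le> W (x + d)"
        using K gd(1)[of "x + d"] gW[of "x + d"] d x by (simp add: algebra_simps)
    qed (use True y x d e in \<open>auto simp: w_def\<close>)
    then show ?thesis using True by (simp add: algebra_simps)
  next
    case False
    have "(w - K * x) + K * y \<le> W y"
    proof (rule line_barrierD[OF W, of "x - d" x])
      fix t assume t: "x - d \<le> t" "t \<le> x"
      have "K * t \<le> K * x" using t K by (intro mult_left_mono)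
      moreover have "h x - e / 2 < h t" using gd(2)[of t] t by auto
      ultimately show "(w - K * x) + K * t \<le> h t" using Wh[OF x] by (simp add: w_def)
    next
      show "(w - K * x) + K * (x - d) \<le> W (x - d)"
        using K gd(1)[of "x - d"] gW[of "x - d"] d x by (simp add: algebra_simps)
    qed (use False y x d e in \<open>auto simp: w_def\<close>)
    then show ?thesis using False by (simp add: algebra_simps)
  qed
  \<comment> \<open>Within this distance the tent loses at most \<open>e / 4\<close>;
    \<open>K + 1\<close> avoids a division by zero.\<close>
  define d1 where "d1 = min d (e / (4 * (K + 1)))"
  have d1: "0 < d1" using d e K by (auto simp: d1_def)
  show ?thesis unfolding eventually_at
  proof (intro exI[of _ d1] conjI ballI impI)
    fix y assume y: "y \<noteq> x \<and> dist y x < d1"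
    have "K * \<bar>y - x\<bar> \<le> (K + 1) * (e / (4 * (K + 1)))"
      using y K by (intro mult_mono) (auto simp: d1_def dist_real_def)
    also have "\<dots> = e / 4" using K by (simp add: field_simps)
    finally show "W x - e < W y"
      using lower[of y] y e by (auto simp: d1_def dist_real_def w_def)
  qed (use d1 in auto)
qed

text \<open>\<open>- W\<close> is a barrier of the same kind between the negated obstacles, so lower
  semicontinuity is available for both signs.\<close>

lemma double_barrier_continuous:
  fixes g h W :: "real \<Rightarrow> real"
  assumes g: "continuous_on {0<..} g" and h: "continuous_on {0<..} h"
    and gW: "\<And>y. 0 < y \<Longrightarrow> g y \<le> W y" and Wh: "\<And>y. 0 < y \<Longrightarrow> W y \<le> h y"
    and W: "line_barrier h W" "line_barrier (\<lambda>y. - g y) (\<lambda>y. - W y)"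
  shows "continuous_on {0<..} W"
proof (rule continuous_at_imp_continuous_on, intro ballI)
  fix x :: real assume "x \<in> {0<..}"
  then have x: "0 < x" by simp
  show "isCont W x" unfolding isCont_def
  proof (rule order_tendstoI)
    fix l assume "l < W x"
    then show "\<forall>\<^sub>F y in at x. l < W y"
      using line_barrier_lower_semicontinuous[OF g h gW Wh W(1) x, of "W x - l"] by simp
  next
    fix l assume l: "W x < l"
    have "\<forall>\<^sub>F y in at x. - W x - (l - W x) < - W y"
      by (rule line_barrier_lower_semicontinuous[of "\<lambda>y. - h y" "\<lambda>y. - g y"])
        (use g h gW Wh W x l in \<open>auto intro: continuous_on_minus\<close>)
    then show "\<forall>\<^sub>F y in at x. W y < l" by (auto elim: eventually_mono)
  qed
qed

text \<open>Away from \<open>h\<close> a barrier is concave: chord slopes to the right of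
  \<open>x\<close> do not exceed those to the left, and a slope in between supports \<open>f\<close>
  from above. One slope serves the whole component of \<open>{t. f t < h t}\<close> around
  \<open>x\<close>, which is why its range is expressed by segments.\<close>

lemma line_barrier_tangent:
  fixes h f :: "real \<Rightarrow> real"
  assumes fc: "continuous_on {0<..} f" and hc: "continuous_on {0<..} h"
    and b: "line_barrier h f" and x: "0 < x" and fx: "f x < h x"
  obtains c where "\<And>y. 0 < y \<Longrightarrow> (\<And>t. t \<in> closed_segment x y \<Longrightarrow> f t < h t) \<Longrightarrow> f y \<le> f x + c * (y - x)"
proof -
  define U where "U = {y. x < y \<and> (\<forall>t\<in>{x..y}. f t < h t)}"
  define L where "L = {y. 0 < y \<and> y < x \<and> (\<forall>t\<in>{y..x}. f t < h t)}"
  have slope: "(f y - f x) / (y - x) \<le> (f x - f z) / (x - z)" if y: "y \<in> U" and z: "z \<in> L" for y z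
  proof (rule ccontr)
    assume "\<not> ?thesis"
    then obtain c where c1: "c < (f y - f x) / (y - x)" and c2: "(f x - f z) / (x - z) < c"
      by (meson dense not_le)
    have xyz: "x < y" "0 < z" "z < x" using y z by (auto simp: U_def L_def)
    define d where "d t = f t - (f x + c * (t - x))" for t
    have dy: "0 < d y" using c1 xyz by (simp add: d_def field_simps)
    have dz: "0 < d z" using c2 xyz by (simp add: d_def field_simps)
    have dx: "d x = 0" by (simp add: d_def)
    have fhlt: "f t < h t" if "t \<in> {z..y}" for t
      using y z that by (cases "t \<le> x") (auto simp: U_def L_def)
    have cf: "continuous_on {z..y} f" and ch: "continuous_on {z..y} h"
      using xyz by (auto intro: continuous_on_subset[OF fc] continuous_on_subset[OF hc])
    have cd: "continuous_on {z..y} d" unfolding d_def by (intro continuous_intros cf)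
    obtain s where s: "s \<in> {z..y}" "\<And>t. t \<in> {z..y} \<Longrightarrow> d s \<le> d t"
      using continuous_attains_inf[OF compact_Icc _ cd] xyz by auto
    have ds: "d s \<le> 0" using s(2)[of x] dx xyz by auto
    have "continuous_on {z..y} (\<lambda>t. h t - f t)" by (intro continuous_intros cf ch)
    then obtain s' where s': "s' \<in> {z..y}" "\<And>t. t \<in> {z..y} \<Longrightarrow> h s' - f s' \<le> h t - f t"
      using continuous_attains_inf[OF compact_Icc, of z y "\<lambda>t. h t - f t"] xyz by auto
    \<comment> \<open>The line of slope \<open>c\<close> that touches \<open>f\<close> from below at
      the minimiser \<open>s\<close> of \<open>d\<close> is lifted by \<open>e\<close>: little
      enough to stay below \<open>h\<close> on \<open>{z..y}\<close> and below \<open>f\<close> at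
      \<open>z\<close> and \<open>y\<close>, although it now exceeds \<open>f\<close> at
      \<open>s\<close>.\<close>
    define e where "e = min (h s' - f s') (min (d y) (d z))"
    have e: "0 < e" "e \<le> h s' - f s'" "e \<le> d y" "e \<le> d z"
      using fhlt[OF s'(1)] dy dz by (auto simp: e_def)
    have "(f x - c * x + d s + e) + c * s \<le> f s"
    proof (rule line_barrierD[OF b, of z y])
      fix t assume t: "z \<le> t" "t \<le> y"
      have "d s \<le> d t" "h s' - f s' \<le> h t - f t" using s(2)[of t] s'(2)[of t] t by auto
      with e show "(f x - c * x + d s + e) + c * t \<le> h t" by (simp add: d_def algebra_simps)
    next
      show "(f x - c * x + d s + e) + c * z \<le> f z" using e ds by (simp add: d_def algebra_simps)
      show "(f x - c * x + d s + e) + c * y \<le> f y" using e ds by (simp add: d_def algebra_simps)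
    qed (use xyz s in auto)
    then show False using e by (simp add: d_def algebra_simps)
  qed
  have lim: "(f \<longlongrightarrow> f x) (at x)" "(h \<longlongrightarrow> h x) (at x)"
    using continuous_on_interior[OF fc, of x] continuous_on_interior[OF hc, of x] x
    by (auto simp: continuous_at interior_open)
  have "((\<lambda>y. h y - f y) \<longlongrightarrow> h x - f x) (at x)" by (intro tendsto_intros lim)
  then have "\<forall>\<^sub>F y in at x. 0 < h y - f y" using fx by (intro order_tendstoD) auto
  then obtain d0 where d0: "d0 > 0" "\<And>y. y \<noteq> x \<Longrightarrow> dist y x < d0 \<Longrightarrow> 0 < h y - f y"
    unfolding eventually_at by auto
  have near: "f y < h y" if "\<bar>y - x\<bar> < d0" for y
    using d0(2)[of y] that fx by (cases "y = x") (auto simp: dist_real_def)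
  define d where "d = min d0 x / 2"
  have d: "0 < d" "d < d0" "d < x" using d0 x by (auto simp: d_def)
  have neU: "x + d \<in> U" and neL: "x - d \<in> L" using d by (auto simp: U_def L_def intro!: near)
  \<comment> \<open>Every left slope bounds all right slopes, so the supremum of the right slopes
    supports on both sides.\<close>
  define c where "c = (SUP y\<in>U. (f y - f x) / (y - x))"
  have c1: "(f y - f x) / (y - x) \<le> c" if "y \<in> U" for y
    unfolding c_def using that slope[OF _ neL] by (intro cSUP_upper bdd_aboveI2) auto
  have c2: "c \<le> (f x - f z) / (x - z)" if "z \<in> L" for z
    unfolding c_def using neU slope[OF _ that] by (intro cSUP_least) auto
  show ?thesis
  proof (rule that[of c])
    fix y assume y: "0 < y" "\<And>t. t \<in> closed_segment x y \<Longrightarrow> f t < h t"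
    consider "y = x" | "x < y" | "y < x" by linarith
    then show "f y \<le> f x + c * (y - x)"
    proof cases
      case 2
      then have "y \<in> U" using y by (auto simp: U_def closed_segment_eq_real_ivl)
      from c1[OF this] 2 show ?thesis by (simp add: field_simps)
    next
      case 3
      then have "y \<in> L" using y by (auto simp: L_def closed_segment_eq_real_ivl)
      from c2[OF this] 3 show ?thesis by (simp add: field_simps)
    qed auto
  qed
qed

text \<open>If \<open>W\<close> touches \<open>g\<close> at \<open>x\<close>, the tangent slope of
  \<open>W\<close> qualifies: a violation would require \<open>W\<close> to reach \<open>h\<close>
  on the way, at a point where the line is still below \<open>h\<close>. Conversely, a line through
  the point of \<open>g\<close> at \<open>x\<close> with an admissible slope is followed to both
  sides until it meets \<open>W\<close>. Up to there it stays below \<open>h\<close>, so it keeps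
  above \<open>g\<close>, and the reversed barrier property pushes \<open>W\<close> down to
  \<open>g\<close> at \<open>x\<close>. Where the line never meets \<open>W\<close>, the vanishing
  gap near the end supplies an approximate meeting point.\<close>

lemma superdifferential_nonempty_iff:
  fixes g h W :: "real \<Rightarrow> real"
  assumes g: "continuous_on {0<..} g" and h: "continuous_on {0<..} h"
    and gW: "\<And>y. 0 < y \<Longrightarrow> g y \<le> W y" and Wh: "\<And>y. 0 < y \<Longrightarrow> W y \<le> h y"
    and W: "line_barrier h W" "line_barrier (\<lambda>y. - g y) (\<lambda>y. - W y)"
    and at0: "\<And>e d. 0 < e \<Longrightarrow> 0 < d \<Longrightarrow> \<exists>p. 0 < p \<and> p < d \<and> h p - g p \<le> e"
    and at_inf: "\<And>e N. 0 < e \<Longrightarrow> \<exists>q>N. h q - g q \<le> e * q"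
    and x: "0 < x"
  shows "gen_superdifferential h g x \<noteq> {} \<longleftrightarrow> W x = g x"
proof
  have Wc: "continuous_on {0<..} W" by (rule double_barrier_continuous[OF g h gW Wh W])
  assume "W x = g x"
  show "gen_superdifferential h g x \<noteq> {}"
  proof (cases "g x = h x")
    case True
    \<comment> \<open>A contact at \<open>x\<close> itself makes the interval in the definition
      empty, so every slope qualifies.\<close>
    have "ennreal x \<le> left_contact h x c (g x)" "right_contact h x c (g x) \<le> ennreal x" for c
      unfolding left_contact_def right_contact_def using x True
      by (auto intro!: Sup_upper Inf_lower)
    then have "0 \<in> gen_superdifferential h g x"
      unfolding gen_superdifferential_def mem_Collect_eq
      by (meson leD le_less_trans less_le_trans order_less_trans less_irrefl)
    then show ?thesis by blast
  next
    case False
    then have "W x < h x" using \<open>W x = g x\<close> gW[OF x] Wh[OF x] by auto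
    then obtain c where c: "\<And>y. 0 < y \<Longrightarrow> (\<And>t. t \<in> closed_segment x y \<Longrightarrow> W t < h t) \<Longrightarrow>
        W y \<le> W x + c * (y - x)"
      using line_barrier_tangent[OF Wc h W(1) x] by blast
    have "c \<in> gen_superdifferential h g x"
      unfolding gen_superdifferential_def mem_Collect_eq
    proof (intro allI impI, rule ccontr)
      fix y assume y: "0 < y" "left_contact h x c (g x) < ennreal y" "ennreal y < right_contact h x c (g x)"
        and neg: "\<not> g y - g x \<le> c * (y - x)"
      define D where "D t = h t - (g x + c * (t - x))" for t
      have Dc: "continuous_on {0<..} D" unfolding D_def by (intro continuous_intros h)
      have nz: "D t \<noteq> 0" if t: "t \<in> closed_segment x y" for t
      proof
        assume Dt: "D t = 0"
        show False
        proof (cases "x \<le> y")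
          case True
          then have "right_contact h x c (g x) \<le> ennreal t"
            unfolding right_contact_def using t Dt
            by (intro Inf_lower) (auto simp: closed_segment_eq_real_ivl D_def)
          also have "\<dots> \<le> ennreal y" using t True by (auto simp: closed_segment_eq_real_ivl intro: ennreal_leI)
          finally show False using y by auto
        next
          case False
          then have "ennreal t \<le> left_contact h x c (g x)"
            unfolding left_contact_def using t Dt y
            by (intro Sup_upper) (auto simp: closed_segment_eq_real_ivl D_def)
          moreover have "ennreal y \<le> ennreal t" using t False by (auto simp: closed_segment_eq_real_ivl intro: ennreal_leI)
          ultimately show False using y by auto
        qed
      qed
      \<comment> \<open>Otherwise the tangent bound reaches \<open>y\<close> and, with
        \<open>g y \<le> W y\<close>, contradicts \<open>neg\<close>.\<close>
      have "\<exists>t\<in>closed_segment x y. \<not> W t < h t"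
        using c[OF y(1)] neg gW[OF y(1)] \<open>W x = g x\<close> by force
      then obtain t0 where t0: "t0 \<in> closed_segment x y" "h t0 \<le> W t0" by force
      have t0pos: "0 < t0" using t0 x y by (auto simp: closed_segment_eq_real_ivl split: if_splits)
      have sub: "closed_segment x t0 \<subseteq> closed_segment x y" "closed_segment x y \<subseteq> {0<..}"
        using t0 x y by (auto simp: closed_segment_eq_real_ivl split: if_splits)
      have t0x: "t0 \<noteq> x" using t0 \<open>W x < h x\<close> by auto
      have Dx: "0 < D x" using \<open>W x < h x\<close> \<open>W x = g x\<close> by (simp add: D_def)
      have pos: "0 < D t" if t: "t \<in> closed_segment x y" for t
      proof (rule ccontr)
        assume "\<not> 0 < D t"
        moreover have "connected (D ` closed_segment x y)"
          using sub by (intro connected_continuous_image continuous_on_subset[OF Dc]) auto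
        ultimately have "0 \<in> D ` closed_segment x y"
          using Dx t connectedD_interval[of "D ` closed_segment x y" "D t" "D x" 0] by force
        then show False using nz by auto
      qed
      \<comment> \<open>\<open>u\<close> will be the contact of \<open>W\<close> with
        \<open>h\<close> nearest to \<open>x\<close>; choosing it by distance treats both sides of
        \<open>x\<close> alike.\<close>
      define S where "S = {t \<in> closed_segment x t0. h t - W t \<le> 0}"
      have "continuous_on (closed_segment x t0) (\<lambda>t. h t - W t)"
        using sub by (intro continuous_intros continuous_on_subset[OF h] continuous_on_subset[OF Wc]) auto
      then have "closed S" unfolding S_def
        using continuous_closed_preimage[of "closed_segment x t0" "\<lambda>t. h t - W t" "{..0}"]
        by (simp add: vimage_def Int_def)
      moreover have "S \<noteq> {}" using t0 by (auto simp: S_def)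
      ultimately obtain u where u: "u \<in> S" "\<And>t. t \<in> S \<Longrightarrow> dist x u \<le> dist x t"
        using distance_attains_inf[of S x] by metis
      have uy: "u \<in> closed_segment x y" "0 < u" using u sub by (auto simp: S_def)
      have ux: "u \<noteq> x" using u \<open>W x < h x\<close> by (auto simp: S_def)
      have Wu: "W t \<le> g x + c * (t - x)" if t: "t \<in> open_segment x u" for t
      proof -
        have "W s < h s" if s: "s \<in> closed_segment x t" for s
        proof (rule ccontr)
          assume "\<not> W s < h s"
          moreover have "s \<in> closed_segment x t0" using s t u
            by (auto simp: S_def open_segment_eq_real_ivl closed_segment_eq_real_ivl split: if_splits)
          ultimately have "s \<in> S" by (auto simp: S_def)
          with u(2)[of s] s t ux show False
            by (auto simp: open_segment_eq_real_ivl closed_segment_eq_real_ivl dist_real_def split: if_splits)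
        qed
        moreover have "0 < t" using t x uy by (auto simp: open_segment_eq_real_ivl split: if_splits)
        ultimately show ?thesis using c[of t] \<open>W x = g x\<close> by auto
      qed
      \<comment> \<open>The tangent bound holds strictly between \<open>x\<close> and
        \<open>u\<close>. In the limit it puts \<open>W u = h u\<close> on or below the line,
        contrary to \<open>pos\<close>.\<close>
      have "(\<lambda>t. g x + c * (t - x) - W t) u \<ge> 0"
      proof (rule continuous_ge_on_closure[of "open_segment x u" "\<lambda>t. g x + c * (t - x) - W t"])
        have cl: "closure (open_segment x u) = closed_segment x u" using ux by (simp add: closure_open_segment)
        show "u \<in> closure (open_segment x u)" unfolding cl by simp
        have "closed_segment x u \<subseteq> {0<..}" using x uy by (auto simp: closed_segment_eq_real_ivl split: if_splits)
        then show "continuous_on (closure (open_segment x u)) (\<lambda>t. g x + c * (t - x) - W t)"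
          unfolding cl by (intro continuous_intros continuous_on_subset[OF Wc]) auto
      qed (use Wu in force)
      moreover have "W u = h u" using u Wh[OF uy(2)] by (auto simp: S_def)
      ultimately show False using pos[OF uy(1)] by (simp add: D_def)
    qed
    then show ?thesis by blast
  qed
next
  have Wc: "continuous_on {0<..} W" by (rule double_barrier_continuous[OF g h gW Wh W])
  assume "gen_superdifferential h g x \<noteq> {}"
  then obtain c where c: "\<And>y. 0 < y \<Longrightarrow> left_contact h x c (g x) < ennreal y \<Longrightarrow>
      ennreal y < right_contact h x c (g x) \<Longrightarrow> g y - g x \<le> c * (y - x)"
    unfolding gen_superdifferential_def by blast
  define l where "l t = g x + c * (t - x)" for t
  have lc: "continuous_on A l" for A unfolding l_def by (intro continuous_intros)
  show "W x = g x"
  proof (rule ccontr)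
    assume "W x \<noteq> g x"
    then have lx: "l x < W x" using gW[OF x] by (auto simp: l_def)
    \<comment> \<open>While the line lies below \<open>W\<close> it lies below \<open>h\<close>, so
      the right contact has not yet occurred and the inequality that defines the differential
      applies; continuity adds the endpoint.\<close>
    have right: "g y \<le> l y" if "x \<le> y" "\<And>t. x \<le> t \<Longrightarrow> t < y \<Longrightarrow> l t < W t" for y
    proof (cases "x < y")
      case True
      have "g t \<le> l t" if t: "t \<in> {x<..<y}" for t
      proof -
        have "ennreal y \<le> right_contact h x c (g x)" unfolding right_contact_def
        proof (rule Inf_greatest, safe)
          fix z assume z: "x \<le> z" "h z - g x = c * (z - x)"
          then have "\<not> z < y" using Wh[of z] x \<open>\<And>t. x \<le> t \<Longrightarrow> t < y \<Longrightarrow> l t < W t\<close>[of z]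
            by (auto simp: l_def)
          then show "ennreal y \<le> ennreal z" using x True by (auto intro!: ennreal_leI)
        qed
        moreover have "left_contact h x c (g x) \<le> ennreal x"
          unfolding left_contact_def by (rule Sup_least) (use x in \<open>auto intro!: ennreal_leI\<close>)
        moreover have "ennreal x < ennreal t" "ennreal t < ennreal y" using t x by (auto simp: ennreal_less_iff)
        ultimately have "g t - g x \<le> c * (t - x)"
          using t x by (intro c) (auto intro: le_less_trans less_le_trans)
        then show ?thesis by (simp add: l_def)
      qed
      then have "0 \<le> l t - g t" if "t \<in> {x<..<y}" for t using that by fastforce
      moreover have "continuous_on {x..y} (\<lambda>t. l t - g t)"
        using True x by (intro continuous_intros lc continuous_on_subset[OF g]) auto
      then have "continuous_on (closure {x<..<y}) (\<lambda>t. l t - g t)"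
        using True by simp
      moreover have "y \<in> closure {x<..<y}" using True by simp
      ultimately have "0 \<le> l y - g y"
        using continuous_ge_on_closure[of "{x<..<y}" "\<lambda>t. l t - g t" y 0] by blast
      then show ?thesis by simp
    next
      case False
      then have "y = x" using that by linarith
      then show ?thesis by (simp add: l_def)
    qed
    have left: "g y \<le> l y" if "0 < y" "y \<le> x" "\<And>t. y < t \<Longrightarrow> t \<le> x \<Longrightarrow> l t < W t" for y
    proof (cases "y < x")
      case True
      have "g t \<le> l t" if t: "t \<in> {y<..<x}" for t
      proof -
        have "left_contact h x c (g x) \<le> ennreal y" unfolding left_contact_def
        proof (rule Sup_least, safe)
          fix z assume z: "0 < z" "z \<le> x" "h z - g x = c * (z - x)"
          then have "\<not> y < z" using Wh[of z] x \<open>\<And>t. y < t \<Longrightarrow> t \<le> x \<Longrightarrow> l t < W t\<close>[of z]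
            by (auto simp: l_def)
          then show "ennreal z \<le> ennreal y" by (auto intro!: ennreal_leI)
        qed
        moreover have "ennreal x \<le> right_contact h x c (g x)"
          unfolding right_contact_def by (rule Inf_greatest) (use x in \<open>auto intro!: ennreal_leI\<close>)
        moreover have "ennreal y < ennreal t" "ennreal t < ennreal x" using t x that \<open>0 < y\<close> by (auto simp: ennreal_less_iff)
        ultimately have "g t - g x \<le> c * (t - x)"
          using t x \<open>0 < y\<close> by (intro c) (auto intro: le_less_trans less_le_trans)
        then show ?thesis by (simp add: l_def)
      qed
      then have "0 \<le> l t - g t" if "t \<in> {y<..<x}" for t using that by fastforce
      moreover have "continuous_on {y..x} (\<lambda>t. l t - g t)"
        using True \<open>0 < y\<close> by (intro continuous_intros lc continuous_on_subset[OF g]) auto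
      then have "continuous_on (closure {y<..<x}) (\<lambda>t. l t - g t)"
        using True by simp
      moreover have "y \<in> closure {y<..<x}" using True by simp
      ultimately have "0 \<le> l y - g y"
        using continuous_ge_on_closure[of "{y<..<x}" "\<lambda>t. l t - g t" y 0] by blast
      then show ?thesis by simp
    next
      case False
      then have "y = x" using that by linarith
      then show ?thesis by (simp add: l_def)
    qed
    have clo: "closed {t \<in> {u..v}. W t \<le> l t}" if "0 < u" for u v
    proof -
      have "continuous_on {u..v} (\<lambda>t. W t - l t)"
        using that by (intro continuous_intros lc continuous_on_subset[OF Wc]) auto
      then show ?thesis
        using continuous_closed_preimage[of "{u..v}" "\<lambda>t. W t - l t" "{..0}"]
        by (simp add: vimage_def Int_def)
    qed
    \<comment> \<open>The allowance \<open>e * (1 + q)\<close> covers both outcomes: a true meeting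
      with \<open>W\<close>, or a far point where the gap is at most \<open>e * q\<close>. At the
      left end the summand 1 absorbs a gap of size \<open>e\<close>.\<close>
    have R: "\<exists>q>x. (\<forall>y\<in>{x..q}. g y \<le> l y) \<and> W q \<le> l q + e * (1 + q)" if e: "0 < e" for e
    proof (cases "\<exists>v\<ge>x. W v \<le> l v")
      case True
      then obtain v where v: "x \<le> v" "W v \<le> l v" by auto
      define S where "S = {t \<in> {x..v}. W t \<le> l t}"
      define q where "q = Inf S"
      have "S \<noteq> {}" "bdd_below S" using v by (auto simp: S_def intro: bdd_belowI[of _ x])
      then have qS: "q \<in> S" unfolding q_def using clo v x by (intro closed_contains_Inf) (auto simp: S_def)
      have lt: "l t < W t" if "x \<le> t" "t < q" for t
        using cInf_lower[of t S] that \<open>bdd_below S\<close> qS by (force simp: S_def q_def)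
      have "x < q" using qS lx by (cases "x = q") (auto simp: S_def)
      moreover have "\<forall>y\<in>{x..q}. g y \<le> l y" using lt right by fastforce
      moreover have "0 \<le> e * (1 + q)" using \<open>x < q\<close> e x by simp
      ultimately show ?thesis using qS by (intro exI[of _ q]) (auto simp: S_def)
    next
      case False
      then have "l t < W t" if "x \<le> t" for t using that by (meson not_le)
      then have *: "g y \<le> l y" if "x \<le> y" for y using right[OF that] by blast
      obtain q where q: "q > x" "h q - g q \<le> e * q" using at_inf[OF e] by blast
      have "W q \<le> l q + e * (1 + q)" using q *[of q] Wh[of q] x e by (simp add: algebra_simps)
      then show ?thesis using q * by auto
    qed
    have L: "\<exists>p. 0 < p \<and> p < x \<and> (\<forall>y\<in>{p..x}. g y \<le> l y) \<and> W p \<le> l p + e * (1 + p)" if e: "0 < e" for e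
    proof (cases "\<exists>v. 0 < v \<and> v \<le> x \<and> W v \<le> l v")
      case True
      then obtain v where v: "0 < v" "v \<le> x" "W v \<le> l v" by auto
      define S where "S = {t \<in> {v..x}. W t \<le> l t}"
      define p where "p = Sup S"
      have "S \<noteq> {}" "bdd_above S" using v by (auto simp: S_def intro: bdd_aboveI[of _ x])
      then have pS: "p \<in> S" unfolding p_def using clo v x by (intro closed_contains_Sup) (auto simp: S_def)
      have lt: "l t < W t" if "p < t" "t \<le> x" for t
        using cSup_upper[of t S] that \<open>bdd_above S\<close> pS by (force simp: S_def p_def)
      have "p < x" using pS lx by (cases "x = p") (auto simp: S_def)
      moreover have "0 < p" using pS v by (auto simp: S_def)
      moreover have "\<forall>y\<in>{p..x}. g y \<le> l y" using lt left \<open>0 < p\<close> by fastforce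
      moreover have "0 \<le> e * (1 + p)" using \<open>0 < p\<close> e by simp
      ultimately show ?thesis using pS by (intro exI[of _ p]) (auto simp: S_def)
    next
      case False
      then have "l t < W t" if "0 < t" "t \<le> x" for t using that by (meson not_le)
      then have *: "g y \<le> l y" if "0 < y" "y \<le> x" for y
        using left[OF that] that(1) by (meson less_trans)
      obtain p where p: "0 < p" "p < x" "h p - g p \<le> e" using at0[OF e x] by blast
      have "e \<le> e * (1 + p)" using e p by simp
      then have "W p \<le> l p + e * (1 + p)" using p *[of p] Wh[of p] by simp
      then show ?thesis using p * by (intro exI[of _ p]) auto
    qed
    have "W x \<le> g x + e" if e: "0 < e" for e
    proof -
      \<comment> \<open>Scaled so that the tilt \<open>e' * (1 + y)\<close> used below equals
        \<open>e\<close> at \<open>y = x\<close>.\<close>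
      define e' where "e' = e / (1 + x)"
      have e': "0 < e'" "e' * (1 + x) = e" using e x by (auto simp: e'_def)
      obtain q where q: "q > x" "\<And>y. y \<in> {x..q} \<Longrightarrow> g y \<le> l y" "W q \<le> l q + e' * (1 + q)"
        using R[OF e'(1)] by blast
      obtain p where p: "0 < p" "p < x" "\<And>y. y \<in> {p..x} \<Longrightarrow> g y \<le> l y" "W p \<le> l p + e' * (1 + p)"
        using L[OF e'(1)] by blast
      \<comment> \<open>The tilted line \<open>l y + e' * (1 + y)\<close> lies above
        \<open>g\<close> on \<open>{p..q}\<close> and above \<open>W\<close> at both ends, so the
        reversed barrier property puts it above \<open>W\<close> at \<open>x\<close>.\<close>
      have "- (g x - c * x + e') + - (c + e') * x \<le> - W x"
      proof (rule line_barrierD[OF W(2), of p q])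
        fix y assume y: "p \<le> y" "y \<le> q"
        have "g y \<le> l y" using q(2)[of y] p(3)[of y] y by (cases "x \<le> y") auto
        moreover have "0 \<le> e' * (1 + y)" using e' y p by simp
        ultimately show "- (g x - c * x + e') + - (c + e') * y \<le> - g y" by (simp add: l_def algebra_simps)
      next
        show "- (g x - c * x + e') + - (c + e') * p \<le> - W p" using p(4) by (simp add: l_def algebra_simps)
        show "- (g x - c * x + e') + - (c + e') * q \<le> - W q" using q(3) by (simp add: l_def algebra_simps)
      qed (use p q in auto)
      then show ?thesis using e'(2) by (simp add: algebra_simps)
    qed
    then have "W x \<le> g x" by (rule field_le_epsilon)
    then show False using \<open>W x \<noteq> g x\<close> gW[OF x] by simp
  qed
qed

text \<open>Reflection turns the contacts of a line with \<open>g\<close> into those of the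
  reflected line with \<open>- g\<close>. This carries the description of the maximiser's stopping
  set over to the minimiser's.\<close>

lemma subdifferential_eq_uminus_superdifferential:
  "gen_subdifferential g h x = uminus ` gen_superdifferential (\<lambda>y. - g y) (\<lambda>y. - h y) x"
proof -
  have l: "left_contact (\<lambda>y. - g y) x c (- p) = left_contact g x (- c) p" for c p
    unfolding left_contact_def by (intro arg_cong[where f = Sup] image_cong Collect_cong) auto
  have r: "right_contact (\<lambda>y. - g y) x c (- p) = right_contact g x (- c) p" for c p
    unfolding right_contact_def by (intro arg_cong[where f = Inf] image_cong Collect_cong) auto
  have "c \<in> gen_subdifferential g h x \<longleftrightarrow> - c \<in> gen_superdifferential (\<lambda>y. - g y) (\<lambda>y. - h y) x" for c
    unfolding gen_subdifferential_def gen_superdifferential_def mem_Collect_eq l r by auto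
  then have "gen_subdifferential g h x = uminus -` gen_superdifferential (\<lambda>y. - g y) (\<lambda>y. - h y) x"
    by blast
  then show ?thesis by (auto simp: image_iff) (metis minus_minus)
qed

section \<open>Test functions and Laplace transforms\<close>

lemma C2_on_openI:
  assumes "open S" and d1: "\<And>x. x \<in> S \<Longrightarrow> (f has_real_derivative f' x) (at x)"
    and d2: "\<And>x. x \<in> S \<Longrightarrow> (f' has_real_derivative f'' x) (at x)" and c: "continuous_on S f''"
  shows "C2_on S f"
proof -
  have e1: "deriv f x = f' x" if "x \<in> S" for x using d1[OF that] by (rule DERIV_imp_deriv)
  have D2: "(deriv f has_real_derivative f'' x) (at x)" if "x \<in> S" for x
    by (rule has_field_derivative_transform_within_open[OF d2[OF that] \<open>open S\<close> that]) (simp add: e1)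
  have e2: "deriv (deriv f) x = f'' x" if "x \<in> S" for x using D2[OF that] by (rule DERIV_imp_deriv)
  show ?thesis
    unfolding C2_on_def
  proof (intro conjI)
    show "f differentiable_on S"
      using d1 by (auto simp: differentiable_on_def real_differentiable_def intro: has_field_derivative_at_within)
    show "deriv f differentiable_on S"
      using D2 by (auto simp: differentiable_on_def real_differentiable_def intro: has_field_derivative_at_within)
    show "continuous_on S (deriv (deriv f))" using c e2 by (simp cong: continuous_on_cong)
  qed
qed

lemma C2_on_openD:
  assumes "open S" "C2_on S f"
  shows "x \<in> S \<Longrightarrow> (f has_real_derivative deriv f x) (at x)"
    and "x \<in> S \<Longrightarrow> (deriv f has_real_derivative deriv (deriv f) x) (at x)"
    and "continuous_on S (deriv (deriv f))"
  using assms
  by (auto simp: C2_on_def differentiable_on_eq_differentiable_at real_differentiable_def DERIV_imp_deriv)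

lemma C2_on_continuous_on:
  assumes "C2_on S f"
  shows "continuous_on S f" "continuous_on S (deriv f)" "continuous_on S (deriv (deriv f))"
  using assms by (auto simp: C2_on_def differentiable_imp_continuous_on)

lemma C2_on_mult:
  assumes "open S" "C2_on S f" "C2_on S g"
  shows "C2_on S (\<lambda>x. f x * g x)"
proof (rule C2_on_openI[OF assms(1)])
  note f = C2_on_openD[OF assms(1,2)] and g = C2_on_openD[OF assms(1,3)]
  show "((\<lambda>x. f x * g x) has_real_derivative deriv f x * g x + deriv g x * f x) (at x)" if "x \<in> S" for x
    by (rule DERIV_mult'[OF f(1) g(1), OF that that, THEN DERIV_cong]) simp
  show "((\<lambda>x. deriv f x * g x + deriv g x * f x) has_real_derivative
      deriv (deriv f) x * g x + 2 * deriv f x * deriv g x + deriv (deriv g) x * f x) (at x)" if "x \<in> S" for x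
    using that by (auto intro!: derivative_eq_intros f g)
  show "continuous_on S (\<lambda>x. deriv (deriv f) x * g x + 2 * deriv f x * deriv g x + deriv (deriv g) x * f x)"
    by (intro continuous_intros C2_on_continuous_on assms)
qed

lemma C2_on_compose:
  assumes "C2_on UNIV f" "C2_on UNIV g"
  shows "C2_on UNIV (\<lambda>x. f (g x))"
proof (rule C2_on_openI[OF open_UNIV])
  note f = C2_on_openD(1,2)[OF open_UNIV assms(1) UNIV_I] and g = C2_on_openD(1,2)[OF open_UNIV assms(2) UNIV_I]
  show "((\<lambda>x. f (g x)) has_real_derivative deriv f (g x) * deriv g x) (at x)" for x
    by (rule DERIV_chain2[OF f(1) g(1)])
  show "((\<lambda>x. deriv f (g x) * deriv g x) has_real_derivative
      deriv (deriv f) (g x) * (deriv g x)\<^sup>2 + deriv f (g x) * deriv (deriv g) x) (at x)" for x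
    by (rule DERIV_mult'[OF DERIV_chain2[OF f(2) g(1)] g(2), THEN DERIV_cong])
      (simp add: power2_eq_square algebra_simps)
  note fc = C2_on_continuous_on[OF assms(1)] and gc = C2_on_continuous_on[OF assms(2)]
  show "continuous_on UNIV (\<lambda>x. deriv (deriv f) (g x) * (deriv g x)\<^sup>2 + deriv f (g x) * deriv (deriv g) x)"
    by (intro continuous_intros gc continuous_on_compose2[OF fc(2)] continuous_on_compose2[OF fc(3)]) auto
qed

lemma C2_on_cong_open:
  assumes "open S" "C2_on S f" "\<And>x. x \<in> S \<Longrightarrow> g x = f x"
  shows "C2_on S g"
proof (rule C2_on_openI[OF assms(1)])
  note f = C2_on_openD[OF assms(1,2)]
  show "(g has_real_derivative deriv f x) (at x)" if "x \<in> S" for x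
    by (rule has_field_derivative_transform_within_open[OF f(1)[OF that] \<open>open S\<close> that]) (simp add: assms)
qed (use C2_on_openD[OF assms(1,2)] in auto)

lemma C2_on_Un_open:
  assumes "open S" "open T" "C2_on S f" "C2_on T f"
  shows "C2_on (S \<union> T) f"
proof (rule C2_on_openI)
  note f = C2_on_openD[OF assms(1,3)] C2_on_openD[OF assms(2,4)]
  show "continuous_on (S \<union> T) (deriv (deriv f))"
    using assms f by (intro continuous_on_open_Un) auto
qed (use assms C2_on_openD[OF assms(1,3)] C2_on_openD[OF assms(2,4)] in auto)

lemma DERIV_max_power:
  "((\<lambda>t::real. max 0 t ^ Suc (Suc n)) has_real_derivative real (n + 2) * max 0 t ^ Suc n) (at t)"
proof -
  consider "t < 0" | "t = 0" | "0 < t" by linarith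
  then show ?thesis
  proof cases
    case 1
    have "((\<lambda>_. 0) has_real_derivative 0) (at t)" by simp
    from has_field_derivative_transform_within_open[OF this, of "{..<0}" "\<lambda>t. max 0 t ^ Suc (Suc n)"] 1
    show ?thesis by (auto simp: max_absorb1)
  next
    case 2
    have "((\<lambda>h::real. max 0 h ^ Suc n) \<longlongrightarrow> max 0 0 ^ Suc n) (at 0)" by (intro tendsto_intros)
    then have "((\<lambda>h::real. max 0 h ^ Suc n) \<longlongrightarrow> 0) (at 0)" by simp
    then have "((\<lambda>h::real. max 0 h ^ Suc (Suc n) / h) \<longlongrightarrow> 0) (at 0)"
      by (rule Lim_transform_eventually) (auto simp: eventually_at_filter max_def field_simps)
    then show ?thesis using 2 by (simp add: DERIV_def)
  next
    case 3
    have "((\<lambda>t. t ^ Suc (Suc n)) has_real_derivative real (Suc (Suc n)) * (1 * t ^ (Suc (Suc n) - Suc 0))) (at t)"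
      by (intro DERIV_power DERIV_ident)
    from has_field_derivative_transform_within_open[OF this, of "{0<..}" "\<lambda>t. max 0 t ^ Suc (Suc n)"] 3
    show ?thesis by (auto simp: max_absorb2 algebra_simps)
  qed
qed

text \<open>The cube is the lowest natural power of the positive part whose second derivative is
  continuous at 0.\<close>

lemma C2_on_max_cube: "C2_on UNIV (\<lambda>t::real. max 0 t ^ 3)"
proof (rule C2_on_openI[OF open_UNIV])
  show "((\<lambda>t::real. max 0 t ^ 3) has_real_derivative 3 * max 0 t ^ 2) (at t)" for t
    using DERIV_max_power[of 1 t] by (simp add: numeral_eq_Suc)
  show "((\<lambda>t::real. 3 * max 0 t ^ 2) has_real_derivative 6 * max 0 t) (at t)" for t
    using DERIV_cmult[OF DERIV_max_power[of 0 t], of 3] by (simp add: numeral_eq_Suc)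
qed (intro continuous_intros)

lemma C2_on_affine: "C2_on UNIV (\<lambda>x::real. \<alpha> * x + \<beta>)"
  by (rule C2_on_openI[where f' = "\<lambda>_. \<alpha>" and f'' = "\<lambda>_. 0"]) (auto intro!: derivative_eq_intros)

text \<open>With \<open>k\<close> the cube of the positive part, \<open>k (1 - k s)\<close> is 1 for
  \<open>s \<le> 0\<close> and 0 for \<open>s \<ge> 1\<close>, because \<open>k 1 = 1\<close> and
  \<open>k\<close> is at least 1 from there on. One such factor descends between \<open>q\<close>
  and \<open>d\<close>, a mirrored one between \<open>p\<close> and \<open>c\<close>.\<close>

lemma ex_cutoff:
  fixes p q c d :: real
  assumes "c < p" "q < d"
  obtains w where "C2_on UNIV w" "\<And>y. 0 \<le> w y" "\<And>y. y \<in> {p..q} \<Longrightarrow> w y = 1"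
    "\<And>y. y \<notin> {c..d} \<Longrightarrow> w y = 0"
proof -
  define k :: "real \<Rightarrow> real" where "k t = max 0 t ^ 3" for t
  have k: "C2_on UNIV k" unfolding k_def by (rule C2_on_max_cube)
  have k0: "k t = 0" if "t \<le> 0" for t using that by (simp add: k_def max_absorb1)
  have k1: "1 \<le> k t" if "1 \<le> t" for t using that by (simp add: k_def max_absorb2)
  have kk: "k 1 = 1" "0 \<le> k t" for t by (simp_all add: k_def)
  define w where "w y = k (1 - k ((y - q) / (d - q))) * k (1 - k ((p - y) / (p - c)))" for y
  show ?thesis
  proof
    have *: "C2_on UNIV (\<lambda>y. k (1 - k (\<alpha> * y + \<beta>)))" for \<alpha> \<beta>
    proof -
      have "C2_on UNIV (\<lambda>y. (- 1) * k (\<alpha> * y + \<beta>) + 1)"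
        by (rule C2_on_compose[OF C2_on_affine C2_on_compose[OF k C2_on_affine]])
      from C2_on_compose[OF k this] show ?thesis by simp
    qed
    have "C2_on UNIV (\<lambda>y. k (1 - k (inverse (d - q) * y + - q / (d - q))) *
        k (1 - k (- inverse (p - c) * y + p / (p - c))))"
      by (intro C2_on_mult * open_UNIV)
    then show "C2_on UNIV w"
      by (simp add: w_def[abs_def] diff_divide_distrib divide_inverse algebra_simps)
    show "0 \<le> w y" for y by (simp add: w_def kk)
    show "w y = 1" if "y \<in> {p..q}" for y
      using that assms by (simp add: w_def kk k0 divide_nonpos_pos)
    show "w y = 0" if y: "y \<notin> {c..d}" for y
    proof -
      consider "y < c" | "d < y" using y by (auto simp: not_le)
      then show ?thesis
      proof cases
        case 1
        then have "1 - k ((p - y) / (p - c)) \<le> 0" using k1[of "(p - y) / (p - c)"] assms by simp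
        then show ?thesis using k0 by (simp add: w_def)
      next
        case 2
        then have "1 - k ((y - q) / (d - q)) \<le> 0" using k1[of "(y - q) / (d - q)"] assms by simp
        then show ?thesis using k0 by (simp add: w_def)
      qed
    qed
  qed
qed

text \<open>A solution of the differential equation is controlled inside \<open>I\<close> only. Its
  product with the cutoff vanishes on the open complement of \<open>{c..d}\<close>, and that
  complement and \<open>I\<close> cover the line.\<close>

lemma C2_on_localize:
  assumes I: "open I" and f: "C2_on I f" and w: "C2_on UNIV w" and sub: "{c..d} \<subseteq> I"
    and 0: "\<And>y. y \<notin> {c..d} \<Longrightarrow> w y = 0"
  shows "C2_on UNIV (\<lambda>y. f y * w y)"
proof -
  have "C2_on I w" using w I
    by (intro C2_on_openI[of I w "deriv w" "deriv (deriv w)"] C2_on_openD(1,2)[OF open_UNIV w UNIV_I])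
      (auto simp: C2_on_def intro: continuous_on_subset)
  then have 1: "C2_on I (\<lambda>y. f y * w y)" by (intro C2_on_mult I f)
  have "C2_on (- {c..d}) (\<lambda>_. 0)"
    by (rule C2_on_openI[where f' = "\<lambda>_. 0" and f'' = "\<lambda>_. 0"]) auto
  then have "C2_on (- {c..d}) (\<lambda>y. f y * w y)"
    by (rule C2_on_cong_open[rotated]) (use 0 in auto)
  from C2_on_Un_open[OF I _ 1 this] have "C2_on (I \<union> - {c..d}) (\<lambda>y. f y * w y)" by auto
  moreover have "I \<union> - {c..d} = UNIV" using sub by auto
  ultimately show ?thesis by simp
qed

section \<open>Laplace transforms in time and joint measurability\<close>

lemma nn_integral_exp_atLeast:
  fixes r u :: real
  assumes "0 < r"
  shows "(\<integral>\<^sup>+s. ennreal (r * exp (- r * s)) * indicator {u..} s \<partial>lborel) = ennreal (exp (- r * u))"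
proof -
  have "(\<integral>\<^sup>+s. ennreal (r * exp (- r * s)) * indicator {u..} s \<partial>lborel) = ennreal (0 - (- exp (- r * u)))"
  proof (rule nn_integral_FTC_atLeast)
    show "((\<lambda>x. - exp (- r * x)) has_real_derivative r * exp (- r * x)) (at x)" for x
      by (auto intro!: derivative_eq_intros)
    have "filterlim (\<lambda>x. r * x) at_top at_top"
      using assms by (intro filterlim_tendsto_pos_mult_at_top[OF tendsto_const]) (auto simp: filterlim_ident)
    then have "filterlim (\<lambda>x. - (r * x)) at_bot at_top" by (simp add: filterlim_uminus_at_top)
    then have "((\<lambda>x. exp (- (r * x))) \<longlongrightarrow> 0) at_top" by (rule filterlim_compose[OF exp_at_bot])
    then show "((\<lambda>x. - exp (- r * x)) \<longlongrightarrow> 0) at_top" using tendsto_minus by fastforce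
  qed (use assms in auto)
  then show ?thesis by simp
qed

text \<open>By Tonelli, the exponential density is integrated over all \<open>s \<ge> u\<close>,
  which leaves \<open>exp (- r * u)\<close>. This turns identities for time integrals into
  identities for resolvents.\<close>

lemma laplace_transform_of_integral:
  fixes n :: "real \<Rightarrow> ennreal"
  assumes [measurable]: "n \<in> borel_measurable borel" and r: "0 < r"
  shows "(\<integral>\<^sup>+s. ennreal (r * exp (- r * s)) * indicator {0..} s * (\<integral>\<^sup>+u. n u * indicator {0..s} u \<partial>lborel) \<partial>lborel) =
    (\<integral>\<^sup>+u. ennreal (exp (- r * u)) * n u * indicator {0..} u \<partial>lborel)"
proof -
  have [measurable]: "(\<lambda>(s, u). ennreal (r * exp (- r * s)) * (n u * (indicator {0..} u * indicator {u..} s)))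
      \<in> borel_measurable (lborel \<Otimes>\<^sub>M lborel)"
    unfolding atLeast_def indicator_def by measurable
  have "(\<integral>\<^sup>+s. ennreal (r * exp (- r * s)) * indicator {0..} s * (\<integral>\<^sup>+u. n u * indicator {0..s} u \<partial>lborel) \<partial>lborel) =
      (\<integral>\<^sup>+s. (\<integral>\<^sup>+u. ennreal (r * exp (- r * s)) * (n u * (indicator {0..} u * indicator {u..} s)) \<partial>lborel) \<partial>lborel)"
  proof (intro nn_integral_cong)
    fix s :: real
    have "ennreal (r * exp (- r * s)) * (n u * (indicator {0..} u * indicator {u..} s)) =
        ennreal (r * exp (- r * s)) * indicator {0..} s * (n u * indicator {0..s} u)" for u
      by (auto split: split_indicator)
    then show "ennreal (r * exp (- r * s)) * indicator {0..} s * (\<integral>\<^sup>+u. n u * indicator {0..s} u \<partial>lborel) =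
        (\<integral>\<^sup>+u. ennreal (r * exp (- r * s)) * (n u * (indicator {0..} u * indicator {u..} s)) \<partial>lborel)"
      by (simp add: nn_integral_cmult)
  qed
  also have "\<dots> = (\<integral>\<^sup>+u. (\<integral>\<^sup>+s. ennreal (r * exp (- r * s)) * (n u * (indicator {0..} u * indicator {u..} s)) \<partial>lborel) \<partial>lborel)"
    by (rule lborel_pair.Fubini'[symmetric]) measurable
  also have "\<dots> = (\<integral>\<^sup>+u. n u * indicator {0..} u * (\<integral>\<^sup>+s. ennreal (r * exp (- r * s)) * indicator {u..} s \<partial>lborel) \<partial>lborel)"
    by (intro nn_integral_cong, subst nn_integral_cmult[symmetric]) (auto simp: mult_ac)
  also have "\<dots> = (\<integral>\<^sup>+u. ennreal (exp (- r * u)) * n u * indicator {0..} u \<partial>lborel)"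
    unfolding nn_integral_exp_atLeast[OF r] by (simp add: mult_ac)
  finally show ?thesis .
qed

text \<open>Rounding the time down to a multiple of \<open>1 / Suc n\<close> leaves countably many
  measurable functions, and continuity recovers the original in the limit. \<open>max 0 t\<close>
  extends the index set to all reals, over which the time integrals are taken.\<close>

lemma borel_measurable_pair_continuous:
  fixes f :: "real \<Rightarrow> 'a \<Rightarrow> real"
  assumes m: "\<And>t. 0 \<le> t \<Longrightarrow> f t \<in> borel_measurable N"
    and c: "\<And>x. x \<in> space N \<Longrightarrow> continuous_on {0..} (\<lambda>t. f t x)"
  shows "(\<lambda>(t, x). f (max 0 t) x) \<in> borel_measurable (borel \<Otimes>\<^sub>M N)"
proof (rule borel_measurable_LIMSEQ_real)
  define d :: "nat \<Rightarrow> real \<Rightarrow> real" where "d n t = real (nat \<lfloor>real (Suc n) * max 0 t\<rfloor>) / real (Suc n)" for n t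
  show "(\<lambda>(t, x). f (d n t) x) \<in> borel_measurable (borel \<Otimes>\<^sub>M N)" for n
  proof -
    have "(\<lambda>z. (\<lambda>i z. f (real i / real (Suc n)) (snd z)) (nat \<lfloor>real (Suc n) * max 0 (fst z)\<rfloor>) z)
        \<in> borel_measurable (borel \<Otimes>\<^sub>M N)"
      by (rule measurable_compose_countable) (auto intro!: measurable_compose[OF measurable_snd] m)
    then show ?thesis by (simp add: d_def case_prod_beta)
  qed
  fix z :: "real \<times> 'a" assume "z \<in> space (borel \<Otimes>\<^sub>M N)"
  then obtain t x where z: "z = (t, x)" "x \<in> space N" by (auto simp: space_pair_measure)
  have "(\<lambda>n. d n t) \<longlonglongrightarrow> max 0 t"
  proof (rule tendsto_sandwich)
    show "(\<lambda>n. max 0 t - 1 / real (Suc n)) \<longlonglongrightarrow> max 0 t"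
      using tendsto_diff[OF tendsto_const LIMSEQ_Suc[OF lim_1_over_n], of "max 0 t"] by simp
    have fl: "real (nat \<lfloor>y\<rfloor>) \<le> y" "y - 1 \<le> real (nat \<lfloor>y\<rfloor>)" if "0 \<le> y" for y :: real
      using that by linarith+
    have e: "max 0 t - 1 / real (Suc n) = (real (Suc n) * max 0 t - 1) / real (Suc n)" for n
      by (auto simp: field_simps)
    have "max 0 t - 1 / real (Suc n) \<le> d n t" for n
      unfolding d_def e(1) by (intro divide_right_mono fl) auto
    moreover have "d n t \<le> max 0 t" for n
      unfolding d_def using fl(1)[of "real (Suc n) * max 0 t"] by (simp add: divide_le_eq mult.commute del: of_nat_Suc)
    ultimately show "\<forall>\<^sub>F n in sequentially. max 0 t - 1 / real (Suc n) \<le> d n t"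
      "\<forall>\<^sub>F n in sequentially. d n t \<le> max 0 t" by auto
  qed simp
  then have "(\<lambda>n. f (d n t) x) \<longlonglongrightarrow> f (max 0 t) x"
    by (intro continuous_on_tendsto_compose[OF c[OF z(2)]]) (auto simp: d_def)
  then show "(\<lambda>n. case z of (t, x) \<Rightarrow> f (d n t) x) \<longlonglongrightarrow> (case z of (t, x) \<Rightarrow> f (max 0 t) x)"
    by (simp add: z)
qed

section \<open>Resolvent and harmonic functions of the diffusion\<close>

text \<open>Induction over the nonnegative \<open>S\<close>-measurable functions. In effect
  \<open>f\<close> and \<open>g\<close> have the same conditional expectation given
  \<open>S\<close>, with no integrability required.\<close>

lemma nn_integral_eq_on_subalgebra:
  fixes f g Z :: "'a \<Rightarrow> ennreal"
  assumes sub: "subalgebra N S" and f: "f \<in> borel_measurable N" and g: "g \<in> borel_measurable N"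
    and eq: "\<And>A. A \<in> sets S \<Longrightarrow> (\<integral>\<^sup>+x. indicator A x * f x \<partial>N) = (\<integral>\<^sup>+x. indicator A x * g x \<partial>N)"
    and Z: "Z \<in> borel_measurable S"
  shows "(\<integral>\<^sup>+x. Z x * f x \<partial>N) = (\<integral>\<^sup>+x. Z x * g x \<partial>N)"
  using Z
proof induction
  case (cong u v)
  have "u x = v x" if "x \<in> space N" for x using cong(3) that sub by (simp add: subalgebra_def)
  then have "(\<integral>\<^sup>+x. u x * k x \<partial>N) = (\<integral>\<^sup>+x. v x * k x \<partial>N)" for k
    by (intro nn_integral_cong) simp
  then show ?case using cong by simp
next
  case (set A)
  then show ?case by (rule eq)
next
  case (mult u c)
  then have [measurable]: "u \<in> borel_measurable N" using measurable_from_subalg[OF sub] by blast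
  note f[measurable] g[measurable]
  show ?case using mult by (simp add: mult.assoc nn_integral_cmult)
next
  case (add u v)
  then have [measurable]: "u \<in> borel_measurable N" "v \<in> borel_measurable N"
    using measurable_from_subalg[OF sub] by blast+
  note f[measurable] g[measurable]
  show ?case using add by (simp add: distrib_right nn_integral_add)
next
  case (seq U)
  then have [measurable]: "U i \<in> borel_measurable N" for i using measurable_from_subalg[OF sub] by blast
  have "(\<integral>\<^sup>+x. (SUP i. U i) x * h x \<partial>N) = (SUP i. \<integral>\<^sup>+x. U i x * h x \<partial>N)"
    if [measurable]: "h \<in> borel_measurable N" for h
  proof -
    have "(\<integral>\<^sup>+x. (SUP i. U i) x * h x \<partial>N) = (\<integral>\<^sup>+x. (SUP i. U i x * h x) \<partial>N)"
      by (simp add: SUP_mult_right_ennreal image_comp)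
    also have "\<dots> = (SUP i. \<integral>\<^sup>+x. U i x * h x \<partial>N)"
      using \<open>incseq U\<close>
      by (intro nn_integral_monotone_convergence_SUP)
        (auto simp: incseq_def le_fun_def intro!: mult_right_mono)
    finally show ?thesis .
  qed
  then show ?case using f g seq by simp
qed

context regular_diffusion
begin

abbreviation "E \<equiv> einterval a b"
abbreviation "borel_E \<equiv> restrict_space borel E"
abbreviation "X_at T \<omega> \<equiv> X (enn2real (T \<omega>)) \<omega>"
abbreviation "weighted r T g \<omega> \<equiv>
  ennreal (exp (- r * enn2real (T \<omega>))) * (indicator {\<omega>. T \<omega> < \<infinity>} \<omega> * g (X_at T \<omega>))"
abbreviation "discounted_after r k \<tau> \<omega> \<equiv>
  (\<integral>\<^sup>+t. indicator {t. 0 \<le> t \<and> \<tau> \<le> ennreal t} t * (ennreal (exp (- r * t)) * k (X (max 0 t) \<omega>)) \<partial>lborel)"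
abbreviation "path_limit r g \<omega> l \<equiv> ((\<lambda>t. exp (- r * t) * g (X t \<omega>)) \<longlongrightarrow> l) at_top"
abbreviation "path_bounded r g \<omega> B \<equiv> \<forall>t\<ge>0. \<bar>exp (- r * t) * g (X t \<omega>)\<bar> \<le> B"

section \<open>Measurability of the paths and of the transition kernel\<close>

lemma interval_subset_E: "p \<in> E \<Longrightarrow> q \<in> E \<Longrightarrow> {p..q} \<subseteq> E"
  by (auto simp: einterval_iff) (meson ereal_less_eq(3) less_le_trans le_less_trans)+

lemma space_P: "x \<in> E \<Longrightarrow> space (P x) = space M"
  by (rule sets_eq_imp_space_eq[OF sets_P])

lemma measurable_P: "x \<in> E \<Longrightarrow> measurable (P x) N = measurable M N"
  by (rule measurable_cong_sets[OF sets_P refl])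

lemma measurable_pair_P: "x \<in> E \<Longrightarrow> measurable (B \<Otimes>\<^sub>M P x) N = measurable (B \<Otimes>\<^sub>M M) N"
  by (intro measurable_cong_sets sets_pair_measure_cong sets_P refl)

lemma measurable_X: "0 \<le> s \<Longrightarrow> X s \<in> borel_measurable M"
  by (rule measurable_from_subalg[OF filtration_sub adapted])

lemma measurable_stopping: "stopping_time F T \<Longrightarrow> T \<in> borel_measurable M"
  by (rule measurable_stopping_time[of F]) (use filtration_sub in \<open>auto simp: subalgebra_def\<close>)

lemma measurable_path [measurable]: "(\<lambda>(t, \<omega>). X (max 0 t) \<omega>) \<in> borel_measurable (borel \<Otimes>\<^sub>M M)"
  by (rule borel_measurable_pair_continuous[OF measurable_X continuous_paths])

lemma measurable_path' [measurable (raw)]: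
  "f \<in> borel_measurable N \<Longrightarrow> g \<in> measurable N M \<Longrightarrow> (\<lambda>z. X (max 0 (f z)) (g z)) \<in> borel_measurable N"
  using measurable_compose[OF measurable_Pair measurable_path] by simp

lemma measurable_P_nn_fixed:
  assumes "0 \<le> s" and k: "k \<in> borel_measurable borel"
  shows "(\<lambda>y. \<integral>\<^sup>+\<omega>. k (X s \<omega>) \<partial>P y) \<in> borel_measurable borel_E"
proof -
  have m: "X s \<in> borel_measurable (P y)" if "y \<in> E" for y
    using measurable_X[OF assms(1)] by (simp add: measurable_P that)
  have "(\<lambda>y. distr (P y) borel (X s)) \<in> borel_E \<rightarrow>\<^sub>M subprob_algebra borel"
  proof (rule measurable_subprob_algebra)
    fix y assume "y \<in> space borel_E"
    then have y: "y \<in> E" by (simp add: space_restrict_space)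
    interpret prob_space "P y" by (rule prob_space_P[OF y])
    show "subprob_space (distr (P y) borel (X s))"
      by (intro prob_space_imp_subprob_space prob_space_distr m y)
  next
    fix A :: "real set" assume A: "A \<in> sets borel"
    have "(\<lambda>y. emeasure (distr (P y) borel (X s)) A) \<in> borel_measurable borel_E \<longleftrightarrow>
        (\<lambda>y. emeasure (P y) {\<omega> \<in> space M. X s \<omega> \<in> A}) \<in> borel_measurable borel_E"
      by (rule measurable_cong)
        (auto simp: space_restrict_space emeasure_distr m A space_P vimage_def Int_def conj_commute)
    then show "(\<lambda>y. emeasure (distr (P y) borel (X s)) A) \<in> borel_measurable borel_E"
      using transition_measurable[OF assms(1) A] by simp
  qed simp
  from measurable_compose[OF this nn_integral_measurable_subprob_algebra[OF k]]
  have "(\<lambda>y. integral\<^sup>N (distr (P y) borel (X s)) k) \<in> borel_measurable borel_E" .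
  also have "?this \<longleftrightarrow> ?thesis"
    by (rule measurable_cong) (auto simp: space_restrict_space nn_integral_distr m k)
  finally show ?thesis .
qed

text \<open>Measurability in the starting point is assumed for one time at a time. The means of
  continuous functions of the position are also continuous in time, because the paths are, hence
  jointly measurable; ramps \<open>h n\<close> that shrink to the indicator of the half line pass
  this on to the distribution function.\<close>

lemma cdf_X_measurable:
  "(\<lambda>(s, y). measure (P y) {\<omega> \<in> space M. X (max 0 s) \<omega> \<le> c})
    \<in> borel_measurable (borel \<Otimes>\<^sub>M borel_E)"
proof -
  define h where "h n z = max 0 (min 1 (1 - real n * (z - c)))" for n and z :: real
  have h01: "0 \<le> h n z" "h n z \<le> 1" for n z by (auto simp: h_def)
  have hc: "continuous_on A (h n)" for n A unfolding h_def by (intro continuous_intros)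
  have [measurable]: "h n \<in> borel_measurable borel" for n
    by (rule borel_measurable_continuous_onI[OF hc])
  have hlim: "(\<lambda>n. h n z) \<longlonglongrightarrow> indicator {..c} z" for z
  proof (cases "z \<le> c")
    case True
    then have "real n * (z - c) \<le> 0" for n by (simp add: mult_nonneg_nonpos)
    then have "h n z = 1" for n by (auto simp: h_def min_def max_def)
    then show ?thesis using True by simp
  next
    case False
    obtain n0 where n0: "1 / (z - c) < real n0" using reals_Archimedean2 by blast
    have "h n z = 0" if "n \<ge> n0" for n
    proof -
      have "1 / (z - c) < real n" using n0 that by linarith
      then have "1 < real n * (z - c)" using False by (simp add: field_simps)
      then show ?thesis by (simp add: h_def)
    qed
    then have "\<forall>\<^sub>F n in sequentially. h n z = 0" by (auto simp: eventually_sequentially)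
    then show ?thesis using False by (simp add: tendsto_eventually)
  qed
  define e where "e n s y = (LINT \<omega>|P y. h n (X s \<omega>))" for n s y
  have int: "integrable (P y) (\<lambda>\<omega>. h n (X s \<omega>))" if y: "y \<in> E" and s: "0 \<le> s" for n s y
  proof -
    interpret prob_space "P y" by (rule prob_space_P[OF y])
    note measurable_X[OF s, folded measurable_P[OF y], measurable]
    show ?thesis by (rule integrable_const_bound[where B = 1]) (auto simp: h01)
  qed
  have e_meas: "e n s \<in> borel_measurable borel_E" if s: "0 \<le> s" for n s
  proof -
    have "(\<lambda>y. enn2real (\<integral>\<^sup>+\<omega>. ennreal (h n (X s \<omega>)) \<partial>P y)) \<in> borel_measurable borel_E"
      by (intro borel_measurable_enn2real measurable_P_nn_fixed s) simp
    also have "?this \<longleftrightarrow> ?thesis"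
      by (rule measurable_cong) (simp add: space_restrict_space e_def nn_integral_eq_integral int s h01 integral_nonneg_AE)
    finally show ?thesis .
  qed
  have e_cont: "continuous_on {0..} (\<lambda>s. e n s y)" if y: "y \<in> E" for n y
    unfolding continuous_on_sequentially
  proof (intro allI ballI impI)
    interpret prob_space "P y" by (rule prob_space_P[OF y])
    fix S :: "nat \<Rightarrow> real" and s assume s: "s \<in> {0..}" and "(\<forall>n. S n \<in> {0..}) \<and> S \<longlonglongrightarrow> s"
    then have S: "\<And>n. 0 \<le> S n" "S \<longlonglongrightarrow> s" "0 \<le> s" by auto
    show "((\<lambda>s. e n s y) \<circ> S) \<longlonglongrightarrow> e n s y"
      unfolding e_def comp_def
    proof (rule integral_dominated_convergence[where w = "\<lambda>_. 1"])
      show "AE \<omega> in P y. (\<lambda>i. h n (X (S i) \<omega>)) \<longlonglongrightarrow> h n (X s \<omega>)"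
      proof (rule AE_I2)
        fix \<omega> assume "\<omega> \<in> space (P y)"
        then have c: "continuous_on {0..} (\<lambda>s. X s \<omega>)" using continuous_paths space_P[OF y] by simp
        have "(\<lambda>i. X (S i) \<omega>) \<longlonglongrightarrow> X s \<omega>"
          by (rule continuous_on_tendsto_compose[OF c]) (use S in auto)
        then show "(\<lambda>i. h n (X (S i) \<omega>)) \<longlonglongrightarrow> h n (X s \<omega>)"
          by (intro continuous_on_tendsto_compose[OF hc[of UNIV]]) auto
      qed
    qed (use int[OF y S(1)] int[OF y S(3)] h01 in \<open>auto intro: borel_measurable_integrable\<close>)
  qed
  show ?thesis
  proof (rule borel_measurable_LIMSEQ_real)
    show "(\<lambda>(s, y). e n (max 0 s) y) \<in> borel_measurable (borel \<Otimes>\<^sub>M borel_E)" for n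
      by (rule borel_measurable_pair_continuous[OF e_meas e_cont]) (auto simp: space_restrict_space)
    fix z :: "real \<times> real" assume "z \<in> space (borel \<Otimes>\<^sub>M borel_E)"
    then obtain s y where z: "z = (s, y)" "y \<in> E" by (auto simp: space_pair_measure space_restrict_space)
    interpret prob_space "P y" by (rule prob_space_P[OF z(2)])
    have "(\<lambda>n. e n (max 0 s) y) \<longlonglongrightarrow> (LINT \<omega>|P y. indicator {..c} (X (max 0 s) \<omega>))"
      unfolding e_def
    proof (rule integral_dominated_convergence[where w = "\<lambda>_. 1"])
      note measurable_X[of "max 0 s", folded measurable_P[OF z(2)], measurable]
      show "(\<lambda>\<omega>. indicator {..c} (X (max 0 s) \<omega>) :: real) \<in> borel_measurable (P y)" by simp
      show "(\<lambda>\<omega>. h i (X (max 0 s) \<omega>)) \<in> borel_measurable (P y)" for i by simp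
    qed (use hlim h01 in auto)
    also have "(LINT \<omega>|P y. indicator {..c} (X (max 0 s) \<omega>)) =
        (LINT \<omega>|P y. indicator {\<omega> \<in> space M. X (max 0 s) \<omega> \<le> c} \<omega>)"
      by (intro Bochner_Integration.integral_cong) (auto simp: space_P z indicator_def)
    also have "\<dots> = measure (P y) {\<omega> \<in> space M. X (max 0 s) \<omega> \<le> c}"
      using measurable_X[of "max 0 s"] by (simp add: Int_absorb2 space_P z Collect_conj_eq)
    finally show "(\<lambda>n. case z of (s, y) \<Rightarrow> e n (max 0 s) y) \<longlonglongrightarrow>
        (case z of (s, y) \<Rightarrow> measure (P y) {\<omega> \<in> space M. X (max 0 s) \<omega> \<le> c})"
      by (simp add: z)
  qed
qed

text \<open>Half lines form an intersection-stable generator, so the distribution functions suffice.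
  A kernel into measures can be composed with a random starting point and used in
  \<open>bind\<close>.\<close>

lemma measurable_transition_kernel:
  "(\<lambda>(s, y). distr (P y) borel (X (max 0 s))) \<in> borel \<Otimes>\<^sub>M borel_E \<rightarrow>\<^sub>M subprob_algebra borel"
proof (rule measurable_subprob_algebra_generated[where G = "range atMost" and \<Omega> = UNIV])
  show "sets borel = sigma_sets UNIV (range (atMost :: real \<Rightarrow> _))"
    by (subst borel_eq_atMost) (rule sets_measure_of, simp)
  show "Int_stable (range (atMost :: real \<Rightarrow> _))" by (auto simp: Int_stable_def)
  have m: "X (max 0 s) \<in> borel_measurable (P y)" if "y \<in> E" for s y
    using measurable_X[of "max 0 s"] by (simp add: measurable_P that)
  have sp: "z \<in> space (borel \<Otimes>\<^sub>M borel_E) \<Longrightarrow> \<exists>s y. z = (s, y) \<and> y \<in> E" for z :: "real \<times> real"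
    by (auto simp: space_pair_measure space_restrict_space)
  have pd: "prob_space (distr (P y) borel (X (max 0 s)))" if "y \<in> E" for s y
    by (rule prob_space.prob_space_distr[OF prob_space_P[OF that] m[OF that]])
  show "subprob_space (case z of (s, y) \<Rightarrow> distr (P y) borel (X (max 0 s)))"
    if "z \<in> space (borel \<Otimes>\<^sub>M borel_E)" for z
    using sp[OF that] by (auto intro!: prob_space_imp_subprob_space pd)
  show "sets (case z of (s, y) \<Rightarrow> distr (P y) borel (X (max 0 s))) = sets borel" for z
    by (simp add: case_prod_beta)
  show "(\<lambda>z. emeasure (case z of (s, y) \<Rightarrow> distr (P y) borel (X (max 0 s))) UNIV)
      \<in> borel_measurable (borel \<Otimes>\<^sub>M borel_E)"
  proof (subst measurable_cong)
    show "emeasure (case z of (s, y) \<Rightarrow> distr (P y) borel (X (max 0 s))) UNIV = 1"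
      if "z \<in> space (borel \<Otimes>\<^sub>M borel_E)" for z
      using sp[OF that] prob_space.emeasure_space_1[OF pd] by auto
  qed simp
  fix A :: "real set" assume "A \<in> range atMost"
  then obtain c where A: "A = {..c}" by auto
  have "(\<lambda>(s, y). ennreal (measure (P y) {\<omega> \<in> space M. X (max 0 s) \<omega> \<le> c}))
      \<in> borel_measurable (borel \<Otimes>\<^sub>M borel_E)"
    using measurable_compose[OF cdf_X_measurable measurable_ennreal] by (simp add: case_prod_beta)
  also have "?this \<longleftrightarrow> (\<lambda>z. emeasure (case z of (s, y) \<Rightarrow> distr (P y) borel (X (max 0 s))) A)
      \<in> borel_measurable (borel \<Otimes>\<^sub>M borel_E)"
  proof (rule measurable_cong)
    fix z :: "real \<times> real" assume "z \<in> space (borel \<Otimes>\<^sub>M borel_E)"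
    then obtain s y where z: "z = (s, y)" "y \<in> E" using sp by blast
    interpret prob_space "P y" by (rule prob_space_P[OF z(2)])
    have "emeasure (distr (P y) borel (X (max 0 s))) A = emeasure (P y) {\<omega> \<in> space M. X (max 0 s) \<omega> \<le> c}"
      using z by (auto simp: A emeasure_distr m space_P intro!: arg_cong2[where f = emeasure])
    then show "(case z of (s, y) \<Rightarrow> ennreal (measure (P y) {\<omega> \<in> space M. X (max 0 s) \<omega> \<le> c})) =
        emeasure (case z of (s, y) \<Rightarrow> distr (P y) borel (X (max 0 s))) A"
      by (simp add: z emeasure_eq_measure)
  qed
  finally show "(\<lambda>z. emeasure (case z of (s, y) \<Rightarrow> distr (P y) borel (X (max 0 s))) A)
      \<in> borel_measurable (borel \<Otimes>\<^sub>M borel_E)" .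
qed auto

definition transition :: "(real \<Rightarrow> ennreal) \<Rightarrow> real \<Rightarrow> real \<Rightarrow> ennreal" where
  "transition k s y = (\<integral>\<^sup>+\<omega>. k (X (max 0 s) \<omega>) \<partial>P y)"

lemma transition_eq_distr:
  assumes "y \<in> E" "k \<in> borel_measurable borel"
  shows "transition k s y = integral\<^sup>N (distr (P y) borel (X (max 0 s))) k"
  using assms measurable_X[of "max 0 s"] by (simp add: transition_def nn_integral_distr measurable_P)

lemma measurable_transition:
  assumes k: "k \<in> borel_measurable borel"
  shows "(\<lambda>(s, y). transition k s y) \<in> borel_measurable (borel \<Otimes>\<^sub>M borel_E)"
proof -
  have "(\<lambda>z. integral\<^sup>N (case z of (s, y) \<Rightarrow> distr (P y) borel (X (max 0 s))) k)
      \<in> borel_measurable (borel \<Otimes>\<^sub>M borel_E)"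
    by (rule measurable_compose[OF measurable_transition_kernel nn_integral_measurable_subprob_algebra[OF k]])
  also have "?this \<longleftrightarrow> ?thesis"
    by (rule measurable_cong) (auto simp: space_pair_measure space_restrict_space transition_eq_distr k)
  finally show ?thesis .
qed

lemma measurable_transition_left:
  assumes "k \<in> borel_measurable borel" "y \<in> E"
  shows "(\<lambda>s. transition k s y) \<in> borel_measurable borel"
proof -
  have "(\<lambda>s. (s, y)) \<in> borel \<rightarrow>\<^sub>M borel \<Otimes>\<^sub>M borel_E"
    using assms(2) by (intro measurable_Pair) (auto simp: space_restrict_space)
  from measurable_compose[OF this measurable_transition[OF assms(1)]] show ?thesis by simp
qed

section \<open>Strong Markov property and the resolvent at stopping times\<close>

lemma measurable_X_stopping:
  assumes T: "T \<in> borel_measurable M"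
  shows "(\<lambda>\<omega>. X_at T \<omega>) \<in> M \<rightarrow>\<^sub>M borel_E"
proof (rule measurable_restrict_space2)
  show "(\<lambda>\<omega>. X_at T \<omega>) \<in> space M \<rightarrow> E" using state_space by auto
  have "(\<lambda>\<omega>. X (max 0 (enn2real (T \<omega>))) \<omega>) \<in> borel_measurable M" using T by measurable
  then show "(\<lambda>\<omega>. X_at T \<omega>) \<in> borel_measurable M" by (simp add: max_absorb2)
qed

text \<open>The assumption concerns events at one later time. On a fixed event of the past it says
  that the law of the later position is a mixture of transition laws, so integrals of
  \<open>k\<close> agree; the weight \<open>Z\<close> then follows by
  \<open>nn_integral_eq_on_subalgebra\<close>.\<close>

lemma strong_markov_nn:
  assumes x: "x \<in> E" and T: "stopping_time F T" and k: "k \<in> borel_measurable borel" and s: "0 \<le> s"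
    and Z: "Z \<in> borel_measurable (pre_sigma T)"
  shows "(\<integral>\<^sup>+\<omega>. Z \<omega> * (indicator {\<omega>. T \<omega> < \<infinity>} \<omega> * k (X (enn2real (T \<omega>) + s) \<omega>)) \<partial>P x) =
    (\<integral>\<^sup>+\<omega>. Z \<omega> * (indicator {\<omega>. T \<omega> < \<infinity>} \<omega> * transition k s (X_at T \<omega>)) \<partial>P x)"
proof (rule nn_integral_eq_on_subalgebra[OF _ _ _ _ Z])
  interpret prob_space "P x" by (rule prob_space_P[OF x])
  note T_M[measurable] = measurable_stopping[OF T]
  have XT[measurable]: "(\<lambda>\<omega>. X (enn2real (T \<omega>) + s) \<omega>) \<in> borel_measurable M"
  proof -
    have "(\<lambda>\<omega>. X (max 0 (enn2real (T \<omega>) + s)) \<omega>) \<in> borel_measurable M" by measurable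
    then show ?thesis using s by (simp add: max_absorb2)
  qed
  have KT: "(\<lambda>\<omega>. distr (P (X_at T \<omega>)) borel (X s)) \<in> M \<rightarrow>\<^sub>M subprob_algebra borel"
    using measurable_compose[OF measurable_Pair[OF measurable_const[of s] measurable_X_stopping[OF T_M]]
        measurable_transition_kernel] s by (simp add: max_absorb2)
  have sT[measurable]: "Measurable.pred M (\<lambda>\<omega>. T \<omega> < \<infinity>)" by measurable
  have tr: "transition k s (X_at T \<omega>) = integral\<^sup>N (distr (P (X_at T \<omega>)) borel (X s)) k"
    if "\<omega> \<in> space M" for \<omega>
    using transition_eq_distr[OF state_space[OF _ that] k, of "enn2real (T \<omega>)" s] s by (simp add: max_absorb2)
  show "subalgebra (P x) (pre_sigma T)"
    unfolding subalgebra_def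
  proof
    show "space (pre_sigma T) = space (P x)" by (simp add: space_pre_sigma space_P x)
    show "sets (pre_sigma T) \<subseteq> sets (P x)"
    proof
      fix A assume A: "A \<in> sets (pre_sigma T)"
      from sets_pre_sigmaD[OF T this, of \<infinity>] have "A \<in> sets (F \<infinity>)" by simp
      then show "A \<in> sets (P x)" using filtration_sub[of \<infinity>] by (auto simp: subalgebra_def sets_P x)
    qed
  qed
  then have setsD: "A \<in> sets M" if "A \<in> sets (pre_sigma T)" for A
    using that by (auto simp: subalgebra_def sets_P x)
  show "(\<lambda>\<omega>. indicator {\<omega>. T \<omega> < \<infinity>} \<omega> * k (X (enn2real (T \<omega>) + s) \<omega>)) \<in> borel_measurable (P x)"
    unfolding measurable_P[OF x] using k by measurable
  have trm: "(\<lambda>\<omega>. transition k s (X_at T \<omega>)) \<in> borel_measurable M"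
    using measurable_compose[OF measurable_Pair[OF measurable_const[of s] measurable_X_stopping[OF T_M]]
        measurable_transition[OF k]] by simp
  then show "(\<lambda>\<omega>. indicator {\<omega>. T \<omega> < \<infinity>} \<omega> * transition k s (X_at T \<omega>)) \<in> borel_measurable (P x)"
    unfolding measurable_P[OF x] by measurable
  fix A assume A: "A \<in> sets (pre_sigma T)"
  define A' where "A' = {\<omega> \<in> A. T \<omega> < \<infinity>}"
  have AM: "A' \<in> sets M"
  proof -
    have "A' = A \<inter> {\<omega> \<in> space M. T \<omega> < \<infinity>}"
      using sets.sets_into_space[OF setsD[OF A]] by (auto simp: A'_def)
    moreover have "{\<omega> \<in> space M. T \<omega> < \<infinity>} \<in> sets M" using sT by (simp add: pred_def)
    ultimately show ?thesis using setsD[OF A] by simp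
  qed
  \<comment> \<open>Restricting the measure to \<open>A'\<close> absorbs the event, so that the
    assumption becomes an equality of two measures on the real line.\<close>
  define N where "N = density (P x) (indicator A')"
  have NM: "measurable N B = measurable M B" for B
    unfolding N_def by (intro measurable_cong_sets) (simp_all add: sets_P x)
  have XTN: "(\<lambda>\<omega>. X (enn2real (T \<omega>) + s) \<omega>) \<in> borel_measurable N" using XT NM by blast
  have spM: "space N = space M" by (simp add: N_def space_P x)
  have spN: "space N \<noteq> {}" unfolding N_def using not_empty by simp
  have eqN: "distr N borel (\<lambda>\<omega>. X (enn2real (T \<omega>) + s) \<omega>) =
      N \<bind> (\<lambda>\<omega>. distr (P (X_at T \<omega>)) borel (X s))"
  proof (rule measure_eqI)
    show "sets (distr N borel (\<lambda>\<omega>. X (enn2real (T \<omega>) + s) \<omega>)) =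
      sets (N \<bind> (\<lambda>\<omega>. distr (P (X_at T \<omega>)) borel (X s)))"
      by (subst sets_bind[where N = borel]) (use spN in auto)
    fix B assume "B \<in> sets (distr N borel (\<lambda>\<omega>. X (enn2real (T \<omega>) + s) \<omega>))"
    then have B: "B \<in> sets borel" by simp
    have BM: "(\<lambda>\<omega>. X (enn2real (T \<omega>) + s) \<omega>) -` B \<inter> space M \<in> sets M"
      by (rule measurable_sets[OF XT B])
    have "emeasure (distr N borel (\<lambda>\<omega>. X (enn2real (T \<omega>) + s) \<omega>)) B =
        emeasure N ((\<lambda>\<omega>. X (enn2real (T \<omega>) + s) \<omega>) -` B \<inter> space M)"
      by (simp add: emeasure_distr[OF XTN B] spM)
    also have "\<dots> = emeasure (P x) (A' \<inter> ((\<lambda>\<omega>. X (enn2real (T \<omega>) + s) \<omega>) -` B \<inter> space M))"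
      unfolding N_def using AM BM
      by (subst emeasure_density) (auto simp: sets_P x measurable_P indicator_inter_arith[symmetric])
    also have "A' \<inter> ((\<lambda>\<omega>. X (enn2real (T \<omega>) + s) \<omega>) -` B \<inter> space M) =
        {\<omega> \<in> A. T \<omega> < \<infinity> \<and> X (enn2real (T \<omega>) + s) \<omega> \<in> B}"
      using sets.sets_into_space[OF setsD[OF A]] by (auto simp: A'_def)
    also have "emeasure (P x) \<dots> = (\<integral>\<^sup>+\<omega>. emeasure (P (X_at T \<omega>)) {\<omega>' \<in> space M. X s \<omega>' \<in> B} *
        indicator A' \<omega> \<partial>P x)"
      unfolding A'_def by (rule strong_markov[OF x T A s B])
    also have "\<dots> = (\<integral>\<^sup>+\<omega>. indicator A' \<omega> * emeasure (distr (P (X_at T \<omega>)) borel (X s)) B \<partial>P x)"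
    proof (rule nn_integral_cong)
      fix \<omega> assume "\<omega> \<in> space (P x)"
      then have y: "X_at T \<omega> \<in> E" using space_P[OF x] by (intro state_space) auto
      show "emeasure (P (X_at T \<omega>)) {\<omega>' \<in> space M. X s \<omega>' \<in> B} * indicator A' \<omega> =
          indicator A' \<omega> * emeasure (distr (P (X_at T \<omega>)) borel (X s)) B"
        using measurable_X[OF s] B
        by (subst emeasure_distr) (auto simp: measurable_P y space_P mult.commute vimage_def Int_def conj_commute)
    qed
    also have "\<dots> = (\<integral>\<^sup>+\<omega>. emeasure (distr (P (X_at T \<omega>)) borel (X s)) B \<partial>N)"
      unfolding N_def using AM KT B
      by (subst nn_integral_density) (auto simp: sets_P x measurable_P intro: measurable_emeasure_kernel)
    also have "\<dots> = emeasure (N \<bind> (\<lambda>\<omega>. distr (P (X_at T \<omega>)) borel (X s))) B"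
      by (rule emeasure_bind[symmetric, OF spN _ B]) (simp add: NM KT)
    finally show "emeasure (distr N borel (\<lambda>\<omega>. X (enn2real (T \<omega>) + s) \<omega>)) B =
      emeasure (N \<bind> (\<lambda>\<omega>. distr (P (X_at T \<omega>)) borel (X s))) B" .
  qed
  have ind: "indicator A \<omega> * (indicator {\<omega>. T \<omega> < \<infinity>} \<omega> * z) = indicator A' \<omega> * z" for \<omega> and z :: ennreal
    by (auto simp: A'_def indicator_def)
  have "(\<integral>\<^sup>+\<omega>. indicator A' \<omega> * k (X (enn2real (T \<omega>) + s) \<omega>) \<partial>P x) =
      (\<integral>\<^sup>+\<omega>. k (X (enn2real (T \<omega>) + s) \<omega>) \<partial>N)"
    unfolding N_def using AM XT k
    by (subst nn_integral_density) (auto simp: sets_P x measurable_P intro: measurable_compose[OF XT k])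
  also have "\<dots> = integral\<^sup>N (distr N borel (\<lambda>\<omega>. X (enn2real (T \<omega>) + s) \<omega>)) k"
    by (rule nn_integral_distr[OF XTN, symmetric]) (simp add: k)
  also have "\<dots> = (\<integral>\<^sup>+\<omega>. integral\<^sup>N (distr (P (X_at T \<omega>)) borel (X s)) k \<partial>N)"
    unfolding eqN by (rule nn_integral_bind[OF k]) (simp add: NM KT)
  also have "\<dots> = (\<integral>\<^sup>+\<omega>. transition k s (X_at T \<omega>) \<partial>N)"
    by (rule nn_integral_cong) (simp add: N_def space_P x tr)
  also have "\<dots> = (\<integral>\<^sup>+\<omega>. indicator A' \<omega> * transition k s (X_at T \<omega>) \<partial>P x)"
    unfolding N_def using AM trm by (subst nn_integral_density) (auto simp: sets_P x measurable_P)
  finally show "(\<integral>\<^sup>+\<omega>. indicator A \<omega> * (indicator {\<omega>. T \<omega> < \<infinity>} \<omega> * k (X (enn2real (T \<omega>) + s) \<omega>)) \<partial>P x) =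
      (\<integral>\<^sup>+\<omega>. indicator A \<omega> * (indicator {\<omega>. T \<omega> < \<infinity>} \<omega> * transition k s (X_at T \<omega>)) \<partial>P x)"
    unfolding ind .
qed

text \<open>The \<open>r\<close>-potential of \<open>k\<close>. It is written through one-time laws
  because only these are accessible to the strong Markov property.\<close>

definition resolvent :: "real \<Rightarrow> (real \<Rightarrow> ennreal) \<Rightarrow> real \<Rightarrow> ennreal" where
  "resolvent r k y = (\<integral>\<^sup>+s. ennreal (exp (- r * s)) * transition k s y * indicator {0..} s \<partial>lborel)"

text \<open>For each fixed lag \<open>s\<close> the strong Markov property applies; Tonelli
  exchanges lag and expectation, and the substitution \<open>t = T + s\<close> turns the lag into
  clock time.\<close>

lemma resolvent_stopping:
  assumes x: "x \<in> E" and T: "stopping_time F T" and k: "k \<in> borel_measurable borel"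
  shows "(\<integral>\<^sup>+\<omega>. weighted r T (resolvent r k) \<omega> \<partial>P x) =
    (\<integral>\<^sup>+\<omega>. discounted_after r k (T \<omega>) \<omega> \<partial>P x)"
proof -
  interpret prob_space "P x" by (rule prob_space_P[OF x])
  interpret pair_sigma_finite lborel "P x" ..
  note T_M[measurable] = measurable_stopping[OF T]
  note k[measurable]
  let ?Z = "\<lambda>\<omega>. ennreal (exp (- r * enn2real (T \<omega>)))"
  let ?A = "\<lambda>s \<omega>. ennreal (exp (- r * s)) * indicator {0..} s * weighted r T (transition k s) \<omega>"
  let ?B = "\<lambda>s \<omega>. ennreal (exp (- r * s)) * indicator {0..} s *
    (?Z \<omega> * (indicator {\<omega>. T \<omega> < \<infinity>} \<omega> * k (X (max 0 (enn2real (T \<omega>) + max 0 s)) \<omega>)))"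
  have Zm: "?Z \<in> borel_measurable (pre_sigma T)"
    using measurable_stopping_time_pre_sigma[OF T] by measurable
  have Tlt[measurable]: "Measurable.pred M (\<lambda>\<omega>. T \<omega> < \<infinity>)" by measurable
  have trm: "(\<lambda>(s, \<omega>). transition k s (X_at T \<omega>)) \<in> borel_measurable (borel \<Otimes>\<^sub>M M)"
  proof -
    have "(\<lambda>z. (fst z, X (enn2real (T (snd z))) (snd z))) \<in> borel \<Otimes>\<^sub>M M \<rightarrow>\<^sub>M borel \<Otimes>\<^sub>M borel_E"
      by (intro measurable_Pair measurable_fst measurable_compose[OF measurable_snd measurable_X_stopping[OF T_M]])
    from measurable_compose[OF this measurable_transition[OF k]] show ?thesis by (simp add: case_prod_beta)
  qed
  have trm1: "(\<lambda>s. transition k s y) \<in> borel_measurable borel" if "y \<in> E" for y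
    using measurable_transition_left[OF k that] .
  have m1: "(\<lambda>(s, \<omega>). ?A s \<omega>) \<in> borel_measurable (lborel \<Otimes>\<^sub>M P x)"
  proof -
    have "(\<lambda>(s, \<omega>). ennreal (exp (- r * s)) * indicator {0..} s *
      (?Z \<omega> * (indicator {\<omega>. T \<omega> < \<infinity>} \<omega> * (\<lambda>(s, \<omega>). transition k s (X_at T \<omega>)) (s, \<omega>)))) \<in> borel_measurable (borel \<Otimes>\<^sub>M M)"
      using trm by measurable
    then show ?thesis by (simp add: measurable_pair_P[OF x] cong: measurable_cong_sets)
  qed
  have m2: "(\<lambda>(s, \<omega>). ?B s \<omega>) \<in> borel_measurable (lborel \<Otimes>\<^sub>M P x)"
  proof -
    have "(\<lambda>(s, \<omega>). ?B s \<omega>) \<in> borel_measurable (borel \<Otimes>\<^sub>M M)"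
      by measurable
    then show ?thesis by (simp add: measurable_pair_P[OF x] cong: measurable_cong_sets)
  qed
  have "(\<integral>\<^sup>+\<omega>. weighted r T (resolvent r k) \<omega> \<partial>P x) =
     (\<integral>\<^sup>+\<omega>. (\<integral>\<^sup>+s. ?A s \<omega> \<partial>lborel) \<partial>P x)"
  proof (rule nn_integral_cong)
    fix \<omega> assume "\<omega> \<in> space (P x)"
    then have y: "X_at T \<omega> \<in> E" using space_P[OF x] by (intro state_space) auto
    have "(\<integral>\<^sup>+s. ?A s \<omega> \<partial>lborel) =
      (\<integral>\<^sup>+s. (?Z \<omega> * indicator {\<omega>. T \<omega> < \<infinity>} \<omega>) *
        (ennreal (exp (- r * s)) * transition k s (X_at T \<omega>) * indicator {0..} s) \<partial>lborel)"
      by (intro nn_integral_cong) (simp add: mult_ac)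
    also have "\<dots> = (?Z \<omega> * indicator {\<omega>. T \<omega> < \<infinity>} \<omega>) * resolvent r k (X_at T \<omega>)"
      unfolding resolvent_def using trm1[OF y] by (intro nn_integral_cmult) simp
    finally show "weighted r T (resolvent r k) \<omega> =
      (\<integral>\<^sup>+s. ?A s \<omega> \<partial>lborel)"
      by (simp add: mult.assoc)
  qed
  also have "\<dots> = (\<integral>\<^sup>+s. (\<integral>\<^sup>+\<omega>. ?A s \<omega> \<partial>P x) \<partial>lborel)"
    by (rule Fubini'[OF m1])
  also have "\<dots> = (\<integral>\<^sup>+s. (\<integral>\<^sup>+\<omega>. ?B s \<omega> \<partial>P x) \<partial>lborel)"
  proof (rule nn_integral_cong)
    fix s :: real
    show "(\<integral>\<^sup>+\<omega>. ?A s \<omega> \<partial>P x) =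
      (\<integral>\<^sup>+\<omega>. ?B s \<omega> \<partial>P x)"
    proof (cases "0 \<le> s")
      case True
      have a1: "(\<lambda>\<omega>. weighted r T (transition k s) \<omega>) \<in> borel_measurable (P x)"
      proof -
        have [measurable]: "(\<lambda>\<omega>. transition k s (X_at T \<omega>)) \<in> borel_measurable M"
          using measurable_compose[OF measurable_Pair[OF measurable_const[of s] measurable_X_stopping[OF T_M]]
            measurable_transition[OF k]] by simp
        show ?thesis unfolding measurable_P[OF x] by measurable
      qed
      have a2: "(\<lambda>\<omega>. ?Z \<omega> * (indicator {\<omega>. T \<omega> < \<infinity>} \<omega> * k (X (max 0 (enn2real (T \<omega>) + max 0 s)) \<omega>))) \<in> borel_measurable (P x)"
        unfolding measurable_P[OF x] by measurable
      show ?thesis unfolding nn_integral_cmult[OF a1] nn_integral_cmult[OF a2]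
        using strong_markov_nn[OF x T k True Zm] True by (simp add: max_absorb2)
    qed simp
  qed
  also have "\<dots> = (\<integral>\<^sup>+\<omega>. (\<integral>\<^sup>+s. ?B s \<omega> \<partial>lborel) \<partial>P x)"
    by (rule Fubini'[OF m2, symmetric])
  also have "\<dots> = (\<integral>\<^sup>+\<omega>. discounted_after r k (T \<omega>) \<omega> \<partial>P x)"
  proof (rule nn_integral_cong)
    fix \<omega> assume "\<omega> \<in> space (P x)"
    then have w: "\<omega> \<in> space M" using space_P[OF x] by simp
    have [measurable]: "(\<lambda>t. X (max 0 t) \<omega>) \<in> borel_measurable borel"
      using w by measurable
    show "(\<integral>\<^sup>+s. ?B s \<omega> \<partial>lborel) =
      discounted_after r k (T \<omega>) \<omega>"
    proof (cases "T \<omega>")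
      case (real v)
      define f where "f t = indicator {t. 0 \<le> t \<and> T \<omega> \<le> ennreal t} t * (ennreal (exp (- r * t)) * k (X (max 0 t) \<omega>))" for t
      have m: "f \<in> borel_measurable borel" unfolding f_def by measurable
      \<comment> \<open>A negative lag corresponds to a time before \<open>T\<close>, where both
        sides vanish.\<close>
      have "?B s \<omega> = f (v + s)" for s
      proof (cases "0 \<le> s")
        case True
        have "ennreal (exp (- r * s)) * ennreal (exp (- r * v)) = ennreal (exp (- r * (v + s)))"
          by (simp add: ennreal_mult[symmetric] exp_add[symmetric] algebra_simps)
        then show ?thesis using real True by (simp add: f_def mult.assoc[symmetric])
      next
        case False
        then have "\<not> (0 \<le> v + s \<and> T \<omega> \<le> ennreal (v + s))" using real by (auto simp: ennreal_le_iff)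
        then show ?thesis using False by (simp add: f_def)
      qed
      then show ?thesis using nn_integral_real_affine[OF m, of 1 v] by (simp add: f_def)
    next
      case top
      then have "indicator {t. 0 \<le> t \<and> T \<omega> \<le> ennreal t} t = (0 :: ennreal)" for t by (simp add: top_unique)
      with top show ?thesis by simp
    qed
  qed
  finally show ?thesis .
qed

text \<open>A bridge from the Bochner time integral in \<open>generator_identity\<close> to
  nonnegative integrals of \<open>transition\<close>. Boundedness on the finite horizon gives
  integrability, and Tonelli exchanges time and expectation.\<close>

lemma expected_time_integral:
  fixes w :: "real \<Rightarrow> real"
  assumes x: "x \<in> E" and w[measurable]: "w \<in> borel_measurable borel"
    and w0: "\<And>z. 0 \<le> w z" and wC: "\<And>z. w z \<le> C" and t: "0 \<le> t"
  shows "\<omega> \<in> space M \<Longrightarrow> set_integrable lborel {0..t} (\<lambda>u. w (X u \<omega>))"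
    and "integrable (P x) (\<lambda>\<omega>. LBINT u:{0..t}. w (X u \<omega>))"
    and "ennreal (LINT \<omega>|P x. (LBINT u:{0..t}. w (X u \<omega>))) =
      (\<integral>\<^sup>+u. transition (\<lambda>z. ennreal (w z)) u x * indicator {0..t} u \<partial>lborel)"
proof -
  interpret prob_space "P x" by (rule prob_space_P[OF x])
  interpret pair_sigma_finite lborel "P x" ..
  have C0: "0 \<le> C" using w0[of 0] wC[of 0] by linarith
  have eq: "indicator {0..t} u *\<^sub>R w (X u \<omega>) = indicator {0..t} u * w (X (max 0 u) \<omega>)" for u \<omega>
    by (auto simp: indicator_def)
  have m: "(\<lambda>u. indicator {0..t} u * w (X (max 0 u) \<omega>)) \<in> borel_measurable borel" if "\<omega> \<in> space M" for \<omega>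
    using that by measurable
  show si: "set_integrable lborel {0..t} (\<lambda>u. w (X u \<omega>))" if "\<omega> \<in> space M" for \<omega>
    unfolding set_integrable_def eq
    using m[OF that] w0 wC by (intro integrableI_bounded_set[where A = "{0..t}" and B = C]) (auto simp: indicator_def t)
  define g where "g \<omega> = (LBINT u:{0..t}. w (X u \<omega>))" for \<omega>
  have g0: "0 \<le> g \<omega>" for \<omega>
    unfolding g_def set_lebesgue_integral_def by (intro integral_nonneg_AE) (auto simp: w0)
  have gn: "ennreal (g \<omega>) = (\<integral>\<^sup>+u. ennreal (indicator {0..t} u * w (X (max 0 u) \<omega>)) \<partial>lborel)" if "\<omega> \<in> space M" for \<omega>
    unfolding g_def set_lebesgue_integral_def eq
    using si[OF that] unfolding set_integrable_def eq
    by (intro nn_integral_eq_integral[symmetric]) (auto simp: w0)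
  have gC: "g \<omega> \<le> C * t" if "\<omega> \<in> space M" for \<omega>
  proof -
    have "ennreal (g \<omega>) \<le> (\<integral>\<^sup>+u. ennreal C * indicator {0..t} u \<partial>lborel)"
      unfolding gn[OF that] using w0 wC C0
      by (intro nn_integral_mono) (auto simp: indicator_def ennreal_leI)
    also have "\<dots> = ennreal (C * t)" using t C0 by (simp add: nn_integral_cmult ennreal_mult)
    finally show ?thesis using C0 t by (simp add: ennreal_le_iff)
  qed
  have m2: "(\<lambda>(u, \<omega>). ennreal (indicator {0..t} u * w (X (max 0 u) \<omega>))) \<in> borel_measurable (lborel \<Otimes>\<^sub>M P x)"
  proof -
    have "(\<lambda>(u, \<omega>). ennreal (indicator {0..t} u * w (X (max 0 u) \<omega>))) \<in> borel_measurable (borel \<Otimes>\<^sub>M M)"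
      by measurable
    then show ?thesis by (simp add: measurable_pair_P[OF x] cong: measurable_cong_sets)
  qed
  have gm: "g \<in> borel_measurable (P x)"
  proof -
    have "(\<lambda>\<omega>. enn2real (\<integral>\<^sup>+u. ennreal (indicator {0..t} u * w (X (max 0 u) \<omega>)) \<partial>lborel)) \<in> borel_measurable (P x)"
      using measurable_compose[OF measurable_pair_swap' m2]
      by (intro borel_measurable_enn2real lborel.borel_measurable_nn_integral) (auto simp: case_prod_beta)
    also have "?this \<longleftrightarrow> ?thesis"
      by (rule measurable_cong) (simp add: gn[symmetric] space_P x g0)
    finally show ?thesis .
  qed
  have gi: "integrable (P x) g"
    by (rule integrable_const_bound[where B = "C * t"]) (auto simp: g0 gC gm space_P x)
  then show "integrable (P x) (\<lambda>\<omega>. LBINT u:{0..t}. w (X u \<omega>))" by (simp add: g_def[abs_def])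
  have "ennreal (LINT \<omega>|P x. g \<omega>) = (\<integral>\<^sup>+\<omega>. ennreal (g \<omega>) \<partial>P x)"
    by (rule nn_integral_eq_integral[symmetric]) (auto simp: gi g0)
  also have "\<dots> = (\<integral>\<^sup>+\<omega>. (\<integral>\<^sup>+u. ennreal (indicator {0..t} u * w (X (max 0 u) \<omega>)) \<partial>lborel) \<partial>P x)"
    by (intro nn_integral_cong) (simp add: gn space_P x)
  also have "\<dots> = (\<integral>\<^sup>+u. (\<integral>\<^sup>+\<omega>. ennreal (indicator {0..t} u * w (X (max 0 u) \<omega>)) \<partial>P x) \<partial>lborel)"
    by (rule Fubini'[OF m2])
  also have "\<dots> = (\<integral>\<^sup>+u. transition (\<lambda>z. ennreal (w z)) u x * indicator {0..t} u \<partial>lborel)"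
    by (intro nn_integral_cong) (auto simp: transition_def indicator_def)
  finally show "ennreal (LINT \<omega>|P x. (LBINT u:{0..t}. w (X u \<omega>))) =
      (\<integral>\<^sup>+u. transition (\<lambda>z. ennreal (w z)) u x * indicator {0..t} u \<partial>lborel)"
    by (simp add: g_def)
qed

section \<open>The resolvent as inverse of the generator\<close>

lemma transition_le:
  assumes "x \<in> E" "\<And>z. k z \<le> c"
  shows "transition k s x \<le> c"
proof -
  interpret prob_space "P x" by (rule prob_space_P[OF assms(1)])
  have "transition k s x \<le> (\<integral>\<^sup>+\<omega>. c \<partial>P x)" unfolding transition_def by (intro nn_integral_mono assms)
  then show ?thesis by (simp add: emeasure_space_1)
qed

lemma resolvent_finite:
  assumes r: "0 < r" and x: "x \<in> E" and k: "\<And>z. k z \<le> ennreal C"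
  shows "resolvent r k x < \<infinity>"
proof -
  have "resolvent r k x \<le> (\<integral>\<^sup>+s. ennreal (\<bar>C\<bar> / r) * (ennreal (r * exp (- r * s)) * indicator {0..} s) \<partial>lborel)"
    unfolding resolvent_def
  proof (rule nn_integral_mono)
    fix s :: real
    have "transition k s x \<le> ennreal \<bar>C\<bar>"
      using transition_le[OF x k] by (rule order_trans) (simp add: ennreal_leI)
    then have "ennreal (exp (- r * s)) * transition k s x \<le> ennreal (exp (- r * s)) * ennreal \<bar>C\<bar>"
      by (intro mult_left_mono) auto
    also have "\<dots> = ennreal (\<bar>C\<bar> / r) * ennreal (r * exp (- r * s))"
      using r by (simp add: ennreal_mult[symmetric] mult.commute)
    finally show "ennreal (exp (- r * s)) * transition k s x * indicator {0..} s \<le>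
        ennreal (\<bar>C\<bar> / r) * (ennreal (r * exp (- r * s)) * indicator {0..} s)"
      by (auto simp: indicator_def)
  qed
  also have "\<dots> = ennreal (\<bar>C\<bar> / r) * ennreal (exp (- r * 0))"
    unfolding nn_integral_exp_atLeast[OF r, symmetric] by (rule nn_integral_cmult) simp
  also have "\<dots> < \<infinity>" by simp
  finally show ?thesis .
qed

lemma measurable_resolvent:
  assumes k: "k \<in> borel_measurable borel"
  shows "resolvent r k \<in> borel_measurable borel_E"
proof -
  have "(\<lambda>z. transition k (snd z) (fst z)) \<in> borel_measurable (borel_E \<Otimes>\<^sub>M lborel)"
    using measurable_compose[OF measurable_pair_swap' measurable_transition[OF k]]
    by (simp add: case_prod_beta cong: measurable_cong_sets)
  then have "(\<lambda>z. ennreal (exp (- r * snd z)) * transition k (snd z) (fst z) * indicator {0..} (snd z))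
      \<in> borel_measurable (borel_E \<Otimes>\<^sub>M lborel)"
    by measurable
  then have "(\<lambda>y. \<integral>\<^sup>+s. ennreal (exp (- r * s)) * transition k s y * indicator {0..} s \<partial>lborel)
      \<in> borel_measurable borel_E"
    by (intro lborel.borel_measurable_nn_integral) (simp add: case_prod_beta)
  then show ?thesis by (simp add: resolvent_def[abs_def])
qed

text \<open>The coefficients are bounded on compact sets only. Off \<open>K\<close> the function
  vanishes on an open set, so its derivatives vanish there and the coefficients do no harm.\<close>

lemma generator_bounded:
  assumes u: "C2_on UNIV u" and K: "compact K" "K \<subseteq> E" and 0: "\<And>y. y \<notin> K \<Longrightarrow> u y = 0"
  obtains C where "\<And>y. y \<in> E \<Longrightarrow> \<bar>generator \<mu> D u y\<bar> \<le> C" "\<And>y. \<bar>u y\<bar> \<le> C"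
proof -
  note uc = C2_on_continuous_on[OF u]
  have bd: "\<exists>c\<ge>0. \<forall>y\<in>K. \<bar>g y\<bar> \<le> c" if "bounded (g ` K)" for g :: "real \<Rightarrow> real"
    using that unfolding bounded_pos by (auto intro: less_imp_le)
  have bc: "bounded (g ` K)" if "continuous_on UNIV g" for g :: "real \<Rightarrow> real"
    by (intro compact_imp_bounded compact_continuous_image continuous_on_subset[OF that] K(1)) auto
  obtain c0 c1 c2 m d where c: "0 \<le> c0" "0 \<le> c1" "0 \<le> c2" "0 \<le> m" "0 \<le> d"
    "\<And>y. y \<in> K \<Longrightarrow> \<bar>u y\<bar> \<le> c0" "\<And>y. y \<in> K \<Longrightarrow> \<bar>deriv u y\<bar> \<le> c1" "\<And>y. y \<in> K \<Longrightarrow> \<bar>deriv (deriv u) y\<bar> \<le> c2"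
    "\<And>y. y \<in> K \<Longrightarrow> \<bar>\<mu> y\<bar> \<le> m" "\<And>y. y \<in> K \<Longrightarrow> \<bar>D y\<bar> \<le> d"
    using bd[OF bc[OF uc(1)]] bd[OF bc[OF uc(2)]] bd[OF bc[OF uc(3)]]
      bd[OF drift_locally_bounded[OF K]] bd[OF diffusion_locally_bounded[OF K]] by metis
  have op: "open (- K)" using K(1) by (simp add: compact_imp_closed open_Compl)
  have d1: "deriv u y = 0" if "y \<notin> K" for y
    by (rule DERIV_imp_deriv, rule has_field_derivative_transform_within_open[of "\<lambda>_. 0" 0 y "- K"])
      (use that op 0 in auto)
  have d2: "deriv (deriv u) y = 0" if "y \<notin> K" for y
    by (rule DERIV_imp_deriv, rule has_field_derivative_transform_within_open[of "\<lambda>_. 0" 0 y "- K"])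
      (use that op d1 in auto)
  show ?thesis
  proof (rule that[of "m * c1 + d * c2 + c0"])
    fix y
    show "\<bar>u y\<bar> \<le> m * c1 + d * c2 + c0"
      using c(1-5) c(6)[of y] 0[of y] by (cases "y \<in> K") (auto simp: add_increasing)
    have "\<bar>\<mu> y * deriv u y\<bar> \<le> m * c1" "\<bar>D y * deriv (deriv u) y\<bar> \<le> d * c2"
      using c d1[of y] d2[of y] by (cases "y \<in> K"; auto simp: abs_mult intro!: mult_mono)+
    then show "\<bar>generator \<mu> D u y\<bar> \<le> m * c1 + d * c2 + c0" using c(1) unfolding generator_def by linarith
  qed
qed

lemma E_borel: "E \<in> sets borel"
  by (rule borel_open[OF open_einterval])

lemma measurable_generator:
  assumes "C2_on UNIV u"
  shows "(\<lambda>y. indicator E y * generator \<mu> D u y) \<in> borel_measurable borel"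
proof -
  note uc = C2_on_continuous_on[OF assms, THEN borel_measurable_continuous_onI]
  have "generator \<mu> D u \<in> borel_measurable borel_E"
    unfolding generator_def[abs_def]
    by (intro borel_measurable_add borel_measurable_times drift_measurable diffusion_measurable
        measurable_restrict_space1 uc)
  then show ?thesis using E_borel by (simp add: borel_measurable_restrict_space_iff)
qed

text \<open>The positive and the negative part of \<open>(r - L)u\<close> are kept apart so that all integrals are
  nonnegative.\<close>

lemma resolvent_generator:
  assumes u: "C2_on UNIV u" and K: "compact K" "K \<subseteq> E" and 0: "\<And>y. y \<notin> K \<Longrightarrow> u y = 0"
    and u0: "\<And>y. 0 \<le> u y" and r: "0 < r" and x: "x \<in> E"
  defines "kp \<equiv> \<lambda>y. ennreal (max 0 (indicator E y * (r * u y - generator \<mu> D u y)))"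
    and "km \<equiv> \<lambda>y. ennreal (max 0 (indicator E y * (generator \<mu> D u y - r * u y)))"
  shows "kp \<in> borel_measurable borel" "km \<in> borel_measurable borel" "resolvent r km x < \<infinity>"
    "resolvent r kp x = ennreal (u x) + resolvent r km x"
proof -
  interpret prob_space "P x" by (rule prob_space_P[OF x])
  obtain C where C: "\<And>y. y \<in> E \<Longrightarrow> \<bar>generator \<mu> D u y\<bar> \<le> C" "\<And>y. \<bar>u y\<bar> \<le> C"
    using generator_bounded[OF u K 0] by blast
  have C0: "0 \<le> C" using C(2)[of 0] by linarith
  have um: "u \<in> borel_measurable borel"
    by (rule borel_measurable_continuous_onI[OF C2_on_continuous_on(1)[OF u]])
  define wp where "wp y = max 0 (indicator E y * (r * u y - generator \<mu> D u y))" for y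
  define wm where "wm y = max 0 (indicator E y * (generator \<mu> D u y - r * u y))" for y
  have wpm: "wp \<in> borel_measurable borel" "wm \<in> borel_measurable borel"
    unfolding wp_def wm_def right_diff_distrib
    using measurable_generator[OF u] um E_borel by (intro borel_measurable_max borel_measurable_diff; simp)+
  have kw: "kp = (\<lambda>z. ennreal (wp z))" "km = (\<lambda>z. ennreal (wm z))" by (auto simp: kp_def km_def wp_def wm_def)
  show kpm: "kp \<in> borel_measurable borel" and kmm: "km \<in> borel_measurable borel"
    unfolding kw using wpm by simp_all
  have w0: "0 \<le> wp z" "0 \<le> wm z" for z by (auto simp: wp_def wm_def)
  have rC: "\<bar>r * u z\<bar> \<le> r * C" for z using C(2)[of z] r by (simp add: abs_mult)
  have rC0: "0 \<le> r * C" using C0 r by simp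
  have wC: "wp z \<le> r * C + C" "wm z \<le> r * C + C" for z
    using C(1)[of z] rC[of z] C0 rC0 by (cases "z \<in> E"; simp add: wp_def wm_def abs_le_iff)+
  have uC: "u z \<le> C" for z using C(2)[of z] by linarith
  show fin: "resolvent r km x < \<infinity>"
    by (rule resolvent_finite[OF r x, of _ "r * C + C"]) (simp add: kw wC ennreal_leI)
  define m where "m s = transition (\<lambda>z. ennreal (u z)) s x" for s
  have mm[measurable]: "m \<in> borel_measurable borel"
    unfolding m_def[abs_def] by (rule measurable_transition_left[OF _ x]) (use um in simp)
  have pm[measurable]: "(\<lambda>s. transition kp s x) \<in> borel_measurable borel"
    by (rule measurable_transition_left[OF kpm x])
  have nm[measurable]: "(\<lambda>s. transition km s x) \<in> borel_measurable borel"
    by (rule measurable_transition_left[OF kmm x])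
  let ?I = "\<lambda>k s. \<integral>\<^sup>+v. transition k v x * indicator {0..s} v \<partial>lborel"
  let ?J = "\<lambda>s. \<integral>\<^sup>+v. (ennreal r * m v) * indicator {0..s} v \<partial>lborel"
  \<comment> \<open>Dynkin's formula with \<open>L u = r u - wp + wm\<close> on \<open>E\<close>,
    the negative terms moved to the other side so that everything is nonnegative.\<close>
  have key: "m t + ?I kp t =
      ennreal (u x) + ?J t +
      ?I km t" if t: "0 \<le> t" for t
  proof -
    note ip = expected_time_integral[OF x wpm(1) w0(1) wC(1) t]
    note im = expected_time_integral[OF x wpm(2) w0(2) wC(2) t]
    note iu = expected_time_integral[OF x um u0 uC t]
    have gen: "(LBINT v:{0..t}. generator \<mu> D u (X v \<omega>)) =
        r * (LBINT v:{0..t}. u (X v \<omega>)) - (LBINT v:{0..t}. wp (X v \<omega>)) + (LBINT v:{0..t}. wm (X v \<omega>))"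
      if w: "\<omega> \<in> space M" for \<omega>
    proof -
      have "(LBINT v:{0..t}. generator \<mu> D u (X v \<omega>)) = (LBINT v:{0..t}. r * u (X v \<omega>) - wp (X v \<omega>) + wm (X v \<omega>))"
      proof (rule set_lebesgue_integral_cong)
        show "\<forall>v. v \<in> {0..t} \<longrightarrow> generator \<mu> D u (X v \<omega>) = r * u (X v \<omega>) - wp (X v \<omega>) + wm (X v \<omega>)"
          using state_space[OF _ w] by (auto simp: wp_def wm_def max_def)
      qed simp
      also have "\<dots> = r * (LBINT v:{0..t}. u (X v \<omega>)) - (LBINT v:{0..t}. wp (X v \<omega>)) + (LBINT v:{0..t}. wm (X v \<omega>))"
        using ip(1)[OF w] im(1)[OF w] iu(1)[OF w] by simp
      finally show ?thesis .
    qed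
    let ?L = "\<lambda>g. LINT \<omega>|P x. (LBINT v:{0..t}. g (X v \<omega>))"
    have Xt: "X t \<in> borel_measurable (P x)" using measurable_X[OF t] by (simp add: measurable_P x)
    have ui: "integrable (P x) (\<lambda>\<omega>. u (X t \<omega>))"
      using C(2) by (intro integrable_const_bound[where B = C]) (auto intro: measurable_compose[OF Xt um])
    have "m t = ennreal (LINT \<omega>|P x. u (X t \<omega>))"
      unfolding m_def transition_def using t u0 ui by (simp add: max_absorb2 nn_integral_eq_integral)
    moreover have "?J t =
        ennreal (r * ?L u)"
      using r iu(3) by (simp add: m_def[symmetric] mult.assoc nn_integral_cmult ennreal_mult')
    moreover have "(LINT \<omega>|P x. u (X t \<omega>)) = u x + (LINT \<omega>|P x. (LBINT v:{0..t}. generator \<mu> D u (X v \<omega>)))"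
      by (rule generator_identity[OF u K 0 x t])
    moreover have "(LINT \<omega>|P x. (LBINT v:{0..t}. generator \<mu> D u (X v \<omega>))) =
        (LINT \<omega>|P x. r * (LBINT v:{0..t}. u (X v \<omega>)) - (LBINT v:{0..t}. wp (X v \<omega>)) + (LBINT v:{0..t}. wm (X v \<omega>)))"
      by (rule Bochner_Integration.integral_cong) (auto simp: gen space_P x)
    moreover have "\<dots> = r * ?L u - ?L wp +
        ?L wm"
      using ip(2) im(2) iu(2) by simp
    moreover have "0 \<le> ?L wp" "0 \<le> ?L wm"
      "0 \<le> ?L u" "0 \<le> (LINT \<omega>|P x. u (X t \<omega>))"
      unfolding set_lebesgue_integral_def by (intro integral_nonneg_AE AE_I2; simp add: w0 u0)+
    moreover have "A = x0 + (R * J - Jp + Jm) \<Longrightarrow> 0 \<le> A \<Longrightarrow> 0 \<le> Jp \<Longrightarrow> 0 \<le> Jm \<Longrightarrow> 0 \<le> J \<Longrightarrow> 0 \<le> R \<Longrightarrow> 0 \<le> x0 \<Longrightarrow>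
        ennreal A + ennreal Jp = ennreal x0 + ennreal (R * J) + ennreal Jm" for A x0 R J Jp Jm :: real
      by (simp add: ennreal_plus[symmetric] del: ennreal_plus)
    ultimately show ?thesis
      unfolding ip(3)[folded kw, symmetric] im(3)[folded kw, symmetric] using u0[of x] r by simp
  qed
  \<comment> \<open>\<open>key\<close> is integrated against the exponential density. The time
    integrals of \<open>kp\<close> and \<open>km\<close> become resolvents, while \<open>m\<close>
    and \<open>r\<close> times its time integral share the transform \<open>?R\<close>; being
    finite, it cancels.\<close>
  let ?e = "\<lambda>s. ennreal (r * exp (- r * s)) * indicator {0..} s"
  let ?R = "\<integral>\<^sup>+s. ?e s * m s \<partial>lborel"
  have meas_int: "(\<lambda>s. \<integral>\<^sup>+v. n v * indicator {0..s} v \<partial>lborel) \<in> borel_measurable borel"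
    if [measurable]: "n \<in> borel_measurable borel" for n :: "real \<Rightarrow> ennreal"
    unfolding atLeastAtMost_def indicator_def Int_iff atLeast_def atMost_def mem_Collect_eq
    by measurable
  have em[measurable]: "?e \<in> borel_measurable borel" by measurable
  have lap: "(\<integral>\<^sup>+s. ?e s * ?I k s \<partial>lborel) = resolvent r k x"
    if "k \<in> borel_measurable borel" for k
    using laplace_transform_of_integral[OF measurable_transition_left[OF that x] r] by (simp add: resolvent_def)
  have Rm: "(\<integral>\<^sup>+s. ?e s * ?J s \<partial>lborel) =
      ?R"
    by (subst laplace_transform_of_integral[OF _ r])
      (use r in \<open>auto simp: ennreal_mult mult_ac intro!: nn_integral_cong\<close>)
  have "?R + resolvent r kp x =
      (\<integral>\<^sup>+s. ?e s * m s + ?e s * ?I kp s \<partial>lborel)"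
    unfolding lap[OF kpm, symmetric] using meas_int[OF pm] by (intro nn_integral_add[symmetric]) auto
  also have "\<dots> = (\<integral>\<^sup>+s. ?e s * ennreal (u x) + (?e s * ?J s +
      ?e s * ?I km s) \<partial>lborel)"
  proof (rule nn_integral_cong)
    fix s :: real
    show "?e s * m s + ?e s * ?I kp s =
        ?e s * ennreal (u x) + (?e s * ?J s +
      ?e s * ?I km s)"
      using key[of s] by (cases "0 \<le> s") (simp_all add: distrib_left[symmetric] add.assoc del: distrib_left_numeral)
  qed
  also have "\<dots> = ennreal (u x) + (?R + resolvent r km x)"
  proof (subst nn_integral_add)
    show "(\<lambda>s. ?e s * ?J s +
      ?e s * ?I km s) \<in> borel_measurable lborel"
      using meas_int[OF nm] meas_int[of "\<lambda>v. ennreal r * m v"] by simp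
    have "(\<integral>\<^sup>+s. ?e s * ennreal (u x) \<partial>lborel) = ennreal (u x)"
      using nn_integral_exp_atLeast[OF r, of 0] by (simp add: nn_integral_multc)
    moreover have "(\<integral>\<^sup>+s. (?e s * ?J s +
      ?e s * ?I km s) \<partial>lborel) =
      ?R + resolvent r km x"
      unfolding lap[OF kmm, symmetric] Rm[symmetric]
      using meas_int[OF nm] meas_int[of "\<lambda>v. ennreal r * m v"] by (intro nn_integral_add) auto
    ultimately show "(\<integral>\<^sup>+s. ?e s * ennreal (u x) \<partial>lborel) +
      (\<integral>\<^sup>+s. (?e s * ?J s +
      ?e s * ?I km s) \<partial>lborel) =
      ennreal (u x) + (?R + resolvent r km x)"
      by simp
  qed simp
  finally have sum: "?R + resolvent r kp x =
      ?R + (ennreal (u x) + resolvent r km x)"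
    by (simp add: add_ac)
  have "?R \<le> (\<integral>\<^sup>+s. ?e s * ennreal C \<partial>lborel)"
    unfolding m_def using uC by (intro nn_integral_mono mult_left_mono transition_le[OF x]) (auto intro: ennreal_leI)
  also have "\<dots> < \<infinity>"
    using nn_integral_exp_atLeast[OF r, of 0] by (simp add: nn_integral_multc)
  finally have "?R \<noteq> \<top>" by simp
  then show "resolvent r kp x = ennreal (u x) + resolvent r km x"
    using sum by (simp add: ennreal_add_left_cancel)
qed

section \<open>Harmonic functions on exit from a compact interval\<close>

lemma hitting_value_closed:
  assumes w: "\<omega> \<in> space M" and T: "T < \<infinity>" and X0: "X 0 \<omega> \<in> C" and C: "closed C"
    and bef: "\<And>t. 0 \<le> t \<Longrightarrow> ennreal t < T \<Longrightarrow> X t \<omega> \<in> C"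
  shows "X (enn2real T) \<omega> \<in> C"
proof (cases "enn2real T = 0")
  case False
  define v where "v = enn2real T"
  have v: "0 < v" "T = ennreal v" using False T by (auto simp: v_def less_le enn2real_nonneg)
  have "X t \<omega> \<in> C" if "t \<in> {0..<v}" for t using that v by (intro bef) (auto simp: ennreal_less_iff)
  moreover have "continuous_on (closure {0..<v}) (\<lambda>t. X t \<omega>)"
    using v by (auto intro!: continuous_on_subset[OF continuous_paths[OF w]])
  moreover have "v \<in> closure {0..<v}" using v by simp
  ultimately have "X v \<omega> \<in> C"
    using image_closure_subset[of "{0..<v}" "\<lambda>t. X t \<omega>" C] C by blast
  then show ?thesis by (simp add: v_def)
qed (use X0 in simp)

text \<open>A cutoff turns \<open>f\<close> into a test function \<open>u\<close> for which
  \<open>(r - L)u\<close> vanishes on \<open>{p..q}\<close>. The positive and negative parts of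
  \<open>(r - L)u\<close> then have resolvents that keep their discounted mean up to
  \<open>T\<close>, and \<open>u\<close> is the difference of these two resolvents.\<close>

lemma exit_identity:
  assumes r: "0 < r" and f: "ode_solution a b \<mu> D r f" and f0: "\<And>y. y \<in> E \<Longrightarrow> 0 < f y"
    and pq: "{p..q} \<subseteq> E" and x: "x \<in> {p..q}" and T: "stopping_time F T"
    and bef: "AE \<omega> in P x. \<forall>t\<ge>0. ennreal t < T \<omega> \<longrightarrow> X t \<omega> \<in> {p..q}"
  shows "(\<integral>\<^sup>+\<omega>. weighted r T (\<lambda>y. ennreal (f y)) \<omega> \<partial>P x) = ennreal (f x)"
proof -
  have xE: "x \<in> E" using x pq by auto
  interpret prob_space "P x" by (rule prob_space_P[OF xE])
  have fC: "C2_on E f" and fL: "\<And>y. y \<in> E \<Longrightarrow> generator \<mu> D f y = r * f y"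
    using f by (auto simp: ode_solution_def)
  have opE: "open E" by (rule open_einterval)
  have "p \<in> E" "q \<in> E" using pq x by auto
  obtain e1 where e1: "0 < e1" "ball p e1 \<subseteq> E" using opE \<open>p \<in> E\<close> openE by blast
  obtain e2 where e2: "0 < e2" "ball q e2 \<subseteq> E" using opE \<open>q \<in> E\<close> openE by blast
  define c where "c = p - e1 / 2"
  define d where "d = q + e2 / 2"
  have cd: "c < p" "q < d" using e1 e2 by (auto simp: c_def d_def)
  have cdE: "{c..d} \<subseteq> E"
    by (rule interval_subset_E) (use e1 e2 in \<open>auto simp: c_def d_def dist_real_def subset_iff\<close>)
  \<comment> \<open>The cutoff equals 1 on an interval that is wider than \<open>{p..q}\<close> on
    both sides, so the derivatives of \<open>u\<close> and \<open>f\<close> agree at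
    \<open>p\<close> and \<open>q\<close> too.\<close>
  obtain w where w: "C2_on UNIV w" "\<And>y. 0 \<le> w y" "\<And>y. y \<in> {(c + p) / 2..(q + d) / 2} \<Longrightarrow> w y = 1"
    "\<And>y. y \<notin> {c..d} \<Longrightarrow> w y = 0"
    using ex_cutoff[of c "(c + p) / 2" "(q + d) / 2" d] cd by auto
  define u where "u y = f y * w y" for y
  have uC: "C2_on UNIV u" unfolding u_def[abs_def] by (rule C2_on_localize[OF opE fC w(1) cdE w(4)])
  have u_out: "u y = 0" if "y \<notin> {c..d}" for y using w(4)[OF that] by (simp add: u_def)
  have u0: "0 \<le> u y" for y
  proof (cases "y \<in> {c..d}")
    case True
    then show ?thesis using w(2)[of y] less_imp_le[OF f0[of y]] cdE by (auto simp: u_def)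
  qed (simp add: u_out)
  define S where "S = {(c + p) / 2<..<(q + d) / 2}"
  have S: "open S" "{p..q} \<subseteq> S" using cd by (auto simp: S_def)
  have uf: "u y = f y" if "y \<in> S" for y using that w(3)[of y] by (simp add: u_def S_def)
  have d1: "deriv u y = deriv f y" if "y \<in> S" for y
    by (rule deriv_cong_ev) (use that S(1) uf in \<open>auto simp: eventually_nhds\<close>)
  have d2: "deriv (deriv u) y = deriv (deriv f) y" if "y \<in> S" for y
    by (rule deriv_cong_ev) (use that S(1) d1 in \<open>auto simp: eventually_nhds\<close>)
  have Lu: "generator \<mu> D u y = r * u y" if "y \<in> {p..q}" for y
  proof -
    have "y \<in> E" "y \<in> S" using that pq S(2) by blast+
    then show ?thesis using fL[of y] uf[of y] d1[of y] d2[of y] by (simp add: generator_def)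
  qed
  define kp where "kp y = ennreal (max 0 (indicator E y * (r * u y - generator \<mu> D u y)))" for y
  define km where "km y = ennreal (max 0 (indicator E y * (generator \<mu> D u y - r * u y)))" for y
  have k0: "kp y = 0" "km y = 0" if "y \<in> {p..q}" for y using Lu[OF that] by (auto simp: kp_def km_def)
  have res: "resolvent r kp y = ennreal (u y) + resolvent r km y" "resolvent r km y < \<infinity>" if "y \<in> E" for y
    by (rule resolvent_generator[OF uC compact_Icc cdE u_out u0 r that, folded kp_def[abs_def] km_def[abs_def]]; assumption)+
  have kpm: "kp \<in> borel_measurable borel" and kmm: "km \<in> borel_measurable borel"
    by (rule resolvent_generator[OF uC compact_Icc cdE u_out u0 r xE, folded kp_def[abs_def] km_def[abs_def]]; assumption)+
  have start_E: "AE \<omega> in P x. X 0 \<omega> = x" by (rule start[OF xE])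
  let ?Z = "\<lambda>\<omega>. ennreal (exp (- r * enn2real (T \<omega>)))"
  \<comment> \<open>Nothing is collected before \<open>T\<close>, since \<open>k\<close> vanishes
    where the path then is. Collecting from \<open>T\<close> on thus amounts to collecting from 0
    on, which is the resolvent at the constant stopping time 0.\<close>
  have harm: "(\<integral>\<^sup>+\<omega>. weighted r T (resolvent r k) \<omega> \<partial>P x) = resolvent r k x"
    if k: "k \<in> borel_measurable borel" and k0: "\<And>y. y \<in> {p..q} \<Longrightarrow> k y = 0" for k
  proof -
    have "(\<integral>\<^sup>+\<omega>. weighted r T (resolvent r k) \<omega> \<partial>P x) =
      (\<integral>\<^sup>+\<omega>. discounted_after r k (T \<omega>) \<omega> \<partial>P x)"
      by (rule resolvent_stopping[OF xE T k])
    also have "\<dots> = (\<integral>\<^sup>+\<omega>. discounted_after r k 0 \<omega> \<partial>P x)"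
    proof (rule nn_integral_cong_AE, use bef in eventually_elim)
      fix \<omega> assume "\<forall>t\<ge>0. ennreal t < T \<omega> \<longrightarrow> X t \<omega> \<in> {p..q}"
      then show "discounted_after r k (T \<omega>) \<omega> =
        discounted_after r k 0 \<omega>"
        by (intro nn_integral_cong) (auto simp: indicator_def k0 not_le)
    qed
    also have "\<dots> = (\<integral>\<^sup>+\<omega>. ennreal (exp (- r * enn2real 0)) *
        (indicator {\<omega>. 0 < (\<infinity>::ennreal)} \<omega> * resolvent r k (X (enn2real 0) \<omega>)) \<partial>P x)"
      by (rule resolvent_stopping[OF xE stopping_time_const k, symmetric])
    also have "\<dots> = (\<integral>\<^sup>+\<omega>. resolvent r k x \<partial>P x)"
      by (rule nn_integral_cong_AE, use start_E in eventually_elim) simp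
    finally show ?thesis by (simp add: emeasure_space_1)
  qed
  note T_M = measurable_stopping[OF T]
  have [measurable]: "Measurable.pred M (\<lambda>\<omega>. T \<omega> < \<infinity>)" using T_M by measurable
  have Zm: "(\<lambda>\<omega>. weighted r T g \<omega>) \<in> borel_measurable (P x)"
    if g: "g \<in> borel_measurable borel_E" for g :: "real \<Rightarrow> ennreal"
  proof -
    have [measurable]: "(\<lambda>\<omega>. g (X_at T \<omega>)) \<in> borel_measurable M"
      by (rule measurable_compose[OF measurable_X_stopping[OF T_M] g])
    show ?thesis unfolding measurable_P[OF xE] using T_M by measurable
  qed
  have hm: "(\<integral>\<^sup>+\<omega>. weighted r T (resolvent r km) \<omega> \<partial>P x) = resolvent r km x"
    by (rule harm[OF kmm k0(2)])
  have um: "(\<lambda>y. ennreal (u y)) \<in> borel_measurable borel_E"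
    using borel_measurable_continuous_onI[OF C2_on_continuous_on(1)[OF uC]]
    by (intro measurable_restrict_space1) simp
  have "ennreal (u x) + resolvent r km x = resolvent r kp x" by (rule res(1)[OF xE, symmetric])
  also have "\<dots> = (\<integral>\<^sup>+\<omega>. weighted r T (resolvent r kp) \<omega> \<partial>P x)"
    by (rule harm[OF kpm k0(1), symmetric])
  also have "\<dots> = (\<integral>\<^sup>+\<omega>. weighted r T (\<lambda>y. ennreal (u y)) \<omega> +
      weighted r T (resolvent r km) \<omega> \<partial>P x)"
    by (intro nn_integral_cong)
      (simp add: res(1)[OF state_space] space_P xE distrib_left)
  also have "\<dots> = (\<integral>\<^sup>+\<omega>. weighted r T (\<lambda>y. ennreal (u y)) \<omega> \<partial>P x) +
      resolvent r km x"
    by (subst nn_integral_add[OF Zm[OF um] Zm[OF measurable_resolvent[OF kmm]]])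
      (simp only: hm)
  \<comment> \<open>At a finite \<open>T\<close> the path is still in the closed interval, where the
    cutoff is 1.\<close>
  also have "(\<integral>\<^sup>+\<omega>. weighted r T (\<lambda>y. ennreal (u y)) \<omega> \<partial>P x) =
      (\<integral>\<^sup>+\<omega>. weighted r T (\<lambda>y. ennreal (f y)) \<omega> \<partial>P x)"
  proof (rule nn_integral_cong_AE, use bef start_E AE_space in eventually_elim)
    fix \<omega> assume *: "\<forall>t\<ge>0. ennreal t < T \<omega> \<longrightarrow> X t \<omega> \<in> {p..q}" "X 0 \<omega> = x" "\<omega> \<in> space (P x)"
    then have "X_at T \<omega> \<in> {p..q}" if "T \<omega> < \<infinity>"
      using that x by (intro hitting_value_closed) (auto simp: space_P xE)
    then show "weighted r T (\<lambda>y. ennreal (u y)) \<omega> =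
      weighted r T (\<lambda>y. ennreal (f y)) \<omega>"
      using uf S(2) by (cases "T \<omega> < \<infinity>") auto
  qed
  finally have "resolvent r km x + ennreal (u x) = resolvent r km x +
      (\<integral>\<^sup>+\<omega>. weighted r T (\<lambda>y. ennreal (f y)) \<omega> \<partial>P x)"
    by (simp add: add.commute)
  moreover have "resolvent r km x < \<infinity>" by (rule res(2)[OF xE])
  ultimately show ?thesis using uf[of x] x S(2) by (auto simp: ennreal_add_left_cancel)
qed

end

section \<open>Hitting times and discounted rewards\<close>

lemma rational_between_near:
  fixes s \<delta> :: real
  assumes "0 < \<delta>"
  obtains q where "q \<in> \<rat>" "s < q" "q < s + \<delta>"
  using Rats_dense_in_real[of s "s + \<delta>"] assms by auto

lemma le_on_rationals_imp_le:
  fixes f :: "real \<Rightarrow> real"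
  assumes c: "continuous_on {0..} f" and N: "0 \<le> N"
    and le: "\<And>q. q \<in> \<rat> \<Longrightarrow> N \<le> q \<Longrightarrow> f q \<le> B" and t: "N \<le> t"
  shows "f t \<le> B"
proof (rule ccontr)
  assume "\<not> f t \<le> B"
  then have "0 < f t - B" by simp
  then obtain \<delta> where \<delta>: "0 < \<delta>" "\<And>s. s \<in> {0..} \<Longrightarrow> dist s t < \<delta> \<Longrightarrow> dist (f s) (f t) < f t - B"
    using c t N unfolding continuous_on_iff by (metis atLeast_iff order_trans)
  obtain q where q: "q \<in> \<rat>" "t < q" "q < t + \<delta>" by (rule rational_between_near[OF \<delta>(1)])
  then have "dist (f q) (f t) < f t - B" using t N by (intro \<delta>) (auto simp: dist_real_def)
  moreover have "f q \<le> B" using q t by (intro le) auto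
  ultimately show False by (auto simp: dist_real_def abs_if split: if_splits)
qed

context regular_diffusion
begin

section \<open>Hitting times of relatively closed sets\<close>

lemma hitting_time_gt: "ennreal t < hitting_time X A \<omega> \<Longrightarrow> 0 \<le> t \<Longrightarrow> X t \<omega> \<notin> A"
  unfolding hitting_time_def by (metis (mono_tags, lifting) Inf_lower image_eqI leD mem_Collect_eq)

lemma hitting_time_le: "0 \<le> t \<Longrightarrow> X t \<omega> \<in> A \<Longrightarrow> hitting_time X A \<omega> \<le> ennreal t"
  using hitting_time_gt[of t A \<omega>] by (meson not_le)

text \<open>Paths stay in \<open>E\<close>, so membership in \<open>A\<close> is membership in the
  closed set \<open>C\<close>. The visiting times form a closed set, which contains its
  infimum.\<close>

lemma hitting_time_attained:
  assumes w: "\<omega> \<in> space M" and C: "closed C" and A: "A = E \<inter> C" and fin: "hitting_time X A \<omega> < \<infinity>"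
  obtains s where "0 \<le> s" "hitting_time X A \<omega> = ennreal s" "X s \<omega> \<in> A"
proof -
  define S where "S = {t. 0 \<le> t \<and> X t \<omega> \<in> A}"
  have "S = {t \<in> {0..}. X t \<omega> \<in> C}" using state_space[OF _ w] by (auto simp: S_def A)
  then have "closed S"
    using continuous_closed_preimage[OF continuous_paths[OF w] closed_atLeast C]
    by (simp add: vimage_def Int_def)
  moreover have ne: "S \<noteq> {}"
  proof
    assume "S = {}"
    then have "hitting_time X A \<omega> = \<infinity>" unfolding hitting_time_def S_def by (simp only: image_empty Inf_empty infinity_ennreal_def)
    then show False using fin by simp
  qed
  moreover have bdd: "bdd_below S" by (auto simp: S_def intro: bdd_belowI[of _ 0])
  ultimately have s: "Inf S \<in> S" by (intro closed_contains_Inf)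
  have "Inf (ennreal ` S) = ennreal (Inf S)"
    by (intro antisym Inf_lower Inf_greatest) (use s bdd in \<open>auto intro!: ennreal_leI cInf_lower\<close>)
  then show ?thesis using s that[of "Inf S"] by (simp add: hitting_time_def S_def)
qed

lemma hitting_time_value:
  assumes "\<omega> \<in> space M" "closed C" "A = E \<inter> C" "hitting_time X A \<omega> < \<infinity>"
  shows "X (enn2real (hitting_time X A \<omega>)) \<omega> \<in> A"
  using hitting_time_attained[OF assms] by (metis enn2real_ennreal)

lemma hitting_time_start:
  assumes "X 0 \<omega> \<in> A"
  shows "hitting_time X A \<omega> = 0"
  using hitting_time_le[of 0 \<omega> A] assms by simp

text \<open>Right-continuity of the filtration is not assumed, so the past up to \<open>t\<close>
  itself must decide. By compactness the distance of the path to \<open>C\<close> attains its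
  minimum on \<open>{0..v}\<close>, so \<open>C\<close> is reached by time \<open>v\<close> exactly
  if countably many times bring the path arbitrarily close to it.\<close>

lemma stopping_time_hitting_time:
  assumes C: "closed C" and A: "A = E \<inter> C"
  shows "stopping_time F (hitting_time X A)"
proof (rule stopping_timeI)
  fix t :: ennreal
  show "Measurable.pred (F t) (\<lambda>\<omega>. hitting_time X A \<omega> \<le> t)"
  proof (cases t)
    case top
    then show ?thesis by simp
  next
    case (real v)
    show ?thesis
    proof (cases "C = {}")
      case True
      then have "hitting_time X A \<omega> = \<infinity>" for \<omega> by (simp add: hitting_time_def A)
      then show ?thesis by simp
    next
      case False
      \<comment> \<open>Rational times just after a visit are used when the visit precedes
        \<open>v\<close>; \<open>v\<close> itself is added for a visit at time
        \<open>v\<close>.\<close>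
      define Q where "Q = insert v (\<rat> \<inter> {0..v})"
      have Q: "countable Q" "\<And>q. q \<in> Q \<Longrightarrow> 0 \<le> q \<and> q \<le> v"
        using real by (auto simp: Q_def countable_rat)
      have eq: "hitting_time X A \<omega> \<le> t \<longleftrightarrow> (\<forall>n::nat. \<exists>q\<in>Q. infdist (X q \<omega>) C < 1 / real (Suc n))"
        if w: "\<omega> \<in> space M" for \<omega>
      proof -
        have c: "continuous_on {0..v} (\<lambda>s. infdist (X s \<omega>) C)"
          by (intro continuous_intros continuous_on_subset[OF continuous_paths[OF w]]) auto
        show ?thesis
        proof (intro iffI allI)
          fix n :: nat
          assume le: "hitting_time X A \<omega> \<le> t"
          also have "t < \<infinity>" using real by simp
          finally obtain s where s: "0 \<le> s" "hitting_time X A \<omega> = ennreal s" "X s \<omega> \<in> A"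
            using hitting_time_attained[OF w C A] by metis
          have sv: "s \<le> v" using le s real by simp
          have z: "infdist (X s \<omega>) C = 0" using s by (simp add: A)
          show "\<exists>q\<in>Q. infdist (X q \<omega>) C < 1 / real (Suc n)"
          proof (cases "s = v")
            case True
            then show ?thesis using z by (auto simp: Q_def)
          next
            case False
            obtain \<delta> where \<delta>: "0 < \<delta>" "\<And>s'. s' \<in> {0..v} \<Longrightarrow> dist s' s < \<delta> \<Longrightarrow>
                dist (infdist (X s' \<omega>) C) (infdist (X s \<omega>) C) < 1 / real (Suc n)"
              using c s sv unfolding continuous_on_iff
              by (metis atLeastAtMost_iff of_nat_0_less_iff zero_less_Suc zero_less_divide_1_iff)
            have "0 < min \<delta> (v - s)" using \<delta> False sv by simp
            then obtain q where q: "q \<in> \<rat>" "s < q" "q < s + min \<delta> (v - s)" by (rule rational_between_near)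
            have "dist (infdist (X q \<omega>) C) (infdist (X s \<omega>) C) < 1 / real (Suc n)"
              using q s by (intro \<delta>) (auto simp: dist_real_def)
            then show ?thesis using q s z by (intro bexI[of _ q]) (auto simp: Q_def infdist_nonneg)
          qed
        next
          assume *: "\<forall>n::nat. \<exists>q\<in>Q. infdist (X q \<omega>) C < 1 / real (Suc n)"
          obtain s where s: "s \<in> {0..v}" "\<And>s'. s' \<in> {0..v} \<Longrightarrow> infdist (X s \<omega>) C \<le> infdist (X s' \<omega>) C"
            using continuous_attains_inf[OF compact_Icc _ c] real by auto
          have "infdist (X s \<omega>) C \<le> 0"
          proof (rule field_le_epsilon)
            fix e :: real assume "0 < e"
            then obtain n where "1 / real (Suc n) < e" using nat_approx_posE by blast
            moreover obtain q where "q \<in> Q" "infdist (X q \<omega>) C < 1 / real (Suc n)" using * by blast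
            ultimately show "infdist (X s \<omega>) C \<le> 0 + e" using s(2)[of q] Q(2)[of q] by fastforce
          qed
          then have "infdist (X s \<omega>) C = 0" using infdist_nonneg[of "X s \<omega>" C] by linarith
          then have "X s \<omega> \<in> C" using C False by (simp add: in_closed_iff_infdist_zero)
          then have "X s \<omega> \<in> A" using state_space[OF _ w] s by (auto simp: A)
          then show "hitting_time X A \<omega> \<le> t"
            using hitting_time_le[of s \<omega> A] s real by (auto intro: order_trans ennreal_leI)
        qed
      qed
      have "{\<omega> \<in> space (F t). \<forall>n::nat. \<exists>q\<in>Q. infdist (X q \<omega>) C < 1 / real (Suc n)} \<in> sets (F t)"
      proof (intro sets.sets_Collect_countable_All sets.sets_Collect_countable_Ex' Q(1))
        fix q and n :: nat assume "q \<in> Q"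
        then have q: "0 \<le> q" "ennreal q \<le> t" using Q(2)[of q] real by (auto intro: ennreal_leI)
        have sub: "subalgebra (F t) (F (ennreal q))"
          using sets_F_mono[OF q(2)] by (simp add: subalgebra_def space_F)
        have [measurable]: "X q \<in> borel_measurable (F t)"
          by (rule measurable_from_subalg[OF sub adapted[OF q(1)]])
        have "(\<lambda>z. infdist z C) \<in> borel_measurable borel"
          by (intro borel_measurable_continuous_onI continuous_intros)
        from measurable_compose[OF \<open>X q \<in> borel_measurable (F t)\<close> this]
        have [measurable]: "(\<lambda>\<omega>. infdist (X q \<omega>) C) \<in> borel_measurable (F t)" .
        show "{\<omega> \<in> space (F t). infdist (X q \<omega>) C < 1 / real (Suc n)} \<in> sets (F t)"
          by measurable
      qed
      also have "{\<omega> \<in> space (F t). \<forall>n::nat. \<exists>q\<in>Q. infdist (X q \<omega>) C < 1 / real (Suc n)} =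
          {\<omega> \<in> space (F t). hitting_time X A \<omega> \<le> t}"
        using eq by (auto simp: space_F)
      finally show ?thesis by (simp add: pred_def)
    qed
  qed
qed

section \<open>Measurability and domination of discounted rewards\<close>

lemma continuous_on_discounted_path:
  assumes g: "continuous_on E g" and w: "\<omega> \<in> space M"
  shows "continuous_on {0..} (\<lambda>s. exp (- r * s) * g (X s \<omega>))"
  using state_space[OF _ w]
  by (intro continuous_intros continuous_on_compose2[OF g continuous_paths[OF w]]) auto

lemma measurable_continuous_E:
  assumes g: "continuous_on E g"
  shows "g \<in> borel_measurable borel_E"
  by (rule borel_measurable_continuous_on_restrict[OF g])

lemma measurable_g_X:
  assumes g: "continuous_on E g" and s: "0 \<le> s"
  shows "(\<lambda>\<omega>. g (X s \<omega>)) \<in> borel_measurable M"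
  by (rule measurable_compose[OF measurable_restrict_space2 measurable_continuous_E[OF g]])
    (use state_space[OF s] measurable_X[OF s] in auto)

text \<open>The delicate case is \<open>T \<omega> = \<infinity>\<close>, where the limit runs over
  uncountably many times and may fail to exist. By continuity convergence can be tested at rational
  times, against the limit along the integers.\<close>

lemma measurable_discounted:
  assumes g: "continuous_on E g" and T[measurable]: "T \<in> borel_measurable M"
  shows "(\<lambda>\<omega>. discounted X r g (T \<omega>) \<omega>) \<in> borel_measurable M"
proof -
  define Z where "Z s \<omega> = exp (- r * s) * g (X s \<omega>)" for s \<omega>
  have Zm: "Z s \<in> borel_measurable M" if "0 \<le> s" for s
    unfolding Z_def using measurable_g_X[OF g that] by simp
  define l where "l \<omega> = lim (\<lambda>n. Z (real n) \<omega>)" for \<omega>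
  have lm: "l \<in> borel_measurable M" unfolding l_def by (intro borel_measurable_lim_metric Zm) simp
  define conv where "conv \<omega> \<longleftrightarrow> (\<forall>k::nat. \<exists>N::nat. \<forall>q\<in>{q\<in>\<rat>. real N \<le> q}. \<bar>Z q \<omega> - l \<omega>\<bar> \<le> 1 / real (Suc k))" for \<omega>
  have conv_iff: "conv \<omega> \<longleftrightarrow> (\<exists>L. ((\<lambda>s. Z s \<omega>) \<longlongrightarrow> L) at_top)" if w: "\<omega> \<in> space M" for \<omega>
  proof
    assume cv: "conv \<omega>"
    have "((\<lambda>s. Z s \<omega>) \<longlongrightarrow> l \<omega>) at_top"
    proof (rule tendstoI)
      fix e :: real assume "0 < e"
      then obtain k where k: "1 / real (Suc k) < e" using nat_approx_posE by blast
      obtain N :: nat where N: "\<And>q. q \<in> \<rat> \<Longrightarrow> real N \<le> q \<Longrightarrow> \<bar>Z q \<omega> - l \<omega>\<bar> \<le> 1 / real (Suc k)"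
        using cv unfolding conv_def by blast
      have cont: "continuous_on {0..} (\<lambda>s. \<bar>Z s \<omega> - l \<omega>\<bar>)"
        unfolding Z_def by (intro continuous_intros continuous_on_discounted_path[OF g w])
      have "\<bar>Z s \<omega> - l \<omega>\<bar> \<le> 1 / real (Suc k)" if "real N \<le> s" for s
        by (rule le_on_rationals_imp_le[OF cont _ N that]) auto
      then have "dist (Z s \<omega>) (l \<omega>) < e" if "real N \<le> s" for s
        using k that by (force simp: dist_real_def)
      then show "\<forall>\<^sub>F s in at_top. dist (Z s \<omega>) (l \<omega>) < e"
        by (auto simp: eventually_at_top_linorder)
    qed
    then show "\<exists>L. ((\<lambda>s. Z s \<omega>) \<longlongrightarrow> L) at_top" by blast
  next
    assume "\<exists>L. ((\<lambda>s. Z s \<omega>) \<longlongrightarrow> L) at_top"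
    then obtain L where L: "((\<lambda>s. Z s \<omega>) \<longlongrightarrow> L) at_top" by blast
    have "(\<lambda>n. Z (real n) \<omega>) \<longlonglongrightarrow> L"
      by (rule filterlim_compose[OF L filterlim_real_sequentially])
    then have lL: "l \<omega> = L" unfolding l_def by (rule limI)
    show "conv \<omega>" unfolding conv_def lL
    proof
      fix k :: nat
      have "\<forall>\<^sub>F s in at_top. dist (Z s \<omega>) L < 1 / real (Suc k)"
        by (rule tendstoD[OF L]) simp
      then obtain B where B: "\<And>s. B \<le> s \<Longrightarrow> dist (Z s \<omega>) L < 1 / real (Suc k)"
        by (auto simp: eventually_at_top_linorder)
      obtain N :: nat where N: "B \<le> real N" using real_arch_simple by blast
      show "\<exists>N::nat. \<forall>q\<in>{q\<in>\<rat>. real N \<le> q}. \<bar>Z q \<omega> - L\<bar> \<le> 1 / real (Suc k)"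
        using B N by (intro exI[of _ N]) (force simp: dist_real_def intro: less_imp_le)
    qed
  qed
  have conv_m: "{\<omega> \<in> space M. conv \<omega>} \<in> sets M"
    unfolding conv_def
  proof (intro sets.sets_Collect_countable_All sets.sets_Collect_countable_Ex sets.sets_Collect_countable_All')
    fix N k :: nat and q assume "q \<in> {q\<in>\<rat>. real N \<le> q}"
    then have "0 \<le> q" by (auto intro: order_trans[OF of_nat_0_le_iff])
    note Zm[OF this, measurable] lm[measurable]
    show "{\<omega> \<in> space M. \<bar>Z q \<omega> - l \<omega>\<bar> \<le> 1 / real (Suc k)} \<in> sets M" by measurable
  qed (auto intro: countable_subset[OF _ countable_rat])
  have inf_part: "(\<lambda>\<omega>. Lim at_top (\<lambda>s. Z s \<omega>)) \<in> borel_measurable M"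
  proof -
    \<comment> \<open>\<open>THE l. False\<close> is what \<open>Lim\<close> reduces to when there
      is no limit; it is the same constant for all such paths.\<close>
    have "(\<lambda>\<omega>. if conv \<omega> then l \<omega> else (THE l. False)) \<in> borel_measurable M"
      using conv_m lm by (intro measurable_If) (auto simp: pred_def)
    also have "?this \<longleftrightarrow> ?thesis"
    proof (rule measurable_cong)
      fix \<omega> assume w: "\<omega> \<in> space M"
      show "(if conv \<omega> then l \<omega> else (THE l. False)) = Lim at_top (\<lambda>s. Z s \<omega>)"
      proof (cases "conv \<omega>")
        case True
        then obtain L where L: "((\<lambda>s. Z s \<omega>) \<longlongrightarrow> L) at_top" using conv_iff[OF w] by blast
        have "(\<lambda>n. Z (real n) \<omega>) \<longlonglongrightarrow> L"
          by (rule filterlim_compose[OF L filterlim_real_sequentially])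
        then have "l \<omega> = L" unfolding l_def by (rule limI)
        moreover have "Lim at_top (\<lambda>s. Z s \<omega>) = L" by (rule tendsto_Lim[OF _ L]) simp
        ultimately show ?thesis using True by simp
      next
        case False
        then have "\<not> ((\<lambda>s. Z s \<omega>) \<longlongrightarrow> L) at_top" for L using conv_iff[OF w] by blast
        then show ?thesis using False by (simp add: Topological_Spaces.Lim_def)
      qed
    qed
    finally show ?thesis .
  qed
  have fin_part: "(\<lambda>\<omega>. exp (- r * enn2real (T \<omega>)) * g (X_at T \<omega>)) \<in> borel_measurable M"
    using measurable_compose[OF measurable_X_stopping[OF T] measurable_continuous_E[OF g]] by measurable
  show ?thesis
    unfolding discounted_def using inf_part fin_part unfolding Z_def by (intro measurable_If) auto
qed

text \<open>An integrable majorant replaces the supremum over uncountably many times, whose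
  measurability would need an argument each time, and is the form that dominated convergence
  uses.\<close>

definition dominated :: "real \<Rightarrow> real \<Rightarrow> (real \<Rightarrow> real) \<Rightarrow> bool" where
  "dominated x r g \<longleftrightarrow> (\<exists>w. integrable (P x) w \<and> (AE \<omega> in P x. path_bounded r g \<omega> (w \<omega>)))"

text \<open>The supremum over rational times is measurable, is at most the given one, and by
  continuity bounds the whole path.\<close>

lemma dominatedI:
  assumes x: "x \<in> E" and g: "continuous_on E g"
    and fin: "(\<integral>\<^sup>+\<omega>. (SUP t\<in>{0..}. ennreal \<bar>exp (- r * t) * g (X t \<omega>)\<bar>) \<partial>P x) < \<infinity>"
  shows "dominated x r g"
proof -
  define S where "S \<omega> = (SUP t\<in>\<rat> \<inter> {0..}. ennreal \<bar>exp (- r * t) * g (X t \<omega>)\<bar>)" for \<omega>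
  have Sm: "S \<in> borel_measurable (P x)"
    unfolding S_def measurable_P[OF x]
  proof (rule borel_measurable_SUP)
    show "countable (\<rat> \<inter> {0..} :: real set)" by (rule countable_subset[OF _ countable_rat]) auto
    show "(\<lambda>\<omega>. ennreal \<bar>exp (- r * t) * g (X t \<omega>)\<bar>) \<in> borel_measurable M" if "t \<in> \<rat> \<inter> {0..}" for t
      using measurable_g_X[OF g, of t] that by simp
  qed
  have "(\<integral>\<^sup>+\<omega>. S \<omega> \<partial>P x) \<le> (\<integral>\<^sup>+\<omega>. (SUP t\<in>{0..}. ennreal \<bar>exp (- r * t) * g (X t \<omega>)\<bar>) \<partial>P x)"
    unfolding S_def by (intro nn_integral_mono SUP_subset_mono) auto
  with fin have Sfin: "(\<integral>\<^sup>+\<omega>. S \<omega> \<partial>P x) < \<infinity>" by (rule le_less_trans[rotated])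
  then have AEfin: "AE \<omega> in P x. S \<omega> \<noteq> \<infinity>" using Sm by (intro nn_integral_noteq_infinite) auto
  have "integrable (P x) (\<lambda>\<omega>. enn2real (S \<omega>))"
  proof (rule integrableI_bounded)
    have "(\<integral>\<^sup>+\<omega>. ennreal (norm (enn2real (S \<omega>))) \<partial>P x) = (\<integral>\<^sup>+\<omega>. S \<omega> \<partial>P x)"
      by (rule nn_integral_cong_AE, use AEfin in eventually_elim) (simp add: less_top)
    then show "(\<integral>\<^sup>+\<omega>. ennreal (norm (enn2real (S \<omega>))) \<partial>P x) < \<infinity>" using Sfin by simp
  qed (use Sm in simp)
  moreover have "AE \<omega> in P x. path_bounded r g \<omega> (enn2real (S \<omega>))"
    using AEfin AE_space
  proof eventually_elim
    fix \<omega> assume S: "S \<omega> \<noteq> \<infinity>" and w: "\<omega> \<in> space (P x)"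
    then have w: "\<omega> \<in> space M" by (simp add: space_P x)
    have q: "\<bar>exp (- r * q) * g (X q \<omega>)\<bar> \<le> enn2real (S \<omega>)" if "q \<in> \<rat>" "0 \<le> q" for q
    proof -
      have "ennreal \<bar>exp (- r * q) * g (X q \<omega>)\<bar> \<le> S \<omega>"
        unfolding S_def using that by (intro SUP_upper) auto
      then have "enn2real (ennreal \<bar>exp (- r * q) * g (X q \<omega>)\<bar>) \<le> enn2real (S \<omega>)"
        using S by (intro enn2real_mono) (auto simp: less_top)
      then show ?thesis by (simp only: enn2real_ennreal abs_ge_zero)
    qed
    have "continuous_on {0..} (\<lambda>t. \<bar>exp (- r * t) * g (X t \<omega>)\<bar>)"
      by (intro continuous_on_rabs continuous_on_discounted_path[OF g w])
    from le_on_rationals_imp_le[OF this order_refl q]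
    show "path_bounded r g \<omega> (enn2real (S \<omega>))" by blast
  qed
  ultimately show ?thesis unfolding dominated_def by blast
qed

lemma dominated_bound:
  assumes x: "x \<in> E" and G: "dominated x r G" and H: "dominated x r H"
    and le: "\<And>y. y \<in> E \<Longrightarrow> \<bar>V y\<bar> \<le> \<bar>G y\<bar> + \<bar>H y\<bar>"
  shows "dominated x r V"
proof -
  obtain w1 where w1: "integrable (P x) w1" "AE \<omega> in P x. path_bounded r G \<omega> (w1 \<omega>)"
    using G unfolding dominated_def by blast
  obtain w2 where w2: "integrable (P x) w2" "AE \<omega> in P x. path_bounded r H \<omega> (w2 \<omega>)"
    using H unfolding dominated_def by blast
  have "AE \<omega> in P x. path_bounded r V \<omega> (w1 \<omega> + w2 \<omega>)"
    using w1(2) w2(2) AE_space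
  proof eventually_elim
    fix \<omega> assume *: "path_bounded r G \<omega> (w1 \<omega>)" "path_bounded r H \<omega> (w2 \<omega>)"
      "\<omega> \<in> space (P x)"
    show "path_bounded r V \<omega> (w1 \<omega> + w2 \<omega>)"
    proof (intro allI impI)
      fix t :: real assume t: "0 \<le> t"
      have "X t \<omega> \<in> E" using * t by (intro state_space) (auto simp: space_P x)
      then have "exp (- r * t) * \<bar>V (X t \<omega>)\<bar> \<le> exp (- r * t) * (\<bar>G (X t \<omega>)\<bar> + \<bar>H (X t \<omega>)\<bar>)"
        by (intro mult_left_mono le) auto
      then show "\<bar>exp (- r * t) * V (X t \<omega>)\<bar> \<le> w1 \<omega> + w2 \<omega>"
        using *(1)[rule_format, OF t] *(2)[rule_format, OF t] by (simp add: abs_mult distrib_left)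
    qed
  qed
  then show ?thesis unfolding dominated_def using w1 w2 by (intro exI[of _ "\<lambda>\<omega>. w1 \<omega> + w2 \<omega>"]) auto
qed

section \<open>Path estimates and stopped functions\<close>

lemma closed_segment_path:
  assumes w: "\<omega> \<in> space M" and t: "0 \<le> t" and y: "y \<in> closed_segment (X 0 \<omega>) (X t \<omega>)"
  obtains s where "0 \<le> s" "s \<le> t" "X s \<omega> = y"
proof -
  have "connected ((\<lambda>s. X s \<omega>) ` {0..t})"
    by (intro connected_continuous_image continuous_on_subset[OF continuous_paths[OF w]]) auto
  moreover have "X 0 \<omega> \<in> (\<lambda>s. X s \<omega>) ` {0..t}" "X t \<omega> \<in> (\<lambda>s. X s \<omega>) ` {0..t}" using t by auto
  ultimately have "closed_segment (X 0 \<omega>) (X t \<omega>) \<subseteq> (\<lambda>s. X s \<omega>) ` {0..t}"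
    by (metis closed_segment_subset is_interval_connected_1 is_interval_convex)
  then obtain s where "s \<in> {0..t}" "X s \<omega> = y" using y by blast
  then show ?thesis using that by auto
qed

lemma path_bounds:
  assumes w: "\<omega> \<in> space M" and v: "0 \<le> v"
  obtains m m' where "m \<in> E" "m' \<in> E" "\<And>s. 0 \<le> s \<Longrightarrow> s \<le> v \<Longrightarrow> m \<le> X s \<omega> \<and> X s \<omega> \<le> m'"
proof -
  have c: "continuous_on {0..v} (\<lambda>s. X s \<omega>)" by (intro continuous_on_subset[OF continuous_paths[OF w]]) auto
  obtain s1 where s1: "s1 \<in> {0..v}" "\<And>s. s \<in> {0..v} \<Longrightarrow> X s1 \<omega> \<le> X s \<omega>"
    using continuous_attains_inf[OF compact_Icc _ c] v by auto
  obtain s2 where s2: "s2 \<in> {0..v}" "\<And>s. s \<in> {0..v} \<Longrightarrow> X s \<omega> \<le> X s2 \<omega>"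
    using continuous_attains_sup[OF compact_Icc _ c] v by auto
  show ?thesis
    using that[of "X s1 \<omega>" "X s2 \<omega>"] s1 s2 state_space[OF _ w] by auto
qed

lemma hitting_time_gtI:
  assumes w: "\<omega> \<in> space M" and C: "closed C" and A: "A = E \<inter> C" and v: "0 \<le> v"
    and n: "\<And>s. 0 \<le> s \<Longrightarrow> s \<le> v \<Longrightarrow> X s \<omega> \<notin> A"
  shows "ennreal v < hitting_time X A \<omega>"
proof (cases "hitting_time X A \<omega> < \<infinity>")
  case True
  then obtain s where "0 \<le> s" "hitting_time X A \<omega> = ennreal s" "X s \<omega> \<in> A"
    using hitting_time_attained[OF w C A] by metis
  moreover from this have "v < s" using n[of s] by (meson not_le)
  ultimately show ?thesis using v by (simp add: ennreal_less_iff)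
next
  case False
  then show ?thesis by (simp add: not_less top_unique)
qed

text \<open>In contrast to \<open>discounted\<close>, the value on
  \<open>T \<omega> = \<infinity>\<close> is 0, in agreement with \<open>exit_identity\<close>,
  where only finite exits count.\<close>

definition stopped :: "real \<Rightarrow> (real \<Rightarrow> real) \<Rightarrow> ('a \<Rightarrow> ennreal) \<Rightarrow> 'a \<Rightarrow> real" where
  "stopped r g T \<omega> = (if T \<omega> < \<infinity> then exp (- r * enn2real (T \<omega>)) * g (X_at T \<omega>) else 0)"

lemma measurable_stopped:
  assumes x: "x \<in> E" and g: "continuous_on E g" and T: "stopping_time F T"
  shows "stopped r g T \<in> borel_measurable (P x)"
proof -
  note T_M[measurable] = measurable_stopping[OF T]
  note measurable_compose[OF measurable_X_stopping[OF T_M] measurable_continuous_E[OF g], measurable]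
  have "Measurable.pred M (\<lambda>\<omega>. T \<omega> < \<infinity>)" by measurable
  then show ?thesis unfolding stopped_def[abs_def] measurable_P[OF x] by measurable
qed

lemma stopped_le_dominating:
  assumes "path_bounded r g \<omega> B"
  shows "\<bar>stopped r g T \<omega>\<bar> \<le> B"
  using assms[rule_format, of 0] assms[rule_format, of "enn2real (T \<omega>)"] by (auto simp: stopped_def)

lemma integrable_stopped:
  assumes x: "x \<in> E" and g: "continuous_on E g" and T: "stopping_time F T" and d: "dominated x r g"
  shows "integrable (P x) (stopped r g T)"
proof -
  obtain w where w: "integrable (P x) w" "AE \<omega> in P x. path_bounded r g \<omega> (w \<omega>)"
    using d unfolding dominated_def by blast
  show ?thesis
  proof (rule Bochner_Integration.integrable_bound[OF w(1) measurable_stopped[OF x g T]])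
    show "AE \<omega> in P x. norm (stopped r g T \<omega>) \<le> norm (w \<omega>)"
      using w(2)
    proof eventually_elim
      fix \<omega> assume "path_bounded r g \<omega> (w \<omega>)"
      from stopped_le_dominating[OF this, of T] show "norm (stopped r g T \<omega>) \<le> norm (w \<omega>)" by simp
    qed
  qed
qed

lemma harmonic_stopped:
  assumes r: "0 < r" and f: "ode_solution a b \<mu> D r f" and f0: "\<And>y. y \<in> E \<Longrightarrow> 0 < f y"
    and pq: "{p..q} \<subseteq> E" and x: "x \<in> {p..q}" and T: "stopping_time F T"
    and bef: "AE \<omega> in P x. \<forall>t\<ge>0. ennreal t < T \<omega> \<longrightarrow> X t \<omega> \<in> {p..q}"
  shows "integrable (P x) (stopped r f T)" and "(LINT \<omega>|P x. stopped r f T \<omega>) = f x"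
proof -
  have xE: "x \<in> E" using x pq by auto
  have fc: "continuous_on E f" using f C2_on_continuous_on(1) by (auto simp: ode_solution_def)
  have m: "stopped r f T \<in> borel_measurable (P x)" by (rule measurable_stopped[OF xE fc T])
  have nn: "AE \<omega> in P x. 0 \<le> stopped r f T \<omega>"
    using AE_space
  proof eventually_elim
    fix \<omega> assume "\<omega> \<in> space (P x)"
    then have "X_at T \<omega> \<in> E" by (intro state_space) (auto simp: space_P xE)
    from f0[OF this] show "0 \<le> stopped r f T \<omega>" by (simp add: stopped_def)
  qed
  have "(\<integral>\<^sup>+\<omega>. ennreal (stopped r f T \<omega>) \<partial>P x) = (\<integral>\<^sup>+\<omega>. weighted r T (\<lambda>y. ennreal (f y)) \<omega> \<partial>P x)"
    by (intro nn_integral_cong) (simp add: stopped_def ennreal_mult' indicator_def)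
  also have "\<dots> = ennreal (f x)" by (rule exit_identity[OF r f f0 pq x T bef])
  finally have eq: "(\<integral>\<^sup>+\<omega>. ennreal (stopped r f T \<omega>) \<partial>P x) = ennreal (f x)" .
  show "integrable (P x) (stopped r f T)" by (rule integrableI_nn_integral_finite[OF m nn eq])
  show "(LINT \<omega>|P x. stopped r f T \<omega>) = f x"
    using integral_eq_nn_integral[OF m nn] eq less_imp_le[OF f0[OF xE]] by simp
qed

text \<open>Finite late times see values near \<open>l\<close>. An infinite time contributes 0,
  which is harmless because it forces \<open>l = 0\<close>.\<close>

lemma stopped_tendsto:
  assumes c: "path_limit r g \<omega> l"
    and late: "\<And>v. 0 \<le> v \<Longrightarrow> \<forall>\<^sub>F n in sequentially. ennreal v < S n \<omega>"
    and inf: "\<And>n. S n \<omega> = \<infinity> \<Longrightarrow> l = 0"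
  shows "(\<lambda>n. stopped r g (S n) \<omega>) \<longlonglongrightarrow> l"
proof (rule tendstoI)
  fix e :: real assume e: "0 < e"
  have "\<forall>\<^sub>F t in at_top. dist (exp (- r * t) * g (X t \<omega>)) l < e" by (rule tendstoD[OF c e])
  then obtain v0 where v0: "\<And>t. v0 \<le> t \<Longrightarrow> dist (exp (- r * t) * g (X t \<omega>)) l < e"
    by (auto simp: eventually_at_top_linorder)
  show "\<forall>\<^sub>F n in sequentially. dist (stopped r g (S n) \<omega>) l < e"
    using late[of "max 0 v0"]
  proof (rule eventually_mono)
    fix n assume n: "ennreal (max 0 v0) < S n \<omega>"
    show "dist (stopped r g (S n) \<omega>) l < e"
    proof (cases "S n \<omega>")
      case (real u)
      then have "max 0 v0 < u" using n by (metis ennreal_less_iff max.cobounded1)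
      then show ?thesis using v0[of u] real by (simp add: stopped_def)
    qed (use inf[of n] e in \<open>simp add: stopped_def\<close>)
  qed simp
qed

lemma discounted_top_tendsto:
  assumes "path_limit r g \<omega> l"
  shows "discounted X r g \<infinity> \<omega> = l"
  using tendsto_Lim[OF _ assms] by (simp add: discounted_def)

lemma discounted_bound:
  assumes c: "path_limit r g \<omega> l"
    and B: "path_bounded r g \<omega> B"
  shows "\<bar>discounted X r g t \<omega>\<bar> \<le> B"
proof (cases t)
  case (real v)
  then show ?thesis using B by (simp add: discounted_def)
next
  case top
  have "\<bar>l\<bar> \<le> B"
    by (rule tendsto_upperbound[OF tendsto_rabs[OF c]])
      (use B in \<open>auto intro: eventually_mono[OF eventually_ge_at_top[of 0]]\<close>)
  then show ?thesis using discounted_top_tendsto[OF c] top by simp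
qed

lemma integrable_discounted:
  assumes x: "x \<in> E" and g: "continuous_on E g" and T: "stopping_time F T" and d: "dominated x r g"
    and conv: "AE \<omega> in P x. \<exists>l. path_limit r g \<omega> l"
  shows "integrable (P x) (\<lambda>\<omega>. discounted X r g (T \<omega>) \<omega>)"
proof -
  obtain w where w: "integrable (P x) w" "AE \<omega> in P x. path_bounded r g \<omega> (w \<omega>)"
    using d unfolding dominated_def by blast
  show ?thesis
  proof (rule Bochner_Integration.integrable_bound[OF w(1)])
    show "(\<lambda>\<omega>. discounted X r g (T \<omega>) \<omega>) \<in> borel_measurable (P x)"
      unfolding measurable_P[OF x] by (rule measurable_discounted[OF g measurable_stopping[OF T]])
    show "AE \<omega> in P x. norm (discounted X r g (T \<omega>) \<omega>) \<le> norm (w \<omega>)"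
      using w(2) conv
    proof eventually_elim
      fix \<omega> assume w: "path_bounded r g \<omega> (w \<omega>)"
        and "\<exists>l. path_limit r g \<omega> l"
      then obtain l where "path_limit r g \<omega> l" by blast
      from discounted_bound[OF this w, of "T \<omega>"] show "norm (discounted X r g (T \<omega>) \<omega>) \<le> norm (w \<omega>)" by simp
    qed
  qed
qed

text \<open>The harmonic majorant need not be uniformly integrable along the path, so it is only stopped on
  exit from compact intervals; the domination of \<open>V\<close> allows passing to the limit.\<close>

lemma discounted_le_start:
  assumes r: "0 < r" and \<phi>: "ode_solution a b \<mu> D r \<phi>" "\<And>y. y \<in> E \<Longrightarrow> 0 < \<phi> y"
    and \<psi>: "ode_solution a b \<mu> D r \<psi>" "\<And>y. y \<in> E \<Longrightarrow> 0 < \<psi> y"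
    and x: "x \<in> E" and V: "continuous_on E V" and dom: "dominated x r V"
    and conv: "AE \<omega> in P x. \<exists>l. path_limit r V \<omega> l"
    and T: "stopping_time F T" and Vx: "V x = \<alpha> * \<phi> x + \<beta> * \<psi> x"
    and le: "AE \<omega> in P x. \<forall>t\<ge>0. ennreal t \<le> T \<omega> \<longrightarrow> V (X t \<omega>) \<le> \<alpha> * \<phi> (X t \<omega>) + \<beta> * \<psi> (X t \<omega>)"
  shows "(LINT \<omega>|P x. discounted X r V (T \<omega>) \<omega>) \<le> V x"
proof -
  obtain U0 L0 :: "nat \<Rightarrow> real" where "E = (\<Union>i. {L0 i..U0 i})" "incseq U0" "decseq L0" "\<And>i. L0 i < U0 i"
    and LU0: "\<And>i. a < L0 i" "\<And>i. U0 i < b" "(\<lambda>i. ereal (L0 i)) \<longlonglongrightarrow> a" "(\<lambda>i. ereal (U0 i)) \<longlonglongrightarrow> b"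
    by (rule einterval_Icc_approximation[OF nonempty_interval]) (rule that; assumption)
  have ev: "\<forall>\<^sub>F n in sequentially. L0 n < y \<and> y < U0 n" if "y \<in> E" for y
    using order_tendstoD(2)[OF LU0(3), of "ereal y"] order_tendstoD(1)[OF LU0(4), of "ereal y"] that
    by (auto simp: einterval_iff elim: eventually_elim2)
  \<comment> \<open>The first intervals are dropped so that \<open>x\<close> lies inside all
    remaining ones.\<close>
  obtain N where N: "\<And>n. N \<le> n \<Longrightarrow> L0 n < x \<and> x < U0 n"
    using ev[OF x] by (auto simp: eventually_sequentially)
  define L where "L n = L0 (n + N)" for n
  define U where "U n = U0 (n + N)" for n
  have LxU: "L n < x" "x < U n" for n using N[of "n + N"] by (auto simp: L_def U_def)
  have LU_E: "L n \<in> E" "U n \<in> E" for n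
    using LU0(1,2)[of "n + N"] LxU[of n] x
    by (auto simp: L_def U_def einterval_iff intro: less_trans[of _ "ereal x"])
  have evLU: "\<forall>\<^sub>F n in sequentially. L n < y \<and> y < U n" if "y \<in> E" for y
    unfolding L_def U_def using eventually_sequentially_seg[of "\<lambda>n. L0 n < y \<and> y < U0 n" N] ev[OF that] by simp
  define A where "A n = E \<inter> - {L n<..<U n}" for n
  define \<rho> where "\<rho> n = hitting_time X (A n)" for n
  have clA: "closed (- {L n<..<U n})" for n by (simp add: closed_Compl)
  have \<rho>_stop: "stopping_time F (\<rho> n)" for n
    unfolding \<rho>_def by (rule stopping_time_hitting_time[OF clA A_def])
  \<comment> \<open>\<open>T\<close> cut off at the exit from the \<open>n\<close>-th interval. Up
    to this time the path is confined to a compact interval, as \<open>harmonic_stopped\<close>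
    requires.\<close>
  define S where "S n \<omega> = min (T \<omega>) (\<rho> n \<omega>)" for n \<omega>
  have S_stop: "stopping_time F (S n)" for n
    unfolding S_def by (rule stopping_time_min[OF T \<rho>_stop])
  have late: "\<forall>\<^sub>F n in sequentially. ennreal v < \<rho> n \<omega>" if w: "\<omega> \<in> space M" and v: "0 \<le> v" for \<omega> v
  proof -
    obtain m m' where m: "m \<in> E" "m' \<in> E" "\<And>s. 0 \<le> s \<Longrightarrow> s \<le> v \<Longrightarrow> m \<le> X s \<omega> \<and> X s \<omega> \<le> m'"
      using path_bounds[OF w v] by metis
    show ?thesis using evLU[OF m(1)] evLU[OF m(2)]
    proof eventually_elim
      fix n assume "L n < m \<and> m < U n" "L n < m' \<and> m' < U n"
      then show "ennreal v < \<rho> n \<omega>" unfolding \<rho>_def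
        using m(3) by (intro hitting_time_gtI[OF w clA A_def v]) (force simp: A_def)
    qed
  qed
  have bef: "AE \<omega> in P x. \<forall>t\<ge>0. ennreal t < S n \<omega> \<longrightarrow> X t \<omega> \<in> {L n..U n}" for n
    using AE_space
  proof eventually_elim
    fix \<omega> assume "\<omega> \<in> space (P x)"
    then have w: "\<omega> \<in> space M" by (simp add: space_P x)
    show "\<forall>t\<ge>0. ennreal t < S n \<omega> \<longrightarrow> X t \<omega> \<in> {L n..U n}"
    proof (intro allI impI)
      fix t :: real assume t: "0 \<le> t" "ennreal t < S n \<omega>"
      then have "X t \<omega> \<notin> A n" using hitting_time_gt[of t "A n" \<omega>] by (simp add: S_def \<rho>_def)
      then show "X t \<omega> \<in> {L n..U n}" using state_space[OF t(1) w] by (auto simp: A_def)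
    qed
  qed
  have xLU: "x \<in> {L n..U n}" for n using LxU[of n] by auto
  have hphi: "integrable (P x) (stopped r \<phi> (S n))" "(LINT \<omega>|P x. stopped r \<phi> (S n) \<omega>) = \<phi> x" for n
    by (rule harmonic_stopped[OF r \<phi> interval_subset_E[OF LU_E] xLU S_stop bef]; assumption)+
  have hpsi: "integrable (P x) (stopped r \<psi> (S n))" "(LINT \<omega>|P x. stopped r \<psi> (S n) \<omega>) = \<psi> x" for n
    by (rule harmonic_stopped[OF r \<psi> interval_subset_E[OF LU_E] xLU S_stop bef]; assumption)+
  \<comment> \<open>The coefficients may have any sign, so the positive functions \<phi> and \<psi>
    are stopped separately and combined afterwards.\<close>
  have Z_le: "(LINT \<omega>|P x. stopped r V (S n) \<omega>) \<le> V x" for n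
  proof -
    have "(LINT \<omega>|P x. stopped r V (S n) \<omega>) \<le>
        (LINT \<omega>|P x. \<alpha> * stopped r \<phi> (S n) \<omega> + \<beta> * stopped r \<psi> (S n) \<omega>)"
    proof (rule integral_mono_AE)
      show "integrable (P x) (stopped r V (S n))" by (rule integrable_stopped[OF x V S_stop dom])
      show "integrable (P x) (\<lambda>\<omega>. \<alpha> * stopped r \<phi> (S n) \<omega> + \<beta> * stopped r \<psi> (S n) \<omega>)"
        using hphi(1) hpsi(1) by simp
      show "AE \<omega> in P x. stopped r V (S n) \<omega> \<le> \<alpha> * stopped r \<phi> (S n) \<omega> + \<beta> * stopped r \<psi> (S n) \<omega>"
        using le
      proof eventually_elim
        fix \<omega> assume *: "\<forall>t\<ge>0. ennreal t \<le> T \<omega> \<longrightarrow> V (X t \<omega>) \<le> \<alpha> * \<phi> (X t \<omega>) + \<beta> * \<psi> (X t \<omega>)"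
        show "stopped r V (S n) \<omega> \<le> \<alpha> * stopped r \<phi> (S n) \<omega> + \<beta> * stopped r \<psi> (S n) \<omega>"
        proof (cases "S n \<omega> < \<infinity>")
          case True
          define t where "t = enn2real (S n \<omega>)"
          have "ennreal t = S n \<omega>" using True by (simp add: t_def less_top)
          then have "ennreal t \<le> T \<omega>" by (simp add: S_def)
          then have "V (X t \<omega>) \<le> \<alpha> * \<phi> (X t \<omega>) + \<beta> * \<psi> (X t \<omega>)" using * by (simp add: t_def)
          then have "exp (- r * t) * V (X t \<omega>) \<le> exp (- r * t) * (\<alpha> * \<phi> (X t \<omega>) + \<beta> * \<psi> (X t \<omega>))"
            by (intro mult_left_mono) auto
          then show ?thesis using True by (simp add: stopped_def t_def[symmetric] algebra_simps)
        qed (simp add: stopped_def)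
      qed
    qed
    also have "\<dots> = V x" using hphi hpsi Vx by simp
    finally show ?thesis .
  qed
  obtain w where w: "integrable (P x) w" "AE \<omega> in P x. path_bounded r V \<omega> (w \<omega>)"
    using dom unfolding dominated_def by blast
  have "(\<lambda>n. LINT \<omega>|P x. stopped r V (S n) \<omega>) \<longlonglongrightarrow> (LINT \<omega>|P x. discounted X r V (T \<omega>) \<omega>)"
  proof (rule integral_dominated_convergence[OF _ _ w(1)])
    show "(\<lambda>\<omega>. discounted X r V (T \<omega>) \<omega>) \<in> borel_measurable (P x)"
      unfolding measurable_P[OF x] by (rule measurable_discounted[OF V measurable_stopping[OF T]])
    show "stopped r V (S n) \<in> borel_measurable (P x)" for n by (rule measurable_stopped[OF x V S_stop])
    show "AE \<omega> in P x. norm (stopped r V (S n) \<omega>) \<le> w \<omega>" for n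
      using w(2) by eventually_elim (use stopped_le_dominating in auto)
    show "AE \<omega> in P x. (\<lambda>n. stopped r V (S n) \<omega>) \<longlonglongrightarrow> discounted X r V (T \<omega>) \<omega>"
      using conv AE_space
    proof eventually_elim
      fix \<omega> assume "\<exists>l. path_limit r V \<omega> l" and "\<omega> \<in> space (P x)"
      then obtain l where l: "path_limit r V \<omega> l" and w: "\<omega> \<in> space M"
        by (auto simp: space_P x)
      show "(\<lambda>n. stopped r V (S n) \<omega>) \<longlonglongrightarrow> discounted X r V (T \<omega>) \<omega>"
      proof (cases "T \<omega>")
        case (real v)
        have "\<forall>\<^sub>F n in sequentially. ennreal v < \<rho> n \<omega>" by (rule late[OF w]) (use real in simp)
        then have "\<forall>\<^sub>F n in sequentially. stopped r V (S n) \<omega> = discounted X r V (T \<omega>) \<omega>"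
        proof (rule eventually_mono)
          fix n assume "ennreal v < \<rho> n \<omega>"
          then have "S n \<omega> = ennreal v" using real by (simp add: S_def min_absorb1 less_imp_le)
          then show "stopped r V (S n) \<omega> = discounted X r V (T \<omega>) \<omega>"
            using real by (simp add: stopped_def discounted_def)
        qed
        then show ?thesis by (rule tendsto_eventually)
      next
        case top
        have S\<rho>: "S n \<omega> = \<rho> n \<omega>" for n using top by (simp add: S_def)
        have "(\<lambda>n. stopped r V (S n) \<omega>) \<longlonglongrightarrow> l"
        proof (rule stopped_tendsto[OF l])
          show "\<forall>\<^sub>F n in sequentially. ennreal v < S n \<omega>" if "0 \<le> v" for v
            unfolding S\<rho> by (rule late[OF w that])
          \<comment> \<open>Such a path never leaves a compact interval, where \<open>V\<close> is
            bounded; discounting makes its limit 0, which matches the value of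
            \<open>stopped\<close>.\<close>
          fix n assume "S n \<omega> = \<infinity>"
          then have "X t \<omega> \<notin> A n" if "0 \<le> t" for t
            using that hitting_time_gt[of t "A n" \<omega>] by (simp add: S\<rho> \<rho>_def)
          then have in_LU: "X t \<omega> \<in> {L n..U n}" if "0 \<le> t" for t
            using that state_space[OF that w] by (force simp: A_def)
          have "bounded (V ` {L n..U n})"
            by (intro compact_imp_bounded compact_continuous_image continuous_on_subset[OF V]
                interval_subset_E[OF LU_E]) auto
          then obtain B where "\<forall>y\<in>{L n..U n}. \<bar>V y\<bar> \<le> B" by (auto simp: bounded_iff)
          then have B: "\<bar>V (X t \<omega>)\<bar> \<le> B" if "0 \<le> t" for t using in_LU[OF that] by blast
          have "((\<lambda>t. exp (- r * t) * B) \<longlongrightarrow> 0) at_top"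
          proof -
            have "filterlim (\<lambda>t. r * t) at_top at_top"
              using r by (intro filterlim_tendsto_pos_mult_at_top[OF tendsto_const]) (auto simp: filterlim_ident)
            then have "filterlim (\<lambda>t. - (r * t)) at_bot at_top" by (simp add: filterlim_uminus_at_top)
            then have "((\<lambda>t. exp (- (r * t))) \<longlongrightarrow> 0) at_top" by (rule filterlim_compose[OF exp_at_bot])
            from tendsto_mult_left_zero[OF this, of B] show ?thesis by simp
          qed
          then have "path_limit r V \<omega> 0"
          proof (rule Lim_null_comparison[rotated])
            show "\<forall>\<^sub>F t in at_top. norm (exp (- r * t) * V (X t \<omega>)) \<le> exp (- r * t) * B"
              using B by (auto simp: abs_mult intro: eventually_mono[OF eventually_ge_at_top[of 0]])
          qed
          from tendsto_unique[OF _ l this] show "l = 0" by simp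
        qed
        then show ?thesis using discounted_top_tendsto[OF l] top by simp
      qed
    qed
  qed
  then show ?thesis by (rule LIMSEQ_le_const2) (use Z_le in auto)
qed

text \<open>\<open>f\<close> is stopped at the first visit to \<open>p\<close> or \<open>y\<close>:
  paths that meet \<open>y\<close> first contribute \<open>f y\<close> times their discount, the
  others at most \<open>f p\<close>. When \<open>p\<close> approaches an end where \<open>f\<close>
  vanishes, the Laplace transform of the hitting time of \<open>y\<close> is seen to be at least
  \<open>f x / f y\<close>.\<close>

lemma hitting_time_laplace_bound:
  assumes r: "0 < r" and f: "ode_solution a b \<mu> D r f" and f0: "\<And>y. y \<in> E \<Longrightarrow> 0 < f y"
    and E: "x \<in> E" "y \<in> E" "p \<in> E" and between: "p < x \<and> x < y \<or> y < x \<and> x < p"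
  shows "f x \<le> f p + f y * (LINT \<omega>|P x. stopped r (\<lambda>_. 1) (hitting_time X {y}) \<omega>)"
proof -
  interpret prob_space "P x" by (rule prob_space_P[OF E(1)])
  define T where "T = hitting_time X {p, y}"
  have Ap: "{p, y} = E \<inter> {p, y}" "{y} = E \<inter> {y}" using E by auto
  have cl: "closed {p, y}" "closed {y}" by auto
  have T: "stopping_time F T" unfolding T_def by (rule stopping_time_hitting_time[OF cl(1) Ap(1)])
  have Ty: "stopping_time F (hitting_time X {y})" by (rule stopping_time_hitting_time[OF cl(2) Ap(2)])
  define u where "u = min p y"
  define v where "v = max p y"
  have uv: "u \<in> E" "v \<in> E" "x \<in> {u..v}" "{u, v} = {p, y}" "u < x" "x < v"
    using E between by (auto simp: u_def v_def min_def max_def)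
  have bef: "AE \<omega> in P x. \<forall>t\<ge>0. ennreal t < T \<omega> \<longrightarrow> X t \<omega> \<in> {u..v}"
    using AE_space start[OF E(1)]
  proof eventually_elim
    fix \<omega> assume "\<omega> \<in> space (P x)" and X0: "X 0 \<omega> = x"
    then have w: "\<omega> \<in> space M" by (simp add: space_P E)
    show "\<forall>t\<ge>0. ennreal t < T \<omega> \<longrightarrow> X t \<omega> \<in> {u..v}"
    proof (intro allI impI, rule ccontr)
      fix t :: real assume t: "0 \<le> t" "ennreal t < T \<omega>" "X t \<omega> \<notin> {u..v}"
      then have "u \<in> closed_segment (X 0 \<omega>) (X t \<omega>) \<or> v \<in> closed_segment (X 0 \<omega>) (X t \<omega>)"
        using uv X0 by (auto simp: closed_segment_eq_real_ivl)
      then obtain s where s: "0 \<le> s" "s \<le> t" "X s \<omega> \<in> {p, y}"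
        using closed_segment_path[OF w t(1)] uv(4) by (metis insert_iff)
      then have "ennreal s < T \<omega>" using t(2) by (meson ennreal_leI le_less_trans)
      with s hitting_time_gt[of s "{p, y}" \<omega>] show False by (simp add: T_def)
    qed
  qed
  have h: "integrable (P x) (stopped r f T)" "(LINT \<omega>|P x. stopped r f T \<omega>) = f x"
    by (rule harmonic_stopped[OF r f f0 interval_subset_E[OF uv(1,2)] uv(3) T bef]; assumption)+
  have int1: "integrable (P x) (stopped r (\<lambda>_. 1) (hitting_time X {y}))"
    by (rule integrable_const_bound[where B = 1])
      (use r measurable_stopped[OF E(1) continuous_on_const Ty] in \<open>auto simp: stopped_def\<close>)
  have "f x = (LINT \<omega>|P x. stopped r f T \<omega>)" by (rule h(2)[symmetric])
  also have "\<dots> \<le> (LINT \<omega>|P x. f p + f y * stopped r (\<lambda>_. 1) (hitting_time X {y}) \<omega>)"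
  proof (rule integral_mono_AE[OF h(1)])
    show "integrable (P x) (\<lambda>\<omega>. f p + f y * stopped r (\<lambda>_. 1) (hitting_time X {y}) \<omega>)"
      using int1 by simp
    show "AE \<omega> in P x. stopped r f T \<omega> \<le> f p + f y * stopped r (\<lambda>_. 1) (hitting_time X {y}) \<omega>"
      using AE_space
    proof eventually_elim
      fix \<omega> assume "\<omega> \<in> space (P x)"
      then have w: "\<omega> \<in> space M" by (simp add: space_P E)
      have p0: "0 \<le> stopped r (\<lambda>_. 1) (hitting_time X {y}) \<omega>" by (simp add: stopped_def)
      show "stopped r f T \<omega> \<le> f p + f y * stopped r (\<lambda>_. 1) (hitting_time X {y}) \<omega>"
      proof (cases "T \<omega> < \<infinity>")
        case True
        then obtain s where s: "0 \<le> s" "T \<omega> = ennreal s" "X s \<omega> \<in> {p, y}"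
          using hitting_time_attained[OF w cl(1) Ap(1)] unfolding T_def by metis
        show ?thesis
        proof (cases "X s \<omega> = y")
          case True
          have "hitting_time X {y} \<omega> = ennreal s"
          proof (rule antisym)
            show "hitting_time X {y} \<omega> \<le> ennreal s" using hitting_time_le[of s \<omega> "{y}"] s True by simp
            have "T \<omega> \<le> hitting_time X {y} \<omega>"
              unfolding T_def hitting_time_def by (rule Inf_superset_mono) auto
            then show "ennreal s \<le> hitting_time X {y} \<omega>" using s by simp
          qed
          then show ?thesis using s True less_imp_le[OF f0[OF E(3)]] by (simp add: stopped_def)
        next
          case False
          have "exp (- r * s) * f p \<le> 1 * f p"
            using s r f0[OF E(3)] by (intro mult_right_mono) auto
          moreover have "0 \<le> f y * stopped r (\<lambda>_. 1) (hitting_time X {y}) \<omega>"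
            using p0 f0[OF E(2)] by simp
          ultimately show ?thesis using s False by (simp add: stopped_def)
        qed
      next
        case False
        then show ?thesis using p0 f0[OF E(2)] f0[OF E(3)] by (simp add: stopped_def add_nonneg_nonneg)
      qed
    qed
  qed
  also have "\<dots> = f p + f y * (LINT \<omega>|P x. stopped r (\<lambda>_. 1) (hitting_time X {y}) \<omega>)"
    using int1 by (simp add: prob_space)
  finally show ?thesis .
qed

text \<open>Stopping at the hitting time of \<open>y n\<close> yields \<open>K (y n)\<close> times
  the Laplace transform of that time, hence at least \<open>K (y n) * f x / f (y n)\<close>. As
  \<open>y n\<close> approaches an end these times tend to infinity, and dominated convergence sends
  the means to 0. \<open>f\<close> vanishes at the opposite end.\<close>

lemma boundary_ratio_tendsto_zero:
  assumes r: "0 < r" and f: "ode_solution a b \<mu> D r f" and f0: "\<And>y. y \<in> E \<Longrightarrow> 0 < f y"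
    and x: "x \<in> E" and K: "continuous_on E K" and K0: "\<And>y. y \<in> E \<Longrightarrow> 0 \<le> K y"
    and dom: "dominated x r K"
    and conv: "AE \<omega> in P x. path_limit r K \<omega> 0"
    and y: "\<And>n. y n \<in> E"
    and side: "(\<forall>n. x < y n) \<and> (\<forall>z\<in>E. \<forall>\<^sub>F n in sequentially. z < y n) \<and> (\<forall>e>0. \<exists>p\<in>E. p < x \<and> f p < e) \<or>
      (\<forall>n. y n < x) \<and> (\<forall>z\<in>E. \<forall>\<^sub>F n in sequentially. y n < z) \<and> (\<forall>e>0. \<exists>p\<in>E. x < p \<and> f p < e)"
  shows "(\<lambda>n. K (y n) / f (y n)) \<longlonglongrightarrow> 0"
proof -
  define T where "T n = hitting_time X {y n}" for n
  have cl: "closed {y n}" and Ay: "{y n} = E \<inter> {y n}" for n using y by auto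
  have T: "stopping_time F (T n)" for n unfolding T_def by (rule stopping_time_hitting_time[OF cl Ay])
  \<comment> \<open>On \<open>{0..v}\<close> the path stays between two points of \<open>E\<close>,
    and \<open>y n\<close> eventually passes both on its side.\<close>
  have late: "\<forall>\<^sub>F n in sequentially. ennreal v < T n \<omega>" if w: "\<omega> \<in> space M" and v: "0 \<le> v" for \<omega> v
  proof -
    obtain m m' where m: "m \<in> E" "m' \<in> E" "\<And>s. 0 \<le> s \<Longrightarrow> s \<le> v \<Longrightarrow> m \<le> X s \<omega> \<and> X s \<omega> \<le> m'"
      using path_bounds[OF w v] by metis
    have "\<forall>\<^sub>F n in sequentially. y n < m \<or> m' < y n"
      using side m(1,2) by (auto elim: eventually_mono)
    then show ?thesis
    proof (rule eventually_mono)
      fix n assume "y n < m \<or> m' < y n"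
      then show "ennreal v < T n \<omega>" unfolding T_def
        using m(3) by (intro hitting_time_gtI[OF w cl Ay v]) force
    qed
  qed
  obtain w where w: "integrable (P x) w" "AE \<omega> in P x. path_bounded r K \<omega> (w \<omega>)"
    using dom unfolding dominated_def by blast
  have "(\<lambda>n. LINT \<omega>|P x. stopped r K (T n) \<omega>) \<longlonglongrightarrow> (LINT \<omega>|P x. 0)"
  proof (rule integral_dominated_convergence[OF _ _ w(1)])
    show "stopped r K (T n) \<in> borel_measurable (P x)" for n by (rule measurable_stopped[OF x K T])
    show "AE \<omega> in P x. norm (stopped r K (T n) \<omega>) \<le> w \<omega>" for n
      using w(2) by eventually_elim (use stopped_le_dominating in auto)
    show "AE \<omega> in P x. (\<lambda>n. stopped r K (T n) \<omega>) \<longlonglongrightarrow> 0"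
      using conv AE_space by eventually_elim (auto intro!: stopped_tendsto late simp: space_P x)
  qed simp
  then have lim: "(\<lambda>n. (LINT \<omega>|P x. stopped r K (T n) \<omega>) / f x) \<longlonglongrightarrow> 0"
    using tendsto_divide_zero by fastforce
  have bound: "K (y n) / f (y n) \<le> (LINT \<omega>|P x. stopped r K (T n) \<omega>) / f x" for n
  proof -
    define J where "J = (LINT \<omega>|P x. stopped r (\<lambda>_. 1) (T n) \<omega>)"
    \<comment> \<open>The contribution of \<open>p\<close> disappears as \<open>p\<close> moves to
      the end where \<open>f\<close> vanishes.\<close>
    have fx: "f x \<le> f (y n) * J"
    proof (rule field_le_epsilon)
      fix e :: real assume "0 < e"
      then obtain p where p: "p \<in> E" "p < x \<and> x < y n \<or> y n < x \<and> x < p" "f p < e" using side by blast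
      show "f x \<le> f (y n) * J + e"
        using hitting_time_laplace_bound[OF r f f0 x y p(1,2)] p(3) by (simp add: J_def T_def)
    qed
    have "(LINT \<omega>|P x. stopped r K (T n) \<omega>) = (LINT \<omega>|P x. K (y n) * stopped r (\<lambda>_. 1) (T n) \<omega>)"
    proof (rule Bochner_Integration.integral_cong[OF refl])
      fix \<omega> assume "\<omega> \<in> space (P x)"
      then have w: "\<omega> \<in> space M" by (simp add: space_P x)
      show "stopped r K (T n) \<omega> = K (y n) * stopped r (\<lambda>_. 1) (T n) \<omega>"
        using hitting_time_value[OF w cl Ay] by (auto simp: stopped_def T_def)
    qed
    then have "(LINT \<omega>|P x. stopped r K (T n) \<omega>) = K (y n) * J" by (simp add: J_def)
    moreover have "K (y n) * f x \<le> K (y n) * (f (y n) * J)" by (intro mult_left_mono fx K0 y)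
    ultimately show ?thesis using f0[OF x] f0[OF y, of n] by (simp add: field_simps)
  qed
  show ?thesis
    by (rule tendsto_sandwich[OF _ _ tendsto_const lim])
      (use bound K0[OF y] f0[OF y] in \<open>auto intro!: always_eventually divide_nonneg_pos\<close>)
qed

end

section \<open>The game\<close>

locale diffusion_game = regular_diffusion M F P X a b \<mu> D
  for M :: "'a measure" and F :: "ennreal \<Rightarrow> 'a measure"
    and P :: "real \<Rightarrow> 'a measure" and X :: "real \<Rightarrow> 'a \<Rightarrow> real"
    and a b :: ereal and \<mu> D :: "real \<Rightarrow> real" +
  fixes \<phi> \<psi> G H :: "real \<Rightarrow> real" and r :: real
  assumes r_pos: "0 < r"
    and fundamental: "fundamental_solutions a b \<mu> D r \<phi> \<psi>"
    and continuous_G: "continuous_on (einterval a b) G" and continuous_H: "continuous_on (einterval a b) H"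
    and G_le_H: "x \<in> einterval a b \<Longrightarrow> G x \<le> H x"
    and sup_G: "x \<in> einterval a b \<Longrightarrow>
      (\<integral>\<^sup>+\<omega>. (SUP t\<in>{0..}. ennreal \<bar>exp (- r * t) * G (X t \<omega>)\<bar>) \<partial>P x) < \<infinity>"
    and sup_H: "x \<in> einterval a b \<Longrightarrow>
      (\<integral>\<^sup>+\<omega>. (SUP t\<in>{0..}. ennreal \<bar>exp (- r * t) * H (X t \<omega>)\<bar>) \<partial>P x) < \<infinity>"
    and common_limit: "x \<in> einterval a b \<Longrightarrow>
      AE \<omega> in P x. \<exists>l. ((\<lambda>t. exp (- r * t) * G (X t \<omega>)) \<longlongrightarrow> l) at_top \<and>
                      ((\<lambda>t. exp (- r * t) * H (X t \<omega>)) \<longlongrightarrow> l) at_top"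
begin

abbreviation "Q z \<equiv> \<phi> z / \<psi> z"
abbreviation "WG \<equiv> transformed E \<phi> \<psi> G"
abbreviation "WH \<equiv> transformed E \<phi> \<psi> H"

section \<open>The coordinate \<open>Q\<close> and the transformed obstacles\<close>

lemma ode_phi: "ode_solution a b \<mu> D r \<phi>" and ode_psi: "ode_solution a b \<mu> D r \<psi>"
  and phi_pos: "y \<in> E \<Longrightarrow> 0 < \<phi> y" and psi_pos: "y \<in> E \<Longrightarrow> 0 < \<psi> y"
  and phi_mono: "strict_mono_on E \<phi>" and psi_mono: "strict_antimono_on E \<psi>"
  using fundamental by (auto simp: fundamental_solutions_def)

lemma continuous_phi: "continuous_on E \<phi>" and continuous_psi: "continuous_on E \<psi>"
  using ode_phi ode_psi C2_on_continuous_on(1) by (auto simp: ode_solution_def)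

lemma ex_near_right_end:
  assumes x: "x \<in> E" and ev: "eventually (\<lambda>t. R (real_of_ereal t)) (at_left b)"
  shows "\<exists>z\<in>E. x < z \<and> R z"
proof -
  have xb: "ereal x < b" using x by (simp add: einterval_iff)
  then obtain c where c: "c < b" "\<And>t. c < t \<Longrightarrow> t < b \<Longrightarrow> R (real_of_ereal t)"
    using ev by (auto simp: eventually_at_left)
  obtain t where t: "max c (ereal x) < t" "t < b" using dense[of "max c (ereal x)" b] c(1) xb by auto
  obtain z where z: "t = ereal z" using t x by (cases t) auto
  show ?thesis using t z c(2)[of t] x by (intro bexI[of _ z]) (auto simp: einterval_iff intro: less_trans[of _ "ereal x"])
qed

lemma ex_near_left_end:
  assumes x: "x \<in> E" and ev: "eventually (\<lambda>t. R (real_of_ereal t)) (at_right a)"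
  shows "\<exists>z\<in>E. z < x \<and> R z"
proof -
  have ax: "a < ereal x" using x by (simp add: einterval_iff)
  then obtain c where c: "a < c" "\<And>t. a < t \<Longrightarrow> t < c \<Longrightarrow> R (real_of_ereal t)"
    using ev by (auto simp: eventually_at_right)
  obtain t where t: "a < t" "t < min c (ereal x)" using dense[of a "min c (ereal x)"] c(1) ax by auto
  obtain z where z: "t = ereal z" using t x by (cases t) auto
  show ?thesis using t z c(2)[of t] x by (intro bexI[of _ z]) (auto simp: einterval_iff intro: less_trans[of _ "ereal x"])
qed

lemma phi_small: "x \<in> E \<Longrightarrow> 0 < e \<Longrightarrow> \<exists>z\<in>E. z < x \<and> \<phi> z < e"
  using fundamental order_tendstoD(2)[of "\<phi> \<circ> real_of_ereal" 0 "at_right a" e]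
  by (intro ex_near_left_end) (auto simp: fundamental_solutions_def)

lemma psi_small: "x \<in> E \<Longrightarrow> 0 < e \<Longrightarrow> \<exists>z\<in>E. x < z \<and> \<psi> z < e"
  using fundamental order_tendstoD(2)[of "\<psi> \<circ> real_of_ereal" 0 "at_left b" e]
  by (intro ex_near_right_end) (auto simp: fundamental_solutions_def)

lemma phi_large: "x \<in> E \<Longrightarrow> \<exists>z\<in>E. x < z \<and> B < \<phi> z"
  using fundamental filterlim_at_top_dense[of "\<phi> \<circ> real_of_ereal" "at_left b"]
  by (intro ex_near_right_end) (auto simp: fundamental_solutions_def)

lemma Q_pos: "z \<in> E \<Longrightarrow> 0 < Q z"
  using phi_pos psi_pos by simp

lemma Q_strict_mono: "x \<in> E \<Longrightarrow> y \<in> E \<Longrightarrow> x < y \<Longrightarrow> Q x < Q y"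
  using phi_mono psi_mono phi_pos[of x] psi_pos[of y] unfolding monotone_on_def
  by (intro frac_less) (auto intro: less_imp_le)

lemma Q_less_iff: "x \<in> E \<Longrightarrow> y \<in> E \<Longrightarrow> Q x < Q y \<longleftrightarrow> x < y"
  using Q_strict_mono[of x y] Q_strict_mono[of y x] by (cases x y rule: linorder_cases) auto

lemma inj_Q: "inj_on Q E"
proof (rule inj_onI)
  fix x y assume xy: "x \<in> E" "y \<in> E" and e: "Q x = Q y"
  show "x = y"
    using Q_strict_mono[OF xy] Q_strict_mono[OF xy(2,1)] e by (cases x y rule: linorder_cases) auto
qed

lemma ex_E: "\<exists>x. x \<in> E"
  using nonempty_interval by (metis einterval_nonempty ex_in_conv)

lemma Q_large: "x \<in> E \<Longrightarrow> \<exists>z\<in>E. x < z \<and> B < Q z"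
proof -
  assume x: "x \<in> E"
  obtain z where z: "z \<in> E" "x < z" "\<bar>B\<bar> * \<psi> x < \<phi> z" using phi_large[OF x] by blast
  have "\<psi> z \<le> \<psi> x" using psi_mono x z by (auto simp: monotone_on_def intro: less_imp_le)
  then have "\<bar>B\<bar> * \<psi> z \<le> \<bar>B\<bar> * \<psi> x" by (intro mult_left_mono) auto
  then have "\<bar>B\<bar> < Q z" using z psi_pos[OF z(1)] by (simp add: field_simps)
  then show ?thesis using z by (intro bexI[of _ z]) auto
qed

lemma Q_small: "x \<in> E \<Longrightarrow> 0 < e \<Longrightarrow> \<exists>z\<in>E. z < x \<and> Q z < e"
proof -
  assume x: "x \<in> E" and e: "0 < e"
  obtain z where z: "z \<in> E" "z < x" "\<phi> z < e * \<psi> x" using phi_small[OF x] e psi_pos[OF x] by (metis mult_pos_pos)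
  have "\<psi> x < \<psi> z" using psi_mono x z by (auto simp: monotone_on_def)
  then have "e * \<psi> x < e * \<psi> z" using e by simp
  then have "Q z < e" using z psi_pos[OF z(1)] by (simp add: field_simps)
  then show ?thesis using z by blast
qed

lemma continuous_Q: "continuous_on E Q"
  using psi_pos by (intro continuous_intros continuous_phi continuous_psi) fastforce

lemma Q_image: "Q ` E = {0<..}"
proof (intro equalityI subsetI)
  fix c :: real assume "c \<in> {0<..}"
  then have c: "0 < c" by simp
  obtain x where x: "x \<in> E" using ex_E by blast
  obtain z1 z2 where z: "z1 \<in> E" "Q z1 < c" "z2 \<in> E" "c < Q z2"
    using Q_small[OF x c] Q_large[OF x, of c] by blast
  have "connected (Q ` E)"
    using interval_subset_E
    by (intro connected_continuous_image continuous_Q is_interval_connected) (fastforce simp: is_interval_1)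
  moreover have "Q z1 \<in> Q ` E" "Q z2 \<in> Q ` E" using z by blast+
  ultimately show "c \<in> Q ` E" using z(2,4) by (meson connectedD_interval less_imp_le)
qed (use Q_pos in auto)

definition Qinv :: "real \<Rightarrow> real" where "Qinv = the_inv_into E Q"

lemma Qinv_Q: "z \<in> E \<Longrightarrow> Qinv (Q z) = z"
  unfolding Qinv_def by (rule the_inv_into_f_f[OF inj_Q])

lemma Qinv_E: "0 < y \<Longrightarrow> Qinv y \<in> E" and Q_Qinv: "0 < y \<Longrightarrow> Q (Qinv y) = y"
  unfolding Qinv_def using Q_image inj_Q
  by (auto intro!: the_inv_into_into f_the_inv_into_f[OF inj_Q, unfolded Q_image])

lemma Qinv_mono: "0 < x \<Longrightarrow> x \<le> y \<Longrightarrow> Qinv x \<le> Qinv y"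
  using Q_strict_mono[OF Qinv_E Qinv_E, of y x] Q_Qinv[of x] Q_Qinv[of y] by (force simp: not_le[symmetric])

lemma continuous_Qinv: "continuous_on {0<..} Qinv"
proof (rule continuous_onI_mono)
  have "Qinv ` {0<..} = E"
    using Qinv_E Qinv_Q Q_pos by (force simp: image_iff)
  then show "open (Qinv ` {0<..})" by (simp add: open_einterval)
qed (use Qinv_mono in auto)

lemma transformed_eq: "transformed E \<phi> \<psi> g y = g (Qinv y) / \<psi> (Qinv y)"
  by (simp add: transformed_def Qinv_def Let_def)

lemma transformed_Q: "z \<in> E \<Longrightarrow> transformed E \<phi> \<psi> g (Q z) = g z / \<psi> z"
  by (simp only: transformed_eq Qinv_Q)

lemma continuous_transformed:
  assumes "continuous_on E g"
  shows "continuous_on {0<..} (transformed E \<phi> \<psi> g)"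
  unfolding transformed_eq
  using Qinv_E psi_pos
  by (intro continuous_on_divide continuous_on_compose2[OF assms continuous_Qinv]
      continuous_on_compose2[OF continuous_psi continuous_Qinv]) (force+)

lemma WG_le_WH: "0 < y \<Longrightarrow> WG y \<le> WH y"
  unfolding transformed_eq using G_le_H[OF Qinv_E] psi_pos[OF Qinv_E] by (intro divide_right_mono) (auto intro: less_imp_le)

lemma dominated_G: "x \<in> E \<Longrightarrow> dominated x r G" and dominated_H: "x \<in> E \<Longrightarrow> dominated x r H"
  using dominatedI continuous_G continuous_H sup_G sup_H by blast+

section \<open>The obstacles meet at both ends\<close>

lemma gap_vanishes:
  assumes x: "x \<in> E" and f: "ode_solution a b \<mu> D r f" "\<And>y. y \<in> E \<Longrightarrow> 0 < f y" and y: "\<And>n. y n \<in> E"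
    and side: "(\<forall>n. x < y n) \<and> (\<forall>z\<in>E. \<forall>\<^sub>F n in sequentially. z < y n) \<and> (\<forall>e>0. \<exists>p\<in>E. p < x \<and> f p < e) \<or>
      (\<forall>n. y n < x) \<and> (\<forall>z\<in>E. \<forall>\<^sub>F n in sequentially. y n < z) \<and> (\<forall>e>0. \<exists>p\<in>E. x < p \<and> f p < e)"
  shows "(\<lambda>n. (H (y n) - G (y n)) / f (y n)) \<longlonglongrightarrow> 0"
proof (rule boundary_ratio_tendsto_zero[OF r_pos f x _ _ _ _ y side])
  show "continuous_on E (\<lambda>z. H z - G z)" by (intro continuous_intros continuous_G continuous_H)
  show "dominated x r (\<lambda>z. H z - G z)"
    by (rule dominated_bound[OF x dominated_G[OF x] dominated_H[OF x]]) auto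
  show "AE \<omega> in P x. ((\<lambda>t. exp (- r * t) * (H (X t \<omega>) - G (X t \<omega>))) \<longlongrightarrow> 0) at_top"
    using common_limit[OF x]
  proof eventually_elim
    fix \<omega> assume "\<exists>l. path_limit r G \<omega> l \<and> path_limit r H \<omega> l"
    then obtain l where "path_limit r G \<omega> l" "path_limit r H \<omega> l" by blast
    from tendsto_diff[OF this(2,1)]
    show "((\<lambda>t. exp (- r * t) * (H (X t \<omega>) - G (X t \<omega>))) \<longlongrightarrow> 0) at_top" by (simp add: right_diff_distrib)
  qed
qed (use G_le_H in auto)

lemma ex_right_sequence:
  assumes x: "x \<in> E"
  obtains y :: "nat \<Rightarrow> real" where "\<And>n. y n \<in> E" "\<And>n. x < y n" "\<And>z. z \<in> E \<Longrightarrow> \<forall>\<^sub>F n in sequentially. z < y n"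
proof -
  have "\<forall>n. \<exists>z\<in>E. x < z \<and> real n < Q z" using Q_large[OF x] by blast
  then obtain y where y: "\<And>n. y n \<in> E" "\<And>n. x < y n" "\<And>n. real n < Q (y n)" by metis
  have "\<forall>\<^sub>F n in sequentially. z < y n" if z: "z \<in> E" for z
  proof -
    obtain N where N: "Q z \<le> real N" using real_arch_simple by blast
    have "z < y n" if "N \<le> n" for n
    proof -
      have "Q z < Q (y n)" using N y(3)[of n] that by linarith
      then show ?thesis using Q_less_iff[OF z y(1)] by simp
    qed
    then show ?thesis by (auto simp: eventually_sequentially)
  qed
  then show ?thesis using that y by blast
qed

lemma ex_left_sequence:
  assumes x: "x \<in> E"
  obtains y :: "nat \<Rightarrow> real" where "\<And>n. y n \<in> E" "\<And>n. y n < x" "\<And>z. z \<in> E \<Longrightarrow> \<forall>\<^sub>F n in sequentially. y n < z"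
proof -
  have "\<forall>n. \<exists>z\<in>E. z < x \<and> Q z < 1 / real (Suc n)" using Q_small[OF x] by simp
  then obtain y where y: "\<And>n. y n \<in> E" "\<And>n. y n < x" "\<And>n. Q (y n) < 1 / real (Suc n)" by metis
  have "\<forall>\<^sub>F n in sequentially. y n < z" if z: "z \<in> E" for z
  proof -
    obtain N where N: "1 / real (Suc N) < Q z" using nat_approx_posE[OF Q_pos[OF z]] by blast
    have "y n < z" if "N \<le> n" for n
    proof -
      have "1 / real (Suc n) \<le> 1 / real (Suc N)" using that by (intro divide_left_mono) auto
      then have "Q (y n) < Q z" using N y(3)[of n] by linarith
      then show ?thesis using Q_less_iff[OF y(1) z] by simp
    qed
    then show ?thesis by (auto simp: eventually_sequentially)
  qed
  then show ?thesis using that y by blast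
qed

text \<open>At the right end the comparison function is \<phi>, which vanishes at the left end. The
  transformed gap divides by \<psi> instead, and this brings in the factor \<open>Q\<close>; hence a
  bound proportional to \<open>q\<close>.\<close>

lemma gap_at_infinity:
  assumes e: "0 < e"
  shows "\<exists>q>N. WH q - WG q \<le> e * q"
proof -
  obtain x where x: "x \<in> E" using ex_E by blast
  obtain y where y: "\<And>n. y n \<in> E" "\<And>n. x < y n" "\<And>z. z \<in> E \<Longrightarrow> \<forall>\<^sub>F n in sequentially. z < y n"
    using ex_right_sequence[OF x] by blast
  have "(\<lambda>n. (H (y n) - G (y n)) / \<phi> (y n)) \<longlonglongrightarrow> 0"
    by (rule gap_vanishes[OF x ode_phi phi_pos y(1)]) (use y phi_small[OF x] in auto)
  then have ev: "\<forall>\<^sub>F n in sequentially. (H (y n) - G (y n)) / \<phi> (y n) < e" using e by (rule order_tendstoD)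
  obtain z where z: "z \<in> E" "N < Q z" using Q_large[OF x] by blast
  obtain n where n: "(H (y n) - G (y n)) / \<phi> (y n) < e" "z < y n"
    using eventually_happens[OF eventually_conj[OF ev y(3)[OF z(1)]]] by auto
  have "WH (Q (y n)) - WG (Q (y n)) = (H (y n) - G (y n)) / \<phi> (y n) * Q (y n)"
    using phi_pos[OF y(1)[of n]] by (simp add: transformed_Q[OF y(1)] diff_divide_distrib[symmetric])
  also have "\<dots> \<le> e * Q (y n)" using n(1) Q_pos[OF y(1)[of n]] by (intro mult_right_mono) auto
  finally show ?thesis using z Q_strict_mono[OF z(1) y(1) n(2)] by (intro exI[of _ "Q (y n)"]) auto
qed

text \<open>At the left end the comparison function is \<psi>, the denominator of the transformed
  gap itself, so no factor appears.\<close>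

lemma gap_at_zero:
  assumes e: "0 < e" and d: "0 < d"
  shows "\<exists>p. 0 < p \<and> p < d \<and> WH p - WG p \<le> e"
proof -
  obtain x where x: "x \<in> E" using ex_E by blast
  obtain y where y: "\<And>n. y n \<in> E" "\<And>n. y n < x" "\<And>z. z \<in> E \<Longrightarrow> \<forall>\<^sub>F n in sequentially. y n < z"
    using ex_left_sequence[OF x] by blast
  have "(\<lambda>n. (H (y n) - G (y n)) / \<psi> (y n)) \<longlonglongrightarrow> 0"
    by (rule gap_vanishes[OF x ode_psi psi_pos y(1)]) (use y psi_small[OF x] in auto)
  then have ev: "\<forall>\<^sub>F n in sequentially. (H (y n) - G (y n)) / \<psi> (y n) < e" using e by (rule order_tendstoD)
  obtain z where z: "z \<in> E" "Q z < d" using Q_small[OF x d] by blast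
  obtain n where n: "(H (y n) - G (y n)) / \<psi> (y n) < e" "y n < z"
    using eventually_happens[OF eventually_conj[OF ev y(3)[OF z(1)]]] by auto
  have "WH (Q (y n)) - WG (Q (y n)) = (H (y n) - G (y n)) / \<psi> (y n)"
    by (simp add: transformed_Q[OF y(1)] diff_divide_distrib)
  then show ?thesis using n(1) z Q_strict_mono[OF y(1) z(1) n(2)] Q_pos[OF y(1)[of n]]
    by (intro exI[of _ "Q (y n)"]) auto
qed

text \<open>Multiplying a line in \<open>Q\<close> by \<psi> gives a combination of \<phi> and
  \<psi>, with the slope in front of \<phi> and the intercept in front of \<psi>. Since
  \<open>Q\<close> is increasing, segments correspond to segments.\<close>

lemma barrier_tangent:
  assumes w: "continuous_on {0<..} w" and h: "continuous_on {0<..} h" and b: "line_barrier h w"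
    and x: "x \<in> E" and lt: "w (Q x) < h (Q x)"
  obtains \<alpha> \<beta> where "\<psi> x * w (Q x) = \<alpha> * \<phi> x + \<beta> * \<psi> x"
    "\<And>z. z \<in> E \<Longrightarrow> (\<And>u. u \<in> closed_segment x z \<Longrightarrow> w (Q u) < h (Q u)) \<Longrightarrow>
      \<psi> z * w (Q z) \<le> \<alpha> * \<phi> z + \<beta> * \<psi> z"
proof -
  obtain c where c: "\<And>y. 0 < y \<Longrightarrow> (\<And>t. t \<in> closed_segment (Q x) y \<Longrightarrow> w t < h t) \<Longrightarrow>
      w y \<le> w (Q x) + c * (y - Q x)"
    using line_barrier_tangent[OF w h b Q_pos[OF x] lt] by blast
  show ?thesis
  proof (rule that[of c "w (Q x) - c * Q x"])
    show "\<psi> x * w (Q x) = c * \<phi> x + (w (Q x) - c * Q x) * \<psi> x"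
      using psi_pos[OF x] by (simp add: field_simps)
    fix z assume z: "z \<in> E" and seg: "\<And>u. u \<in> closed_segment x z \<Longrightarrow> w (Q u) < h (Q u)"
    have "w t < h t" if t: "t \<in> closed_segment (Q x) (Q z)" for t
    proof -
      have t0: "0 < t" using t Q_pos[OF x] Q_pos[OF z] by (auto simp: closed_segment_eq_real_ivl split: if_splits)
      have "Qinv t \<in> closed_segment x z"
        using t Qinv_mono[of "Q x" t] Qinv_mono[of t "Q z"] Qinv_mono[of "Q z" t] Qinv_mono[of t "Q x"]
          t0 Q_pos[OF x] Q_pos[OF z] Qinv_Q[OF x] Qinv_Q[OF z]
        by (auto simp: closed_segment_eq_real_ivl split: if_splits)
      from seg[OF this] show ?thesis by (simp only: Q_Qinv[OF t0])
    qed
    then have "w (Q z) \<le> w (Q x) + c * (Q z - Q x)" by (intro c Q_pos z)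
    then have "\<psi> z * w (Q z) \<le> \<psi> z * (w (Q x) + c * (Q z - Q x))"
      using psi_pos[OF z] by (intro mult_left_mono) auto
    also have "\<dots> = c * \<phi> z + (w (Q x) - c * Q x) * \<psi> z" using psi_pos[OF z] by (simp add: algebra_simps)
    finally show "\<psi> z * w (Q z) \<le> c * \<phi> z + (w (Q x) - c * Q x) * \<psi> z" .
  qed
qed

text \<open>The supermartingale half of the game, up to the contact with \<open>h\<close>. It is
  stated for arbitrary \<open>w\<close> and \<open>h\<close> so as to serve the string under the
  upper obstacle and the negated string under the negated lower one.\<close>

lemma barrier_discounted_le:
  fixes w h :: "real \<Rightarrow> real"
  defines "V \<equiv> \<lambda>z. \<psi> z * w (Q z)" and "A \<equiv> {z \<in> E. w (Q z) = h (Q z)}"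
  assumes w: "continuous_on {0<..} w" and h: "continuous_on {0<..} h" and b: "line_barrier h w"
    and le: "\<And>y. 0 < y \<Longrightarrow> w y \<le> h y" and x: "x \<in> E"
    and dom: "dominated x r V" and conv: "AE \<omega> in P x. \<exists>l. path_limit r V \<omega> l"
    and T: "stopping_time F T" and TA: "\<And>\<omega>. T \<omega> \<le> hitting_time X A \<omega>"
  shows "(LINT \<omega>|P x. discounted X r V (T \<omega>) \<omega>) \<le> V x"
proof -
  have Vc: "continuous_on E V"
    unfolding V_def using Q_pos
    by (intro continuous_on_mult continuous_psi continuous_on_compose2[OF w continuous_Q]) auto
  note main = discounted_le_start[OF r_pos ode_phi phi_pos ode_psi psi_pos x Vc dom conv T]
  show ?thesis
  proof (cases "w (Q x) = h (Q x)")
    case True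
    \<comment> \<open>Starting in the contact set forces \<open>T = 0\<close>, so any harmonic
      function with the right value at \<open>x\<close> will do; here it is a multiple of
      \<phi>.\<close>
    show ?thesis
    proof (rule main[of "V x / \<phi> x" 0])
      show "V x = V x / \<phi> x * \<phi> x + 0 * \<psi> x" using phi_pos[OF x] by simp
      show "AE \<omega> in P x. \<forall>t\<ge>0. ennreal t \<le> T \<omega> \<longrightarrow> V (X t \<omega>) \<le> V x / \<phi> x * \<phi> (X t \<omega>) + 0 * \<psi> (X t \<omega>)"
        using start[OF x]
      proof eventually_elim
        fix \<omega> assume X0: "X 0 \<omega> = x"
        then have "hitting_time X A \<omega> = 0" using True x by (intro hitting_time_start) (simp add: A_def)
        then have "T \<omega> = 0" using TA[of \<omega>] by simp
        then show "\<forall>t\<ge>0. ennreal t \<le> T \<omega> \<longrightarrow> V (X t \<omega>) \<le> V x / \<phi> x * \<phi> (X t \<omega>) + 0 * \<psi> (X t \<omega>)"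
          using X0 phi_pos[OF x] by (auto simp: ennreal_eq_0_iff)
      qed
    qed
  next
    case False
    then have "w (Q x) < h (Q x)" using le[OF Q_pos[OF x]] by simp
    then obtain \<alpha> \<beta> where ab: "\<psi> x * w (Q x) = \<alpha> * \<phi> x + \<beta> * \<psi> x"
      "\<And>z. z \<in> E \<Longrightarrow> (\<And>u. u \<in> closed_segment x z \<Longrightarrow> w (Q u) < h (Q u)) \<Longrightarrow>
        \<psi> z * w (Q z) \<le> \<alpha> * \<phi> z + \<beta> * \<psi> z"
      by (rule barrier_tangent[OF w h b x]) blast
    show ?thesis
    proof (rule main[of \<alpha> \<beta>])
      show "V x = \<alpha> * \<phi> x + \<beta> * \<psi> x" using ab(1) by (simp add: V_def)
      show "AE \<omega> in P x. \<forall>t\<ge>0. ennreal t \<le> T \<omega> \<longrightarrow> V (X t \<omega>) \<le> \<alpha> * \<phi> (X t \<omega>) + \<beta> * \<psi> (X t \<omega>)"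
        using start[OF x] AE_space
      proof eventually_elim
        fix \<omega> assume X0: "X 0 \<omega> = x" and "\<omega> \<in> space (P x)"
        then have \<omega>: "\<omega> \<in> space M" by (simp add: space_P x)
        show "\<forall>t\<ge>0. ennreal t \<le> T \<omega> \<longrightarrow> V (X t \<omega>) \<le> \<alpha> * \<phi> (X t \<omega>) + \<beta> * \<psi> (X t \<omega>)"
        proof (intro allI impI)
          fix t :: real assume t: "0 \<le> t" "ennreal t \<le> T \<omega>"
          \<comment> \<open>The path has passed through every point between \<open>x\<close> and its
            present position, all before the hitting time, so the whole segment avoids the contact
            set and the tangent is valid.\<close>
          have before: "V (X s \<omega>) \<le> \<alpha> * \<phi> (X s \<omega>) + \<beta> * \<psi> (X s \<omega>)" if s: "0 \<le> s" "s < t" for s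
            unfolding V_def
          proof (rule ab(2)[OF state_space[OF s(1) \<omega>]])
            fix u assume "u \<in> closed_segment x (X s \<omega>)"
            then obtain s' where s': "0 \<le> s'" "s' \<le> s" "X s' \<omega> = u"
              using closed_segment_path[OF \<omega> s(1), of u] X0 by auto
            have "ennreal s' < ennreal t" using s' s by (simp add: ennreal_less_iff)
            also have "\<dots> \<le> hitting_time X A \<omega>" using t TA[of \<omega>] by (rule_tac order_trans) auto
            finally have "u \<notin> A" using hitting_time_gt[of s' A \<omega>] s' by simp
            moreover have "u \<in> E" using state_space[OF s'(1) \<omega>] s' by simp
            ultimately show "w (Q u) < h (Q u)" using le[OF Q_pos] by (force simp: A_def)
          qed
          \<comment> \<open>At \<open>t\<close> itself the contact set may have been reached, so the
            strict bound that \<open>ab(2)\<close> requires can fail; the inequality is carried over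
            from earlier times by continuity.\<close>
          show "V (X t \<omega>) \<le> \<alpha> * \<phi> (X t \<omega>) + \<beta> * \<psi> (X t \<omega>)"
          proof (cases "t = 0")
            case True
            then show ?thesis using X0 ab(1) by (simp add: V_def)
          next
            case False
            define d where "d s = \<alpha> * \<phi> (X s \<omega>) + \<beta> * \<psi> (X s \<omega>) - V (X s \<omega>)" for s
            have "(\<lambda>s. X s \<omega>) ` {0..t} \<subseteq> E" using state_space[OF _ \<omega>] by auto
            then have "continuous_on {0..t} d"
              unfolding d_def
              by (intro continuous_on_diff continuous_on_add continuous_on_mult continuous_on_const
                  continuous_on_compose2[OF continuous_phi] continuous_on_compose2[OF continuous_psi]
                  continuous_on_compose2[OF Vc] continuous_on_subset[OF continuous_paths[OF \<omega>]]) auto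
            moreover have "closure {0..<t} = {0..t}" using t False by simp
            ultimately have "0 \<le> d t"
              using continuous_ge_on_closure[of "{0..<t}" d t 0] before t by (auto simp: d_def)
            then show ?thesis by (simp add: d_def)
          qed
        qed
      qed
    qed
  qed
qed

text \<open>\<open>V x\<close> separates the payoffs: it bounds them from above when the minimiser
  uses \<open>\<sigma>'\<close> and from below when the maximiser uses \<open>\<tau>'\<close>. In
  both cases the payoff is compared with \<open>V\<close> at the earlier of the two stopping
  times.\<close>

theorem saddle_point_hitting_times:
  assumes x: "x \<in> E"
  shows "saddle_point F (expected_payoff P X r G H x)
    (hitting_time X {x \<in> E. gen_superdifferential WH WG (Q x) \<noteq> {}})
    (hitting_time X {x \<in> E. gen_subdifferential WG WH (Q x) \<noteq> {}})"
proof -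
  note cG = continuous_transformed[OF continuous_G] and cH = continuous_transformed[OF continuous_H]
  obtain w where w: "\<And>y. 0 < y \<Longrightarrow> WG y \<le> w y" "\<And>y. 0 < y \<Longrightarrow> w y \<le> WH y"
    "line_barrier WH w" "line_barrier (\<lambda>y. - WG y) (\<lambda>y. - w y)"
    using ex_double_barrier[of WG WH] WG_le_WH by metis
  have cw: "continuous_on {0<..} w" by (rule double_barrier_continuous[OF cG cH w])
  define V where "V z = \<psi> z * w (Q z)" for z
  have GV: "G z \<le> V z" and VH: "V z \<le> H z" and G_iff: "w (Q z) = WG (Q z) \<longleftrightarrow> V z = G z"
    and H_iff: "w (Q z) = WH (Q z) \<longleftrightarrow> V z = H z" if z: "z \<in> E" for z
    using w(1,2)[OF Q_pos[OF z]] psi_pos[OF z] by (simp_all add: transformed_Q[OF z] V_def field_simps)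
  define A where "A = {z \<in> E. w (Q z) = WG (Q z)}"
  define B where "B = {z \<in> E. w (Q z) = WH (Q z)}"
  have A_eq: "{x \<in> E. gen_superdifferential WH WG (Q x) \<noteq> {}} = A"
    using superdifferential_nonempty_iff[OF cG cH w gap_at_zero gap_at_infinity Q_pos]
    by (auto simp: A_def)
  have B_eq: "{x \<in> E. gen_subdifferential WG WH (Q x) \<noteq> {}} = B"
  proof -
    have "gen_superdifferential (\<lambda>y. - WG y) (\<lambda>y. - WH y) (Q z) \<noteq> {} \<longleftrightarrow> - w (Q z) = - WH (Q z)" if "z \<in> E" for z
      by (rule superdifferential_nonempty_iff)
        (use w cG cH gap_at_zero gap_at_infinity Q_pos[OF that] in \<open>auto intro: continuous_on_minus\<close>)
    then show ?thesis by (auto simp: B_def subdifferential_eq_uminus_superdifferential)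
  qed
  have Vc: "continuous_on E V"
    unfolding V_def using Q_pos
    by (intro continuous_on_mult continuous_psi continuous_on_compose2[OF cw continuous_Q]) auto
  \<comment> \<open>Contact sets are relatively closed in \<open>E\<close>, the form in which
    hitting times are stopping times and are attained.\<close>
  have closed_coincidence: "\<exists>C. closed C \<and> {z \<in> E. V z = g z} = E \<inter> C" if "continuous_on E g" for g
  proof -
    have "closedin (top_of_set E) {z \<in> E. V z = g z}"
      using continuous_closedin_preimage_constant[of E "\<lambda>z. V z - g z" 0] Vc that
      by (simp add: continuous_on_diff)
    then show ?thesis by (auto simp: closedin_closed)
  qed
  have A_V: "A = {z \<in> E. V z = G z}" and B_V: "B = {z \<in> E. V z = H z}" using G_iff H_iff by (auto simp: A_def B_def)
  obtain CA where CA: "closed CA" "A = E \<inter> CA" using closed_coincidence[OF continuous_G] A_V by auto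
  obtain CB where CB: "closed CB" "B = E \<inter> CB" using closed_coincidence[OF continuous_H] B_V by auto
  define \<tau>' where "\<tau>' = hitting_time X A"
  define \<sigma>' where "\<sigma>' = hitting_time X B"
  have st: "stopping_time F \<tau>'" "stopping_time F \<sigma>'"
    unfolding \<tau>'_def \<sigma>'_def using stopping_time_hitting_time CA CB by blast+
  have limits: "AE \<omega> in P x. \<exists>l. path_limit r G \<omega> l \<and> path_limit r H \<omega> l \<and> path_limit r V \<omega> l"
    using common_limit[OF x] AE_space
  proof eventually_elim
    fix \<omega> assume "\<exists>l. path_limit r G \<omega> l \<and> path_limit r H \<omega> l" and "\<omega> \<in> space (P x)"
    then obtain l where l: "path_limit r G \<omega> l" "path_limit r H \<omega> l" and \<omega>: "\<omega> \<in> space M" by (auto simp: space_P x)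
    \<comment> \<open>\<open>V\<close> is squeezed between \<open>G\<close> and \<open>H\<close>
      along the path, which have the common limit \<open>l\<close>.\<close>
    have "path_limit r V \<omega> l"
      by (rule tendsto_sandwich[OF _ _ l]; rule eventually_mono[OF eventually_ge_at_top[of 0]];
          intro mult_left_mono GV VH state_space[OF _ \<omega>]) auto
    with l show "\<exists>l. path_limit r G \<omega> l \<and> path_limit r H \<omega> l \<and> path_limit r V \<omega> l" by blast
  qed
  have domV: "dominated x r V"
    by (rule dominated_bound[OF x dominated_G[OF x] dominated_H[OF x]]) (use GV VH in fastforce)
  have convV: "AE \<omega> in P x. \<exists>l. path_limit r V \<omega> l"
    using limits by eventually_elim blast
  have convG: "AE \<omega> in P x. \<exists>l. path_limit r G \<omega> l"
    using limits by eventually_elim blast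
  have convH: "AE \<omega> in P x. \<exists>l. path_limit r H \<omega> l"
    using limits by eventually_elim blast
  have discV: "integrable (P x) (\<lambda>\<omega>. discounted X r V (T \<omega>) \<omega>)" if "stopping_time F T" for T
    by (rule integrable_discounted[OF x Vc that domV convV])
  have upper: "(LINT \<omega>|P x. discounted X r V (T \<omega>) \<omega>) \<le> V x"
    if "stopping_time F T" "\<And>\<omega>. T \<omega> \<le> \<sigma>' \<omega>" for T
    using barrier_discounted_le[OF cw cH w(3,2) x _ _ that(1)] domV convV that(2)
    unfolding V_def[abs_def] \<sigma>'_def B_def by blast
  \<comment> \<open>The inequality for the negated string, whose upper obstacle is
    \<open>- WG\<close>.\<close>
  have lower: "V x \<le> (LINT \<omega>|P x. discounted X r V (T \<omega>) \<omega>)"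
    if T: "stopping_time F T" "\<And>\<omega>. T \<omega> \<le> \<tau>' \<omega>" for T
  proof -
    have "(LINT \<omega>|P x. discounted X r (\<lambda>z. \<psi> z * - w (Q z)) (T \<omega>) \<omega>) \<le> \<psi> x * - w (Q x)"
    proof (rule barrier_discounted_le[where h = "\<lambda>y. - WG y"])
      show "dominated x r (\<lambda>z. \<psi> z * - w (Q z))"
        using dominated_bound[OF x domV domV] by (simp add: V_def)
      show "AE \<omega> in P x. \<exists>l. ((\<lambda>t. exp (- r * t) * (\<psi> (X t \<omega>) * - w (Q (X t \<omega>)))) \<longlongrightarrow> l) at_top"
        using convV
      proof eventually_elim
        fix \<omega> assume "\<exists>l. path_limit r V \<omega> l"
        then obtain l where "path_limit r V \<omega> l" by blast
        from tendsto_minus[OF this]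
        show "\<exists>l. ((\<lambda>t. exp (- r * t) * (\<psi> (X t \<omega>) * - w (Q (X t \<omega>)))) \<longlongrightarrow> l) at_top"
          by (auto simp: V_def)
      qed
      show "T \<omega> \<le> hitting_time X {z \<in> E. - w (Q z) = - WG (Q z)} \<omega>" for \<omega>
        using T(2)[of \<omega>] by (simp add: \<tau>'_def A_def)
    qed (use cw cG w T x in \<open>auto intro: continuous_on_minus\<close>)
    \<comment> \<open>Negation is exchanged with \<open>discounted\<close> almost surely only:
      without a limit along the path, \<open>Lim\<close> is arbitrary.\<close>
    also have "(LINT \<omega>|P x. discounted X r (\<lambda>z. \<psi> z * - w (Q z)) (T \<omega>) \<omega>) = (LINT \<omega>|P x. - discounted X r V (T \<omega>) \<omega>)"
    proof (rule integral_cong_AE)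
      have "continuous_on E (\<lambda>z. \<psi> z * - w (Q z))" using continuous_on_minus[OF Vc] by (simp add: V_def)
      from measurable_discounted[OF this measurable_stopping[OF T(1)]]
      show "(\<lambda>\<omega>. discounted X r (\<lambda>z. \<psi> z * - w (Q z)) (T \<omega>) \<omega>) \<in> borel_measurable (P x)"
        by (simp add: measurable_P x)
      show "(\<lambda>\<omega>. - discounted X r V (T \<omega>) \<omega>) \<in> borel_measurable (P x)"
        using discV[OF T(1)] by simp
      show "AE \<omega> in P x. discounted X r (\<lambda>z. \<psi> z * - w (Q z)) (T \<omega>) \<omega> = - discounted X r V (T \<omega>) \<omega>"
        using convV
      proof eventually_elim
        fix \<omega> assume "\<exists>l. path_limit r V \<omega> l"
        then obtain l where l: "path_limit r V \<omega> l" by blast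
        have "((\<lambda>t. exp (- r * t) * (\<psi> (X t \<omega>) * - w (Q (X t \<omega>)))) \<longlongrightarrow> - l) at_top"
          using tendsto_minus[OF l] by (simp add: V_def)
        from discounted_top_tendsto[of r "\<lambda>z. \<psi> z * - w (Q z)", OF this] discounted_top_tendsto[OF l]
        show "discounted X r (\<lambda>z. \<psi> z * - w (Q z)) (T \<omega>) \<omega> = - discounted X r V (T \<omega>) \<omega>"
          by (cases "T \<omega> = \<infinity>") (simp_all add: discounted_def V_def)
      qed
    qed
    finally show ?thesis by (simp add: V_def)
  qed
  have payoff_int: "integrable (P x) (\<lambda>\<omega>. if \<tau> \<omega> \<le> \<sigma> \<omega> then discounted X r G (\<tau> \<omega>) \<omega> else discounted X r H (\<sigma> \<omega>) \<omega>)"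
    if st: "stopping_time F \<tau>" "stopping_time F \<sigma>" for \<tau> \<sigma>
  proof -
    note m[measurable] = measurable_stopping[OF st(1)] measurable_stopping[OF st(2)]
    note g = integrable_discounted[OF x continuous_G st(1) dominated_G[OF x] convG]
    note h = integrable_discounted[OF x continuous_H st(2) dominated_H[OF x] convH]
    have p: "Measurable.pred (P x) (\<lambda>\<omega>. \<tau> \<omega> \<le> \<sigma> \<omega>)"
      unfolding pred_def measurable_P[OF x] sets_P[OF x] space_P[OF x] by measurable
    show ?thesis
      by (rule Bochner_Integration.integrable_bound[OF Bochner_Integration.integrable_add[OF integrable_abs[OF g] integrable_abs[OF h]]])
        (use g h p in \<open>auto intro!: measurable_If simp: pred_def\<close>)
  qed
  have R_upper: "expected_payoff P X r G H x \<tau> \<sigma>' \<le> V x" if \<tau>: "stopping_time F \<tau>" for \<tau>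
  proof -
    define T where "T \<omega> = min (\<tau> \<omega>) (\<sigma>' \<omega>)" for \<omega>
    have T: "stopping_time F T" unfolding T_def by (rule stopping_time_min[OF \<tau> st(2)])
    have "expected_payoff P X r G H x \<tau> \<sigma>' \<le> (LINT \<omega>|P x. discounted X r V (T \<omega>) \<omega>)"
      unfolding expected_payoff_def
    proof (rule integral_mono_AE[OF payoff_int[OF \<tau> st(2)] discV[OF T]])
      show "AE \<omega> in P x. (if \<tau> \<omega> \<le> \<sigma>' \<omega> then discounted X r G (\<tau> \<omega>) \<omega> else discounted X r H (\<sigma>' \<omega>) \<omega>)
          \<le> discounted X r V (T \<omega>) \<omega>"
        using limits AE_space
      proof eventually_elim
        fix \<omega> assume "\<exists>l. path_limit r G \<omega> l \<and> path_limit r H \<omega> l \<and> path_limit r V \<omega> l"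
          and "\<omega> \<in> space (P x)"
        then have top: "discounted X r G \<infinity> \<omega> = discounted X r V \<infinity> \<omega>" and \<omega>: "\<omega> \<in> space M"
          using discounted_top_tendsto by (auto simp: space_P x)
        show "(if \<tau> \<omega> \<le> \<sigma>' \<omega> then discounted X r G (\<tau> \<omega>) \<omega> else discounted X r H (\<sigma>' \<omega>) \<omega>)
          \<le> discounted X r V (T \<omega>) \<omega>"
        proof (cases "\<tau> \<omega> \<le> \<sigma>' \<omega>")
          case True
          then have "T \<omega> = \<tau> \<omega>" by (simp add: T_def min_absorb1)
          moreover have "discounted X r G (\<tau> \<omega>) \<omega> \<le> discounted X r V (\<tau> \<omega>) \<omega>"
            using top GV[OF state_space[OF enn2real_nonneg \<omega>], of "\<tau> \<omega>"]
            by (cases "\<tau> \<omega> = \<infinity>") (simp_all add: discounted_def)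
          ultimately show ?thesis using True by simp
        next
          case False
          \<comment> \<open>Since \<open>\<sigma>'\<close> comes strictly first, it is finite, and
            \<open>H\<close> is paid at a contact point, where it equals \<open>V\<close>.\<close>
          then have T\<sigma>: "T \<omega> = \<sigma>' \<omega>" "\<sigma>' \<omega> \<noteq> \<infinity>"
            by (auto simp: T_def min_def not_le)
          then have "X_at \<sigma>' \<omega> \<in> B"
            using hitting_time_value[OF \<omega> CB] by (simp add: \<sigma>'_def less_top)
          then show ?thesis using T\<sigma> False by (simp add: B_V discounted_def)
        qed
      qed
    qed
    also have "\<dots> \<le> V x" by (rule upper[OF T]) (simp add: T_def)
    finally show ?thesis .
  qed
  have R_lower: "V x \<le> expected_payoff P X r G H x \<tau>' \<sigma>" if \<sigma>: "stopping_time F \<sigma>" for \<sigma>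
  proof -
    define T where "T \<omega> = min (\<tau>' \<omega>) (\<sigma> \<omega>)" for \<omega>
    have T: "stopping_time F T" unfolding T_def by (rule stopping_time_min[OF st(1) \<sigma>])
    have "V x \<le> (LINT \<omega>|P x. discounted X r V (T \<omega>) \<omega>)" by (rule lower[OF T]) (simp add: T_def)
    also have "\<dots> \<le> expected_payoff P X r G H x \<tau>' \<sigma>"
      unfolding expected_payoff_def
    proof (rule integral_mono_AE[OF discV[OF T] payoff_int[OF st(1) \<sigma>]])
      show "AE \<omega> in P x. discounted X r V (T \<omega>) \<omega> \<le>
          (if \<tau>' \<omega> \<le> \<sigma> \<omega> then discounted X r G (\<tau>' \<omega>) \<omega> else discounted X r H (\<sigma> \<omega>) \<omega>)"
        using limits AE_space
      proof eventually_elim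
        fix \<omega> assume "\<exists>l. path_limit r G \<omega> l \<and> path_limit r H \<omega> l \<and> path_limit r V \<omega> l"
          and "\<omega> \<in> space (P x)"
        then have top: "discounted X r G \<infinity> \<omega> = discounted X r V \<infinity> \<omega>" and \<omega>: "\<omega> \<in> space M"
          using discounted_top_tendsto by (auto simp: space_P x)
        show "discounted X r V (T \<omega>) \<omega> \<le>
          (if \<tau>' \<omega> \<le> \<sigma> \<omega> then discounted X r G (\<tau>' \<omega>) \<omega> else discounted X r H (\<sigma> \<omega>) \<omega>)"
        proof (cases "\<tau>' \<omega> \<le> \<sigma> \<omega>")
          case True
          then have T\<tau>: "T \<omega> = \<tau>' \<omega>" by (simp add: T_def min_absorb1)
          show ?thesis
          proof (cases "\<tau>' \<omega> = \<infinity>")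
            \<comment> \<open>Neither player stops: the payoff is the limit of \<open>G\<close>,
              which is also that of \<open>V\<close>.\<close>
            case inf: True
            then show ?thesis using True T\<tau> top by simp
          next
            case False
            then have "X_at \<tau>' \<omega> \<in> A"
              using hitting_time_value[OF \<omega> CA] by (simp add: \<tau>'_def less_top)
            then show ?thesis using T\<tau> False True by (simp add: A_V discounted_def)
          qed
        next
          case False
          then have T\<sigma>: "T \<omega> = \<sigma> \<omega>" "\<sigma> \<omega> \<noteq> \<infinity>"
            by (auto simp: T_def min_def not_le)
          then show ?thesis using False VH[OF state_space[OF enn2real_nonneg \<omega>], of "\<sigma> \<omega>"]
            by (simp add: discounted_def)
        qed
      qed
    qed
    finally show ?thesis .
  qed
  \<comment> \<open>With \<open>R\<close> for the payoff,
    \<open>R \<tau> \<sigma>' \<le> V x \<le> R \<tau>' \<sigma>'\<close> and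
    \<open>R \<tau>' \<sigma>' \<le> V x \<le> R \<tau>' \<sigma>\<close>; in particular
    \<open>V x\<close> is the value.\<close>
  have "saddle_point F (expected_payoff P X r G H x) \<tau>' \<sigma>'"
    unfolding saddle_point_def
    using st R_upper R_lower order_trans[OF R_upper R_lower[OF st(2)]] order_trans[OF R_upper[OF st(1)] R_lower] by blast
  then show ?thesis unfolding A_eq B_eq \<tau>'_def \<sigma>'_def .
qed

end

theorem theorem22:
  fixes M :: "'a measure" and F :: "ennreal \<Rightarrow> 'a measure"
    and P :: "real \<Rightarrow> 'a measure" and X :: "real \<Rightarrow> 'a \<Rightarrow> real"
    and a b :: ereal and \<mu> D \<phi> \<psi> G H :: "real \<Rightarrow> real" and r :: real
  defines "I \<equiv> einterval a b"
    and "WG \<equiv> transformed (einterval a b) \<phi> \<psi> G"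
    and "WH \<equiv> transformed (einterval a b) \<phi> \<psi> H"
  assumes "regular_diffusion M F P X a b \<mu> D"
    and "0 < r"
    and "fundamental_solutions a b \<mu> D r \<phi> \<psi>"
    and "continuous_on I G" and "continuous_on I H"
    and "\<And>x. x \<in> I \<Longrightarrow> G x \<le> H x"
    and "\<And>x. x \<in> I \<Longrightarrow>
      (\<integral>\<^sup>+\<omega>. (SUP t\<in>{0..}. ennreal \<bar>exp (- r * t) * G (X t \<omega>)\<bar>) \<partial>P x) < \<infinity>"
    and "\<And>x. x \<in> I \<Longrightarrow>
      (\<integral>\<^sup>+\<omega>. (SUP t\<in>{0..}. ennreal \<bar>exp (- r * t) * H (X t \<omega>)\<bar>) \<partial>P x) < \<infinity>"
    and "\<And>x. x \<in> I \<Longrightarrow>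
      AE \<omega> in P x. \<exists>l. ((\<lambda>t. exp (- r * t) * G (X t \<omega>)) \<longlongrightarrow> l) at_top \<and>
                      ((\<lambda>t. exp (- r * t) * H (X t \<omega>)) \<longlongrightarrow> l) at_top"
  defines "Dplus \<equiv> {x \<in> I. gen_superdifferential WH WG (\<phi> x / \<psi> x) \<noteq> {}}"
    and "Dminus \<equiv> {x \<in> I. gen_subdifferential WG WH (\<phi> x / \<psi> x) \<noteq> {}}"
  shows "\<forall>x\<in>I. nash_equilibrium F (expected_payoff P X r G H x) \<and>
           saddle_point F (expected_payoff P X r G H x) (hitting_time X Dplus) (hitting_time X Dminus)"
proof
  fix x assume x: "x \<in> I"
  interpret diffusion_game M F P X a b \<mu> D \<phi> \<psi> G H r
    using assms(4-12) unfolding I_def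
    by (intro diffusion_game.intro diffusion_game_axioms.intro)
  have "saddle_point F (expected_payoff P X r G H x) (hitting_time X Dplus) (hitting_time X Dminus)"
    using saddle_point_hitting_times[of x] x unfolding Dplus_def Dminus_def I_def WG_def WH_def by simp
  then show "nash_equilibrium F (expected_payoff P X r G H x) \<and>
      saddle_point F (expected_payoff P X r G H x) (hitting_time X Dplus) (hitting_time X Dminus)"
    unfolding nash_equilibrium_def by blast
qed

end
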